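(* Let $p$ be a probability density on $\mathbb{R}^d$, let $f:\mathbb{R}_+\to\mathbb{R}$, and let $(a,b)\in\mathbb{R}^2$. Let $k\in\mathbb{N}$ be fixed with $k>-2a$, and suppose that the estimator function $\phi_k$ of $f$ with parameter $k$ exists and satisfies $|\phi_k(u)|\le C\psi_{a,b}(u)$ for all $u>0$ and some constant $C$. If $p$ satisfies the property $\mathrm{U}(p;k,a)$ and the property $\mathrm{L}(p;\xi,b)$ with $\xi(t)=t^2$, then $$\lim_{m\to\infty}\operatorname{Var}\bigl(\hat T_f^{(k)}(X_1,\ldots,X_m)\bigr)=0.$$
   Context: $\mathrm{Leb}$ is Lebesgue measure on $\mathbb{R}^d$ with Euclidean norm $\|\cdot\|$; $B(x,r)=\{y:\|x-y\|<r\}$; $\upsilon(r)=\mathrm{Leb}(B(0,r))$ and $\varrho(v)$ is the radius of a ball of volume $v$ (the inverse of $\upsilon$). $P$ is the probability measure with density $p$, and $X_1,X_2,\ldots$ are i.i.d. with density $p$. For a finite set of points $A$, $r_k(x|A)$ is the distance from $x$ to its $k$-th nearest neighbor in $A$ (ties broken arbitrarily). Estimator function: $\phi_k(u)=\frac{\Gamma(k)}{u^{k-1}}\mathcal{L}^{-1}\{f(p)/p^k\}(u)$, where $\mathcal{L}^{-1}$ is the inverse of the one-sided Laplace transform; that is, $\phi_k:(0,\infty)\to\mathbb{R}$ is a function with $\int_0^\infty u^{k-1}\phi_k(u)e^{-su}\,du=\Gamma(k)f(s)/s^k$ for all $s>0$. Estimator: for $m\ge k+1$, $U_{km}(X_i)=(m-1)\,\mathrm{Leb}\bigl(B(X_i,r_k(X_i|\{X_j:j\ne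 i\}))\bigr)$ and $\hat T_f^{(k)}(X_1,\ldots,X_m)=\frac1m\sum_{i=1}^m\phi_k(U_{km}(X_i))$. Polynomial envelope: $\psi_{a,b}(u)=u^a$ for $0<u\le1$ and $\psi_{a,b}(u)=u^b$ for $u>1$. For $r>0$ let $M_rp(x)=\sup_{r'\in(0,r]}\frac{P(B(x,r'))}{\mathrm{Leb}(B(x,r'))}$ and $m_rp(x)=\inf_{r'\in(0,r]}\frac{P(B(x,r'))}{\mathrm{Leb}(B(x,r'))}$. Property $\mathrm{U}(p;k,a)$: either $a\ge0$, or $a<0$ and there exists $r>0$ with $\int p(x)(M_rp(x))^k\,dx<\infty$. Property $\mathrm{L}(p;\xi,b)$ (for a non-decreasing $\xi:\mathbb{R}_+\to\mathbb{R}_+$): either $b\le0$, or $b>0$ and there exists $r>0$ with $\int p(x)\,\xi\bigl((m_rp(x))^{-b}\bigr)dx<\infty$, and $$\limsup_{m\to\infty}\ \xi(m^b)\iint_{\|x-y\|>\varrho(\kappa_m/m)}p(x)p(y)\,\xi\bigl(\upsilon(\|x-y\|)^b\bigr)\,dx\,dy<\infty$$ for some sequence $\kappa_m$ with $\kappa_m/m\to\infty$ and $(\ln\kappa_m)/m\to0$ as $m\to\infty$. *)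

theory Defs
  imports "HOL-Probability.Probability"
begin

definition prob_density :: "('a::euclidean_space \<Rightarrow> real) \<Rightarrow> bool" where
  "prob_density p \<longleftrightarrow> p \<in> borel_measurable borel \<and> (\<forall>x. 0 \<le> p x) \<and>
     (\<integral>\<^sup>+ x. ennreal (p x) \<partial>lborel) = 1"

definition law :: "('a::euclidean_space \<Rightarrow> real) \<Rightarrow> 'a measure" where
  "law p = density lborel (\<lambda>x. ennreal (p x))"

definition iid_with_density ::
  "'w measure \<Rightarrow> (nat \<Rightarrow> 'w \<Rightarrow> 'a::euclidean_space) \<Rightarrow> ('a \<Rightarrow> real) \<Rightarrow> bool" where
  "iid_with_density M X p \<longleftrightarrow>
     prob_space.indep_vars M (\<lambda>_. borel) X {1..} \<and>
     (\<forall>i\<ge>1. distributed M lborel (X i) (\<lambda>x. ennreal (p x)))"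

definition ball_volume :: "'a::euclidean_space itself \<Rightarrow> real \<Rightarrow> real" where
  "ball_volume _ r = measure lborel (ball (0::'a) r)"

definition ball_radius :: "'a::euclidean_space itself \<Rightarrow> real \<Rightarrow> real" where
  "ball_radius T v = the_inv_into {0..} (ball_volume T) v"

(* The k-th smallest entry (k \<ge> 1) of the list of distances from x to the points of A, with
   equal distances listed repeatedly. Only meaningful if A is finite with at least k points. *)
definition knn_dist :: "nat \<Rightarrow> 'a::euclidean_space \<Rightarrow> 'a set \<Rightarrow> real" where
  "knn_dist k x A = sorted_list_of_multiset (image_mset (dist x) (mset_set A)) ! (k - 1)"

(* The sample is x 1, ..., x m. *)
definition U_stat :: "nat \<Rightarrow> nat \<Rightarrow> (nat \<Rightarrow> 'a::euclidean_space) \<Rightarrow> nat \<Rightarrow> real" where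
  "U_stat k m x i =
     (real m - 1) * measure lborel (ball (x i) (knn_dist k (x i) (x ` ({1..m} - {i}))))"

definition T_hat ::
  "(real \<Rightarrow> real) \<Rightarrow> nat \<Rightarrow> nat \<Rightarrow> (nat \<Rightarrow> 'a::euclidean_space) \<Rightarrow> real" where
  "T_hat \<phi> k m x = 1 / real m * (\<Sum>i=1..m. \<phi> (U_stat k m x i))"

(* The Laplace-transform identity defining the estimator function; only the values of \<phi> on
   (0, \<infinity>) matter, and the Lebesgue integral is required to exist. *)
definition estimator_function :: "(real \<Rightarrow> real) \<Rightarrow> nat \<Rightarrow> (real \<Rightarrow> real) \<Rightarrow> bool" where
  "estimator_function f k \<phi> \<longleftrightarrow>
     (\<forall>s>0. set_integrable lborel {0<..} (\<lambda>u. u ^ (k - 1) * \<phi> u * exp (- s * u)) \<and>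
            (LBINT u:{0<..}. u ^ (k - 1) * \<phi> u * exp (- s * u)) = Gamma (real k) * f s / s ^ k)"

definition envelope :: "real \<Rightarrow> real \<Rightarrow> real \<Rightarrow> real" where
  "envelope a b u = (if u \<le> 1 then u powr a else u powr b)"

definition upper_density :: "('a::euclidean_space \<Rightarrow> real) \<Rightarrow> real \<Rightarrow> 'a \<Rightarrow> ennreal" where
  "upper_density p r x =
     (SUP r'\<in>{0<..r}. emeasure (law p) (ball x r') / emeasure lborel (ball x r'))"

definition lower_density :: "('a::euclidean_space \<Rightarrow> real) \<Rightarrow> real \<Rightarrow> 'a \<Rightarrow> ennreal" where
  "lower_density p r x =
     (INF r'\<in>{0<..r}. emeasure (law p) (ball x r') / emeasure lborel (ball x r'))"

definition property_U :: "('a::euclidean_space \<Rightarrow> real) \<Rightarrow> nat \<Rightarrow> real \<Rightarrow> bool" where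
  "property_U p k a \<longleftrightarrow> a \<ge> 0 \<or>
     (a < 0 \<and> (\<exists>r>0. (\<integral>\<^sup>+ x. ennreal (p x) * upper_density p r x ^ k \<partial>lborel) < \<infinity>))"

(* \<xi> (m powr (-b)) for b > 0, where m \<in> [0, \<infinity>] is finite in all uses below. Since 0 powr (-b) = 0
   in HOL, the value at m = 0 is set to \<infinity> explicitly. *)
definition xi_neg_powr :: "(real \<Rightarrow> real) \<Rightarrow> real \<Rightarrow> ennreal \<Rightarrow> ennreal" where
  "xi_neg_powr \<xi> b m = (if m = 0 then \<infinity> else ennreal (\<xi> (enn2real m powr (- b))))"

definition property_L ::
  "('a::euclidean_space \<Rightarrow> real) \<Rightarrow> (real \<Rightarrow> real) \<Rightarrow> real \<Rightarrow> bool" where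
  "property_L p \<xi> b \<longleftrightarrow> b \<le> 0 \<or>
     (b > 0 \<and>
      (\<exists>r>0. (\<integral>\<^sup>+ x. ennreal (p x) * xi_neg_powr \<xi> b (lower_density p r x) \<partial>lborel) < \<infinity>) \<and>
      (\<exists>\<kappa> :: nat \<Rightarrow> real.
         filterlim (\<lambda>m. \<kappa> m / real m) at_top sequentially \<and>
         (\<lambda>m. ln (\<kappa> m) / real m) \<longlonglongrightarrow> 0 \<and>
         limsup (\<lambda>m. ennreal (\<xi> (real m powr b)) *
           (\<integral>\<^sup>+ y. (\<integral>\<^sup>+ x. indicator {z. norm (z - y) > ball_radius TYPE('a) (\<kappa> m / real m)} x *
               ennreal (p x * p y * \<xi> (ball_volume TYPE('a) (norm (x - y)) powr b)) \<partial>lborel) \<partial>lborel))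
         < \<infinity>))"

end

theory Submission
  imports Defs "HOL-Real_Asymp.Real_Asymp"
begin

text \<open>
The statistic averages \<open>\<phi>\<close> over the sample, evaluated at the normalised volume of the ball that reaches
the \<open>k\<close>-th nearest neighbour. Its variance is small because a single sample point has little influence.

Let \<open>T\<close> be the statistic of \<open>m\<close> points and \<open>T_l\<close> the same sum without the \<open>l\<close>-th point, but still divided
by \<open>m\<close> and with volumes still multiplied by \<open>m - 1\<close>. By the Efron--Stein inequality the variance of \<open>T\<close> is at
most the sum over \<open>l\<close> of the mean of \<open>(T - T_l)\<^sup>2\<close>. Removing \<open>l\<close> drops the summand of \<open>l\<close> and changes
only the summands of those \<open>i\<close> that have \<open>l\<close> among their \<open>k\<close> nearest neighbours, where the \<open>k\<close>-th
neighbour distance becomes the \<open>(k+1)\<close>-th one of the full sample. A covering of the sphere by small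
caps shows that only boundedly many \<open>i\<close> are affected (\<open>card_reverse_neighbours\<close>), and each \<open>i\<close> is affected
by at most \<open>k\<close> indices \<open>l\<close>. So the variance is at most a constant times \<open>1/m\<close> times the second moments of the
summands for \<open>k\<close> and \<open>k+1\<close> (\<open>variance_bound\<close>). It remains to see that these second
moments are \<open>o(m)\<close> (\<open>phi_moment\<close>), for which only the envelope of \<open>\<phi>\<close> matters.

Write \<open>V\<close> for the normalised volume. The moment of \<open>V powr (2 * a)\<close> over small \<open>V\<close> is bounded, because
\<open>V \<le> t\<close> forces \<open>k\<close> of the other points into one small ball, which has probability of order
\<open>t ^ k\<close> times the \<open>k\<close>-th power of the maximal density, and \<open>k > - 2 * a\<close>. For large \<open>V\<close> with the neighbour
within distance \<open>2 * r\<close>, a Chernoff bound for the number of points in a ball gives an exponential tail in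
\<open>V\<close> times the minimal density; hence a bounded moment. Put \<open>\<beta> = 2 * b\<close>. If the neighbour is further away
than \<open>2 * r\<close>, then nearly all of the \<open>n\<close> other points avoid that ball, and the moment divided by \<open>n\<close> is
at most a constant times the integral of \<open>n powr (\<beta> - 1) * (1 - q x) ^ (n - 1)\<close> against an integrable
function, where \<open>2 * q x\<close> is the mass of the ball of radius \<open>2 * r\<close> around \<open>x\<close>. This tends to zero by dominated
convergence: for \<open>\<beta> \<le> 1\<close> the factor is at most one, and for \<open>\<beta> > 1\<close> the integrability of the negative
power of the minimal density forces \<open>q\<close> to be bounded away from zero (\<open>ball_mass_bounded_below\<close>). The
integrable function is the mean \<open>\<beta>\<close>-th power of the volume of the ball around \<open>x\<close> that reaches an independent
point; the condition on far pairs of points makes it integrable (\<open>pair_moment_finite\<close>).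
\<close>

section \<open>Order statistics of finite families and nearest neighbours\<close>

text \<open>Working with a family \<open>g\<close> over index set \<open>J\<close> counts tied values separately, which makes the
\<open>k\<close>-th smallest value a measurable function of the sample even where sample points coincide.\<close>

definition kth :: "nat \<Rightarrow> ('i \<Rightarrow> real) \<Rightarrow> 'i set \<Rightarrow> real" where
  "kth k g J = sorted_list_of_multiset (image_mset g (mset_set J)) ! (k - 1)"

lemma sorted_nth_iff_length_filter:
  fixes xs :: "'b::linorder list"
  assumes "sorted xs" "i < length xs"
    and mono: "\<And>u v. u \<le> v \<Longrightarrow> P v \<Longrightarrow> P u"
  shows "P (xs ! i) \<longleftrightarrow> i < length (filter P xs)"
  using assms(1,2)
proof (induction xs arbitrary: i)
  case (Cons x xs)
  show ?case
  proof (cases "P x")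
    case True
    then show ?thesis using Cons by (cases i) auto
  next
    case False
    then have no: "\<not> P y" if "y \<in> set (x # xs)" for y
      using that Cons.prems(1) mono by auto
    then have "filter P (x # xs) = []" by (auto simp: filter_empty_conv)
    then show ?thesis using no[of "(x # xs) ! i"] Cons.prems(2) nth_mem by (metis list.size(3) not_less0)
  qed
qed simp

text \<open>Comparing the \<open>k\<close>-th smallest value with a threshold is the same as counting. All further
properties of \<open>kth\<close> follow from this, without reference to sorting.\<close>

lemma kth_downward:
  assumes "finite J" "1 \<le> k" "k \<le> card J"
    and mono: "\<And>u v. u \<le> v \<Longrightarrow> P v \<Longrightarrow> P u"
  shows "P (kth k g J) \<longleftrightarrow> k \<le> card {j \<in> J. P (g j)}"
proof -
  let ?xs = "sorted_list_of_multiset (image_mset g (mset_set J))"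
  have m: "mset ?xs = image_mset g (mset_set J)" by simp
  have len: "length ?xs = card J"
    using m by (metis size_image_mset size_mset size_mset_set)
  have "length (filter P ?xs) = size (filter_mset P (image_mset g (mset_set J)))"
    using m by (metis mset_filter size_mset)
  also have "\<dots> = card {j \<in> J. P (g j)}"
    using assms(1) by (simp add: filter_mset_image_mset)
  finally have "length (filter P ?xs) = card {j \<in> J. P (g j)}" .
  then show ?thesis
    using sorted_nth_iff_length_filter[of ?xs "k - 1" P] assms len
    by (auto simp: kth_def)
qed

lemma kth_le_iff:
  assumes "finite J" "1 \<le> k" "k \<le> card J"
  shows "kth k g J \<le> t \<longleftrightarrow> k \<le> card {j \<in> J. g j \<le> t}"
  using kth_downward[OF assms, of "\<lambda>u. u \<le> t"] by auto

lemma kth_less_iff: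
  assumes "finite J" "1 \<le> k" "k \<le> card J"
  shows "kth k g J < t \<longleftrightarrow> k \<le> card {j \<in> J. g j < t}"
  using kth_downward[OF assms, of "\<lambda>u. u < t"] by auto

text \<open>Beyond the last entry the value is an unspecified constant. Measurability of the estimator also
needs this case, because coinciding sample points leave fewer than \<open>k\<close> distinct ones.\<close>

lemma kth_overflow:
  assumes "finite J" "card J < k"
  shows "kth k g J = [] ! (k - 1 - card J)"
proof -
  let ?xs = "sorted_list_of_multiset (image_mset g (mset_set J))"
  have len: "length ?xs = card J"
    by (metis mset_sorted_list_of_multiset size_image_mset size_mset size_mset_set)
  have "(xs @ []) ! i = [] ! (i - length xs)" if "length xs \<le> i" for xs :: "real list" and i
    using that by (subst nth_append) auto
  from this[of ?xs "k - 1"] len assms show ?thesis by (simp add: kth_def)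
qed

lemma kth_mono:
  assumes "finite J" "1 \<le> k" "k \<le> l" "l \<le> card J"
  shows "kth k g J \<le> kth l g J"
  using kth_le_iff[of J l g "kth l g J"] assms by (subst kth_le_iff) auto

lemma kth_attained:
  assumes "finite J" "1 \<le> k" "k \<le> card J"
  obtains j where "j \<in> J" "kth k g J = g j"
proof -
  let ?xs = "sorted_list_of_multiset (image_mset g (mset_set J))"
  have m: "mset ?xs = image_mset g (mset_set J)" by simp
  have len: "length ?xs = card J"
    using m by (metis size_image_mset size_mset size_mset_set)
  have "kth k g J \<in> set ?xs" unfolding kth_def using len assms by (intro nth_mem) auto
  then have "kth k g J \<in> g ` J" using assms(1) by auto
  then show ?thesis using that by auto
qed

lemma kth_cong:
  assumes "\<And>j. j \<in> J \<Longrightarrow> g j = h j" shows "kth k g J = kth k h J"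
proof (cases "finite J")
  case True
  then have "image_mset g (mset_set J) = image_mset h (mset_set J)"
    using assms by (intro image_mset_cong) auto
  then show ?thesis by (simp add: kth_def)
qed (simp add: kth_def)

text \<open>Deleting an element that is at most the \<open>k\<close>-th value shifts the order statistics by one; deleting
a larger one leaves the \<open>k\<close>-th value alone.\<close>

lemma kth_remove:
  assumes J: "finite J" "l \<in> J" and k: "1 \<le> k" "k < card J"
  shows "kth k g (J - {l}) = (if g l \<le> kth k g J then kth (Suc k) g J else kth k g J)"
proof -
  have c: "k \<le> card (J - {l})" using J k by simp
  have iff: "kth k g (J - {l}) \<le> t \<longleftrightarrow> (if g l \<le> kth k g J then kth (Suc k) g J else kth k g J) \<le> t" for t
  proof -
    have e: "{j \<in> J - {l}. g j \<le> t} = {j \<in> J. g j \<le> t} - {l}" by auto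
    have cc: "card {j \<in> J - {l}. g j \<le> t} = card {j \<in> J. g j \<le> t} - (if g l \<le> t then 1 else 0)"
      unfolding e using J by (auto simp: card_Diff_singleton_if)
    have 1: "kth k g (J - {l}) \<le> t \<longleftrightarrow> k \<le> card {j \<in> J - {l}. g j \<le> t}"
      using J k c by (intro kth_le_iff) auto
    have 2: "kth (Suc k) g J \<le> t \<longleftrightarrow> Suc k \<le> card {j \<in> J. g j \<le> t}"
      using J k by (intro kth_le_iff) auto
    have 3: "kth k g J \<le> t \<longleftrightarrow> k \<le> card {j \<in> J. g j \<le> t}"
      using J k by (intro kth_le_iff) auto
    have mm: "kth k g J \<le> kth (Suc k) g J" using J k by (intro kth_mono) auto
    show ?thesis
    proof (cases "g l \<le> kth k g J")
      case True
      then show ?thesis using 1 2 3 cc mm k by (cases "g l \<le> t") auto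
    next
      case False
      have 4: "k \<le> card {j \<in> J - {l}. g j \<le> kth k g J}"
      proof -
        have "{j \<in> J - {l}. g j \<le> kth k g J} = {j \<in> J. g j \<le> kth k g J}" using False by auto
        then show ?thesis using kth_le_iff[of J k g "kth k g J"] J k by simp
      qed
      have "k \<le> card {j \<in> J - {l}. g j \<le> t}" if "kth k g J \<le> t"
        using 4 that J by (elim order_trans, intro card_mono) auto
      moreover have "k \<le> card {j \<in> J. g j \<le> t}" if "k \<le> card {j \<in> J - {l}. g j \<le> t}"
        using that J by (elim order_trans, intro card_mono) auto
      ultimately show ?thesis using False 1 3 by auto
    qed
  qed
  show ?thesis
    using iff[of "kth k g (J - {l})"] iff[of "(if g l \<le> kth k g J then kth (Suc k) g J else kth k g J)"]
    by (intro antisym) blast+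
qed

lemma kth_remove_affects:
  assumes J: "finite J" "l \<in> J" and k: "1 \<le> k" "k < card J"
    and ne: "kth k g (J - {l}) \<noteq> kth k g J"
  shows "g l \<le> kth k g J" "kth k g (J - {l}) = kth (Suc k) g J"
  using kth_remove[OF J k, of g] ne by (auto split: if_splits)

text \<open>If some deletion changes the \<open>k\<close>-th value, then the \<open>(k+1)\<close>-th value is strictly larger, so exactly \<open>k\<close>
entries are at most the \<open>k\<close>-th one and only these can matter. So ties do no harm.\<close>

lemma card_kth_affects:
  assumes J: "finite J" and k: "1 \<le> k" "k < card J"
  shows "card {l \<in> J. kth k g (J - {l}) \<noteq> kth k g J} \<le> k"
proof (cases "\<exists>l\<in>J. kth k g (J - {l}) \<noteq> kth k g J")
  case True
  then have "kth (Suc k) g J \<noteq> kth k g J" using kth_remove_affects[OF J _ k] by metis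
  then have "kth k g J < kth (Suc k) g J" using kth_mono[of J k "Suc k" g] J k by auto
  then have "\<not> Suc k \<le> card {j \<in> J. g j \<le> kth k g J}"
    using kth_le_iff[of J "Suc k" g "kth k g J"] J k by auto
  moreover have "card {l \<in> J. kth k g (J - {l}) \<noteq> kth k g J} \<le> card {j \<in> J. g j \<le> kth k g J}"
    using kth_remove_affects[OF J _ k] J by (intro card_mono) auto
  ultimately show ?thesis by linarith
next
  case False
  then have "{l \<in> J. kth k g (J - {l}) \<noteq> kth k g J} = {}" by auto
  then show ?thesis by (metis card.empty zero_le)
qed

text \<open>Two points seen from \<open>x\<close> under an angle below 60 degrees: the further one is closer to the other than
to \<open>x\<close>.\<close>

lemma closer_in_cone:
  fixes x y z :: "'a::real_normed_vector"
  assumes "y \<noteq> x" "norm (y - x) \<le> norm (z - x)"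
    and "norm ((y - x) /\<^sub>R norm (y - x) - (z - x) /\<^sub>R norm (z - x)) < 1"
  shows "norm (y - z) < norm (z - x)"
proof -
  define s t u v where "s = norm (y - x)" "t = norm (z - x)"
    "u = (y - x) /\<^sub>R norm (y - x)" "v = (z - x) /\<^sub>R norm (z - x)"
  note d = this
  have s: "s > 0" "s \<le> t" using assms d by auto
  have eq: "y - z = s *\<^sub>R (u - v) - (t - s) *\<^sub>R v"
  proof -
    have "norm (z - x) \<noteq> 0" "norm (y - x) \<noteq> 0" using s by (auto simp: d)
    then have "y - x = s *\<^sub>R u" "z - x = t *\<^sub>R v"
      unfolding d by (metis scaleR_scaleR right_inverse scaleR_one)+
    moreover have "y - z = (y - x) - (z - x)" by simp
    ultimately show ?thesis by (simp only:) (simp add: algebra_simps)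
  qed
  have "norm (z - x) \<noteq> 0" using s by (auto simp: d)
  then have "norm v = 1" by (simp add: d)
  have "norm (y - z) \<le> s * norm (u - v) + (t - s)"
    using norm_triangle_ineq4[of "s *\<^sub>R (u - v)" "(t - s) *\<^sub>R v"] s \<open>norm v = 1\<close> by (simp add: eq)
  also have "\<dots> < s * 1 + (t - s)" using assms(3) s d by (intro add_strict_right_mono mult_strict_left_mono) auto
  finally show ?thesis using d by simp
qed

lemma finite_direction_cover:
  "\<exists>D :: 'a::euclidean_space set. finite D \<and> (\<forall>v. norm v = 1 \<longrightarrow> (\<exists>d\<in>D. norm (v - d) < 1/2))"
proof -
  have "\<exists>D. finite D \<and> D \<subseteq> sphere 0 1 \<and> sphere (0::'a) 1 \<subseteq> (\<Union>x\<in>D. ball x (1/2))"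
    using compact_imp_seq_compact[OF compact_sphere[of "0::'a" 1]]
    by (intro seq_compact_imp_totally_bounded[rule_format]) auto
  then obtain D where D: "finite D" "sphere (0::'a) 1 \<subseteq> (\<Union>x\<in>D. ball x (1/2))" by blast
  have "\<exists>d\<in>D. norm (v - d) < 1/2" if "norm v = 1" for v :: 'a
  proof -
    have "v \<in> (\<Union>x\<in>D. ball x (1/2))" using D(2) that by (auto simp: subset_iff)
    then show ?thesis by (auto simp: dist_norm norm_minus_commute)
  qed
  then show ?thesis using D(1) by blast
qed

definition nn_dist :: "nat \<Rightarrow> (nat \<Rightarrow> 'a::metric_space) \<Rightarrow> nat \<Rightarrow> nat set \<Rightarrow> real" where
  "nn_dist k x i J = kth k (\<lambda>j. dist (x i) (x j)) J"

text \<open>Fix a covering of the unit sphere by caps of diameter less than one. Suppose more than \<open>k\<close> of the points that have \<open>x l\<close>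
among their \<open>k\<close> nearest neighbours lie in the direction of the same cap. The furthest of them has all the
others strictly closer than \<open>x l\<close>, a contradiction.\<close>

lemma card_reverse_neighbours:
  "\<exists>c. \<forall>(x :: nat \<Rightarrow> 'a::euclidean_space) I k l. finite I \<longrightarrow> 1 \<le> k \<longrightarrow> k < card I \<longrightarrow> l \<in> I
       \<longrightarrow> (\<forall>i\<in>I - {l}. x i \<noteq> x l)
       \<longrightarrow> card {i \<in> I - {l}. dist (x i) (x l) \<le> nn_dist k x i (I - {i})} \<le> c * k"
proof -
  obtain D :: "'a set" where D: "finite D" "\<And>v. norm v = 1 \<Longrightarrow> \<exists>d\<in>D. norm (v - d) < 1/2"
    using finite_direction_cover[where 'a = 'a] by auto
  show ?thesis
  proof (intro exI[of _ "card D"] allI impI)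
    fix x :: "nat \<Rightarrow> 'a" and I :: "nat set" and k l :: nat
    assume I: "finite I" "1 \<le> k" "k < card I" "l \<in> I" and "\<forall>i\<in>I - {l}. x i \<noteq> x l"
    then have ne: "\<And>i. i \<in> I - {l} \<Longrightarrow> x i \<noteq> x l" by blast
    define S where "S = {i \<in> I - {l}. dist (x i) (x l) \<le> nn_dist k x i (I - {i})}"
    define e where "e i = (x i - x l) /\<^sub>R norm (x i - x l)" for i
    define Sd where "Sd d = {i \<in> S. norm (e i - d) < 1/2}" for d
    have fS: "finite S" using I by (auto simp: S_def)
    have S: "S = (\<Union>d\<in>D. Sd d)"
    proof -
      have "norm (e i) = 1" if "i \<in> S" for i using ne[of i] that by (auto simp: S_def e_def)
      then show ?thesis using D(2) by (fastforce simp: Sd_def)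
    qed
    have "card (Sd d) \<le> k" if "d \<in> D" for d
    proof (rule ccontr)
      assume *: "\<not> card (Sd d) \<le> k"
      have f: "finite (Sd d)" using fS by (auto simp: Sd_def)
      have "Sd d \<noteq> {}" using * by auto
      define F where "F = (\<lambda>i. norm (x i - x l)) ` Sd d"
      have F: "finite F" "F \<noteq> {}" using f \<open>Sd d \<noteq> {}\<close> by (auto simp: F_def)
      obtain z where z1: "z \<in> Sd d" "Max F = norm (x z - x l)"
        using Max_in[OF F] unfolding F_def by blast
      have z: "z \<in> Sd d" "\<And>i. i \<in> Sd d \<Longrightarrow> norm (x i - x l) \<le> norm (x z - x l)"
        using z1 Max_ge[OF F(1)] by (auto simp: F_def)
      have zS: "z \<in> I - {l}" "dist (x z) (x l) \<le> nn_dist k x z (I - {z})"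
        using z(1) by (auto simp: Sd_def S_def)
      have "Sd d - {z} \<subseteq> {j \<in> I - {z}. dist (x z) (x j) < dist (x z) (x l)}"
      proof
        fix i assume i: "i \<in> Sd d - {z}"
        have "norm (e i - e z) < 1"
          using i z(1) norm_triangle_ineq4[of "e i - d" "e z - d"] by (auto simp: Sd_def)
        then have "norm (x i - x z) < norm (x z - x l)"
          using i z ne[of i] by (intro closer_in_cone) (auto simp: Sd_def S_def e_def)
        then show "i \<in> {j \<in> I - {z}. dist (x z) (x j) < dist (x z) (x l)}"
          using i by (auto simp: Sd_def S_def dist_norm norm_minus_commute)
      qed
      then have "card (Sd d - {z}) \<le> card {j \<in> I - {z}. dist (x z) (x j) < dist (x z) (x l)}"
        using I by (intro card_mono) auto
      moreover have "k \<le> card (Sd d - {z})" using * z(1) f by auto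
      ultimately have "nn_dist k x z (I - {z}) < dist (x z) (x l)"
        unfolding nn_dist_def using I zS by (subst kth_less_iff) auto
      then show False using zS(2) by simp
    qed
    then have "card S \<le> (\<Sum>d\<in>D. k)"
      unfolding S using D(1) by (intro order_trans[OF card_UN_le] sum_mono) auto
    then show "card {i \<in> I - {l}. dist (x i) (x l) \<le> nn_dist k x i (I - {i})} \<le> card D * k"
      by (simp add: S_def)
  qed
qed

section \<open>The Efron--Stein inequality\<close>

lemma (in prob_space) expectation_square_le:
  fixes f :: "'a \<Rightarrow> real"
  assumes "f \<in> borel_measurable M" "integrable M (\<lambda>x. (f x)\<^sup>2)"
  shows "(expectation f)\<^sup>2 \<le> expectation (\<lambda>x. (f x)\<^sup>2)"
proof -
  have "integrable M f" using assms by (rule square_integrable_imp_integrable)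
  then show ?thesis using variance_eq[of f] variance_positive[of f] assms by simp
qed

text \<open>The expectation minimises the mean square deviation from a constant.\<close>

lemma (in prob_space) variance_le_second_moment_about:
  fixes f :: "'a \<Rightarrow> real"
  assumes "f \<in> borel_measurable M" "integrable M (\<lambda>x. (f x)\<^sup>2)"
  shows "expectation (\<lambda>x. (f x)\<^sup>2) - (expectation f)\<^sup>2 \<le> expectation (\<lambda>x. (f x - c)\<^sup>2)"
proof -
  have f: "integrable M f" using assms by (rule square_integrable_imp_integrable)
  have "expectation (\<lambda>x. (f x - c)\<^sup>2) = expectation (\<lambda>x. (f x)\<^sup>2 - 2 * c * f x + c\<^sup>2)"
    by (intro Bochner_Integration.integral_cong) (auto simp: power2_diff)
  also have "\<dots> = expectation (\<lambda>x. (f x)\<^sup>2) - 2 * c * expectation f + c\<^sup>2"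
    using f assms by (simp add: prob_space)
  finally show ?thesis using zero_le_power2[of "expectation f - c"] by (simp add: power2_diff mult_ac)
qed

lemma integrable_square_diff:
  fixes f g :: "'b \<Rightarrow> real"
  assumes "f \<in> borel_measurable N" "g \<in> borel_measurable N"
    and "integrable N (\<lambda>x. (f x)\<^sup>2)" "integrable N (\<lambda>x. (g x)\<^sup>2)"
  shows "integrable N (\<lambda>x. (f x - g x)\<^sup>2)"
proof (rule Bochner_Integration.integrable_bound)
  show "integrable N (\<lambda>x. 2 * ((f x)\<^sup>2 + (g x)\<^sup>2))" using assms by auto
  show "(\<lambda>x. (f x - g x)\<^sup>2) \<in> borel_measurable N" using assms by measurable
  have "(u - v)\<^sup>2 \<le> 2 * (u\<^sup>2 + v\<^sup>2)" for u v :: real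
    using zero_le_power2[of "u + v"] by (simp add: power2_diff power2_sum)
  then show "AE x in N. norm ((f x - g x)\<^sup>2) \<le> norm (2 * ((f x)\<^sup>2 + (g x)\<^sup>2))"
    by (intro AE_I2) (simp add: abs_of_nonneg)
qed

context
  fixes N :: "'a measure"
  assumes N: "prob_space N"
begin

interpretation N: prob_space N by (rule N)

lemma PiM_insert_integral:
  fixes f :: "('i \<Rightarrow> 'a) \<Rightarrow> real"
  assumes I: "finite I" "j \<notin> I" and f: "integrable (PiM (insert j I) (\<lambda>_. N)) f"
  shows "integrable (PiM I (\<lambda>_. N)) (\<lambda>x. \<integral>y. f (x(j := y)) \<partial>N)"
    and "AE x in PiM I (\<lambda>_. N). integrable N (\<lambda>y. f (x(j := y)))"
    and "(\<integral>x. f x \<partial>PiM (insert j I) (\<lambda>_. N)) = (\<integral>x. (\<integral>y. f (x(j := y)) \<partial>N) \<partial>PiM I (\<lambda>_. N))"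
proof -
  interpret PP: product_sigma_finite "\<lambda>_::'i. N" by standard
  interpret pI: prob_space "PiM I (\<lambda>_. N)" by (intro prob_space_PiM N)
  interpret Q: pair_sigma_finite "PiM I (\<lambda>_. N)" N ..
  let ?h = "\<lambda>(x, y). f (x(j := y))"
  have meas[measurable]: "f \<in> borel_measurable (PiM (insert j I) (\<lambda>_. N))" using f by auto
  have [measurable]: "?h \<in> borel_measurable (PiM I (\<lambda>_. N) \<Otimes>\<^sub>M N)" by measurable
  have "(\<integral>\<^sup>+ z. norm (?h z) \<partial>(PiM I (\<lambda>_. N) \<Otimes>\<^sub>M N)) = (\<integral>\<^sup>+ x. \<integral>\<^sup>+ y. norm (f (x(j := y))) \<partial>N \<partial>PiM I (\<lambda>_. N))"
    by (subst N.nn_integral_fst[symmetric]) (auto simp: case_prod_unfold)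
  also have "\<dots> = (\<integral>\<^sup>+ x. norm (f x) \<partial>PiM (insert j I) (\<lambda>_. N))"
    using I by (subst PP.product_nn_integral_insert) auto
  also have "\<dots> < \<infinity>" using f by (simp add: integrable_iff_bounded)
  finally have h: "integrable (PiM I (\<lambda>_. N) \<Otimes>\<^sub>M N) ?h" by (intro integrableI_bounded) auto
  show "integrable (PiM I (\<lambda>_. N)) (\<lambda>x. \<integral>y. f (x(j := y)) \<partial>N)" using Q.integrable_fst'[OF h] by simp
  show "AE x in PiM I (\<lambda>_. N). integrable N (\<lambda>y. f (x(j := y)))" using Q.AE_integrable_fst'[OF h] by simp
  show "(\<integral>x. f x \<partial>PiM (insert j I) (\<lambda>_. N)) = (\<integral>x. (\<integral>y. f (x(j := y)) \<partial>N) \<partial>PiM I (\<lambda>_. N))"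
    by (rule PP.product_integral_insert[OF I f])
qed

lemma PiM_insert_integral_square:
  fixes f :: "('i \<Rightarrow> 'a) \<Rightarrow> real"
  assumes I: "finite I" "j \<notin> I" and f: "f \<in> borel_measurable (PiM (insert j I) (\<lambda>_. N))"
    and f2: "integrable (PiM (insert j I) (\<lambda>_. N)) (\<lambda>x. (f x)\<^sup>2)"
  shows "(\<lambda>x. \<integral>y. f (x(j := y)) \<partial>N) \<in> borel_measurable (PiM I (\<lambda>_. N))"
    and "integrable (PiM I (\<lambda>_. N)) (\<lambda>x. (\<integral>y. f (x(j := y)) \<partial>N)\<^sup>2)"
    and "(\<integral>x. (\<integral>y. f (x(j := y)) \<partial>N)\<^sup>2 \<partial>PiM I (\<lambda>_. N)) \<le> (\<integral>x. (f x)\<^sup>2 \<partial>PiM (insert j I) (\<lambda>_. N))"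
proof -
  interpret pI: prob_space "PiM (insert j I) (\<lambda>_. N)" by (intro prob_space_PiM N)
  have fi: "integrable (PiM (insert j I) (\<lambda>_. N)) f"
    using f f2 by (rule pI.square_integrable_imp_integrable)
  note a = PiM_insert_integral[OF I fi] and b = PiM_insert_integral[OF I f2]
  show m: "(\<lambda>x. \<integral>y. f (x(j := y)) \<partial>N) \<in> borel_measurable (PiM I (\<lambda>_. N))" using a(1) by auto
  have le: "AE x in PiM I (\<lambda>_. N). (\<integral>y. f (x(j := y)) \<partial>N)\<^sup>2 \<le> (\<integral>y. (f (x(j := y)))\<^sup>2 \<partial>N)"
    using a(2) b(2) by eventually_elim (intro N.expectation_square_le, auto)
  show i: "integrable (PiM I (\<lambda>_. N)) (\<lambda>x. (\<integral>y. f (x(j := y)) \<partial>N)\<^sup>2)"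
  proof (rule Bochner_Integration.integrable_bound[OF b(1)])
    show "AE x in PiM I (\<lambda>_. N). norm ((\<integral>y. f (x(j := y)) \<partial>N)\<^sup>2) \<le> norm (\<integral>y. (f (x(j := y)))\<^sup>2 \<partial>N)"
      using le by eventually_elim auto
  qed (use m in measurable)
  show "(\<integral>x. (\<integral>y. f (x(j := y)) \<partial>N)\<^sup>2 \<partial>PiM I (\<lambda>_. N)) \<le> (\<integral>x. (f x)\<^sup>2 \<partial>PiM (insert j I) (\<lambda>_. N))"
    unfolding b(3) using i b(1) le by (rule integral_mono_AE)
qed

text \<open>Here \<open>g i\<close> is any approximation to \<open>T\<close> that does not look at coordinate \<open>i\<close>. Induction over the
index set: the variance splits into the mean of the conditional variance in the new coordinate, which is at
most the mean of \<open>(T - g j)\<^sup>2\<close>, and the variance of the partial integral of \<open>T\<close>. For the latter the induction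
hypothesis applies to the partial integrals of the \<open>g i\<close>, and Jensen's inequality removes the averaging.\<close>

lemma efron_stein:
  fixes T :: "('i \<Rightarrow> 'a) \<Rightarrow> real" and g :: "'i \<Rightarrow> ('i \<Rightarrow> 'a) \<Rightarrow> real"
  assumes "finite I"
    and "T \<in> borel_measurable (PiM I (\<lambda>_. N))" "integrable (PiM I (\<lambda>_. N)) (\<lambda>x. (T x)\<^sup>2)"
    and "\<And>i. i \<in> I \<Longrightarrow> g i \<in> borel_measurable (PiM I (\<lambda>_. N))"
    and "\<And>i. i \<in> I \<Longrightarrow> integrable (PiM I (\<lambda>_. N)) (\<lambda>x. (g i x)\<^sup>2)"
    and "\<And>i x y. i \<in> I \<Longrightarrow> g i (x(i := y)) = g i x"
  shows "(\<integral>x. (T x)\<^sup>2 \<partial>PiM I (\<lambda>_. N)) - (\<integral>x. T x \<partial>PiM I (\<lambda>_. N))\<^sup>2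
         \<le> (\<Sum>i\<in>I. \<integral>x. (T x - g i x)\<^sup>2 \<partial>PiM I (\<lambda>_. N))"
  using assms
proof (induction I arbitrary: T g)
  case empty
  show ?case by (simp add: PiM_empty lebesgue_integral_count_space_finite)
next
  case (insert j I)
  let ?I = "PiM I (\<lambda>_. N)" and ?J = "PiM (insert j I) (\<lambda>_. N)"
  define A where "A x = (\<integral>y. T (x(j := y)) \<partial>N)" for x
  define h where "h i x = (\<integral>y. g i (x(j := y)) \<partial>N)" for i x
  interpret pI: prob_space ?I by (intro prob_space_PiM N)
  interpret pJ: prob_space ?J by (intro prob_space_PiM N)
  note I = insert.hyps(1,2)
  note T = insert.prems(1,2)
  have Ti: "integrable ?J T" using T by (rule pJ.square_integrable_imp_integrable)
  note T1 = PiM_insert_integral[OF I Ti] and T2 = PiM_insert_integral[OF I T(2)]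
  note A = PiM_insert_integral_square[OF I T, folded A_def]
  have gi: "g i \<in> borel_measurable ?J" "integrable ?J (\<lambda>x. (g i x)\<^sup>2)" if "i \<in> insert j I" for i
    using insert.prems(3,4) that by auto
  have d2: "integrable ?J (\<lambda>x. (T x - g i x)\<^sup>2)" if "i \<in> insert j I" for i
    using T gi[OF that] by (intro integrable_square_diff) auto
  note D = PiM_insert_integral[OF I d2]
  have h: "h i \<in> borel_measurable ?I" "integrable ?I (\<lambda>x. (h i x)\<^sup>2)" "h i (x(i := z)) = h i x"
    if "i \<in> I" for i x z
  proof -
    show "h i \<in> borel_measurable ?I" "integrable ?I (\<lambda>x. (h i x)\<^sup>2)"
      using PiM_insert_integral_square[OF I gi, of i] that unfolding h_def[abs_def] by auto
    have "i \<noteq> j" using that I by auto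
    then show "h i (x(i := z)) = h i x"
      using insert.prems(5)[of i] that by (simp add: h_def fun_upd_twist[of i j] del: fun_upd_apply)
  qed
  \<comment> \<open>conditional variance in the new coordinate\<close>
  have first: "(\<integral>x. (T x)\<^sup>2 \<partial>?J) - (\<integral>x. (A x)\<^sup>2 \<partial>?I) \<le> (\<integral>x. (T x - g j x)\<^sup>2 \<partial>?J)"
  proof -
    have gj: "g j (x(j := y)) = g j x" for x y by (rule insert.prems(5)) simp
    have "AE x in ?I. (\<integral>y. (T (x(j := y)))\<^sup>2 \<partial>N) - (A x)\<^sup>2 \<le> (\<integral>y. (T (x(j := y)) - g j (x(j := y)))\<^sup>2 \<partial>N)"
      using T1(2) T2(2) unfolding gj A_def
    proof eventually_elim
      case (elim x)
      show ?case
        by (rule N.variance_le_second_moment_about[OF borel_measurable_integrable[OF elim(1)] elim(2)])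
    qed
    then have "(\<integral>x. (\<integral>y. (T (x(j := y)))\<^sup>2 \<partial>N) - (A x)\<^sup>2 \<partial>?I)
        \<le> (\<integral>x. (\<integral>y. (T (x(j := y)) - g j (x(j := y)))\<^sup>2 \<partial>N) \<partial>?I)"
      using T2(1) A(2) D(1)[of j]
      by (intro integral_mono_AE Bochner_Integration.integrable_diff) (auto simp del: fun_upd_apply)
    then show ?thesis using T2(1,3) A(2) D(3)[of j] by (simp del: fun_upd_apply)
  qed
  \<comment> \<open>variance of the partial integral\<close>
  have second: "(\<integral>x. (A x)\<^sup>2 \<partial>?I) - (\<integral>x. A x \<partial>?I)\<^sup>2 \<le> (\<Sum>i\<in>I. \<integral>x. (A x - h i x)\<^sup>2 \<partial>?I)"
    by (rule insert.IH[OF A(1,2) h])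
  have third: "(\<integral>x. (A x - h i x)\<^sup>2 \<partial>?I) \<le> (\<integral>x. (T x - g i x)\<^sup>2 \<partial>?J)" if i: "i \<in> I" for i
  proof -
    have ij: "i \<in> insert j I" using i by simp
    have gii: "integrable ?J (g i)"
      by (rule pJ.square_integrable_imp_integrable[OF gi[OF ij]])
    have meas: "(\<lambda>x. T x - g i x) \<in> borel_measurable ?J"
      by (rule borel_measurable_diff[OF T(1) gi(1)[OF ij]])
    note S = PiM_insert_integral_square[OF I meas d2[OF ij]]
    have "AE x in ?I. A x - h i x = (\<integral>y. T (x(j := y)) - g i (x(j := y)) \<partial>N)"
      using T1(2) PiM_insert_integral(2)[OF I gii]
    proof eventually_elim
      case (elim x)
      then show ?case unfolding A_def h_def by (rule Bochner_Integration.integral_diff[symmetric])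
    qed
    then have "AE x in ?I. (A x - h i x)\<^sup>2 = (\<integral>y. T (x(j := y)) - g i (x(j := y)) \<partial>N)\<^sup>2"
      by eventually_elim (simp only:)
    then have "(\<integral>x. (A x - h i x)\<^sup>2 \<partial>?I) = (\<integral>x. (\<integral>y. T (x(j := y)) - g i (x(j := y)) \<partial>N)\<^sup>2 \<partial>?I)"
      by (intro integral_cong_AE borel_measurable_power borel_measurable_diff A(1) h(1)[OF i] S(1))
    also have "\<dots> \<le> (\<integral>x. (T x - g i x)\<^sup>2 \<partial>?J)" by (rule S(3))
    finally show ?thesis .
  qed
  have "(\<Sum>i\<in>I. \<integral>x. (A x - h i x)\<^sup>2 \<partial>?I) \<le> (\<Sum>i\<in>I. \<integral>x. (T x - g i x)\<^sup>2 \<partial>?J)"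
    by (intro sum_mono third)
  moreover have "(\<integral>x. T x \<partial>?J) = (\<integral>x. A x \<partial>?I)" using T1(3) by (simp add: A_def)
  ultimately show ?case using first second I by simp
qed

end

section \<open>Numbers of hits in an independent sample\<close>

lemma measurable_card_filter:
  assumes "finite J" "\<And>j. j \<in> J \<Longrightarrow> Measurable.pred M (Q j)"
  shows "(\<lambda>\<omega>. card {j \<in> J. Q j \<omega>}) \<in> measurable M (count_space (UNIV :: nat set))"
proof -
  have "(\<lambda>\<omega>. \<Sum>j\<in>J. if Q j \<omega> then 1 else 0 :: nat) \<in> measurable M (count_space UNIV)"
    using assms
  proof (induction J)
    case (insert j J)
    have [measurable]: "Measurable.pred M (Q j)"
      "(\<lambda>\<omega>. \<Sum>j\<in>J. if Q j \<omega> then 1 else 0 :: nat) \<in> measurable M (count_space UNIV)"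
      using insert by auto
    show ?case using insert(1,2) by simp
  qed simp
  moreover have "(\<Sum>j\<in>J. if Q j \<omega> then 1 else 0 :: nat) = card {j \<in> J. Q j \<omega>}" for \<omega>
    using assms(1) by (simp add: sum.If_cases Int_def)
  ultimately show ?thesis by (simp only:)
qed

lemma measurable_kth:
  assumes J: "finite J" and k: "1 \<le> k" and g: "\<And>j. j \<in> J \<Longrightarrow> g j \<in> borel_measurable M"
  shows "(\<lambda>\<omega>. kth k (\<lambda>j. g j \<omega>) J) \<in> borel_measurable M"
proof -
  show ?thesis
  proof (cases "card J < k")
    case True
    then show ?thesis using kth_overflow[OF J, of k] by simp
  next
    case False
    have "{\<omega> \<in> space M. kth k (\<lambda>j. g j \<omega>) J \<le> t} \<in> sets M" for t
    proof -
      have [measurable]: "(\<lambda>\<omega>. card {j \<in> J. g j \<omega> \<le> t}) \<in> measurable M (count_space UNIV)"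
        using J g by (intro measurable_card_filter) auto
      have "{\<omega> \<in> space M. k \<le> card {j \<in> J. g j \<omega> \<le> t}} \<in> sets M" by measurable
      then show ?thesis using kth_le_iff[OF J k] False by simp
    qed
    then show ?thesis by (rule borel_measurableI_le)
  qed
qed

context
  fixes N :: "'a measure"
  assumes N: "prob_space N"
begin

interpretation N: prob_space N by (rule N)

lemma measurable_hits:
  assumes "finite J" "A \<in> sets N"
  shows "(\<lambda>\<omega>. card {j \<in> J. \<omega> j \<in> A}) \<in> measurable (PiM J (\<lambda>_. N)) (count_space (UNIV :: nat set))"
proof (rule measurable_card_filter[OF assms(1)])
  fix j assume "j \<in> J"
  then have "(\<lambda>\<omega>. \<omega> j) \<in> measurable (PiM J (\<lambda>_. N)) N" by (rule measurable_component_singleton)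
  then show "Measurable.pred (PiM J (\<lambda>_. N)) (\<lambda>\<omega>. \<omega> j \<in> A)"
    by (rule pred_sets2[OF assms(2)])
qed

text \<open>Union bound over the \<open>k\<close>-element subsets of the index set.\<close>

lemma emeasure_many_hits:
  fixes J :: "'i set"
  assumes J: "finite J" and A: "A \<in> sets N"
  shows "emeasure (PiM J (\<lambda>_. N)) {\<omega> \<in> space (PiM J (\<lambda>_. N)). k \<le> card {j \<in> J. \<omega> j \<in> A}}
         \<le> (of_nat (card J) * emeasure N A) ^ k"
proof -
  interpret PP: product_sigma_finite "\<lambda>_::'i. N" by standard
  let ?P = "PiM J (\<lambda>_. N)"
  define E where "E S = (\<Pi>\<^sub>E j\<in>J. if j \<in> S then A else space N)" for S
  define SS where "SS = {S. S \<subseteq> J \<and> card S = k}"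
  have fin: "finite SS" using J by (simp add: SS_def)
  have E: "E S \<in> sets ?P" for S unfolding E_def by (rule sets_PiM_I_finite[OF J]) (simp add: A)
  have eE: "emeasure ?P (E S) = emeasure N A ^ k" if "S \<in> SS" for S
  proof -
    have "emeasure ?P (E S) = (\<Prod>j\<in>J. emeasure N (if j \<in> S then A else space N))"
      unfolding E_def by (rule PP.emeasure_PiM[OF J]) (simp add: A)
    also have "\<dots> = (\<Prod>j\<in>J. if j \<in> S then emeasure N A else 1)"
      by (intro prod.cong) (auto simp: N.emeasure_space_1)
    also have "\<dots> = (\<Prod>j\<in>S. emeasure N A)"
      using that J by (subst prod.inter_restrict[symmetric]) (auto simp: SS_def Int_absorb1)
    finally show ?thesis using that by (simp add: SS_def)
  qed
  have "{\<omega> \<in> space ?P. k \<le> card {j \<in> J. \<omega> j \<in> A}} \<subseteq> (\<Union>S\<in>SS. E S)"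
  proof
    fix \<omega> assume w: "\<omega> \<in> {\<omega> \<in> space ?P. k \<le> card {j \<in> J. \<omega> j \<in> A}}"
    then obtain S where "S \<subseteq> {j \<in> J. \<omega> j \<in> A}" "card S = k"
      using obtain_subset_with_card_n by (metis (no_types, lifting) mem_Collect_eq)
    then have "S \<in> SS" "\<omega> \<in> E S" using w by (auto simp: SS_def E_def space_PiM PiE_iff)
    then show "\<omega> \<in> (\<Union>S\<in>SS. E S)" by blast
  qed
  then have "emeasure ?P {\<omega> \<in> space ?P. k \<le> card {j \<in> J. \<omega> j \<in> A}} \<le> emeasure ?P (\<Union>S\<in>SS. E S)"
    using fin E by (intro emeasure_mono) auto
  also have "\<dots> \<le> (\<Sum>S\<in>SS. emeasure ?P (E S))"
    using fin E by (intro emeasure_subadditive_finite) auto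
  also have "\<dots> = of_nat (card J choose k) * emeasure N A ^ k"
    using eE n_subsets[OF J, of k] by (simp add: SS_def)
  also have "\<dots> \<le> of_nat (card J ^ k) * emeasure N A ^ k"
    by (cases "k \<le> card J") (intro mult_right_mono of_nat_mono binomial_le_pow, auto simp: binomial_eq_0)
  finally show ?thesis by (simp add: power_mult_distrib)
qed

text \<open>Chernoff's argument: \<open>2 ^ k\<close> times the product over \<open>j\<close> of \<open>1 - indicator A (\<omega> j) / 2\<close> equals 2 to the
power of \<open>k\<close> minus the number of hits, hence exceeds 1 on the event, and the coordinates are independent.\<close>

lemma emeasure_few_hits:
  fixes J :: "'i set"
  assumes J: "finite J" and A: "A \<in> sets N"
  shows "emeasure (PiM J (\<lambda>_. N)) {\<omega> \<in> space (PiM J (\<lambda>_. N)). card {j \<in> J. \<omega> j \<in> A} < k}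
         \<le> ennreal (2 ^ k * (1 - measure N A / 2) ^ card J)"
proof -
  interpret PP: product_sigma_finite "\<lambda>_::'i. N" by standard
  let ?P = "PiM J (\<lambda>_. N)"
  define w where "w y = ennreal (1 - indicator A y / 2)" for y
  have w[measurable]: "w \<in> borel_measurable N" unfolding w_def using A by measurable
  have wj: "(\<lambda>\<omega>. w (\<omega> j)) \<in> borel_measurable ?P" if "j \<in> J" for j
    using that by measurable
  have int: "(\<integral>\<^sup>+ y. w y \<partial>N) = ennreal (1 - measure N A / 2)"
  proof -
    have "integrable N (\<lambda>y. 1 - indicator A y / 2 :: real)"
      using A by (intro N.integrable_const_bound[where B = 1]) (auto simp: indicator_def)
    then have "(\<integral>\<^sup>+ y. w y \<partial>N) = ennreal (\<integral> y. 1 - indicator A y / 2 \<partial>N)"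
      unfolding w_def by (intro nn_integral_eq_integral) (auto simp: indicator_def)
    also have "(\<integral> y. 1 - indicator A y / 2 \<partial>N) = 1 - measure N A / 2"
    proof -
      have i: "integrable N (indicator A :: 'a \<Rightarrow> real)"
        using A by (intro N.integrable_const_bound[where B = 1]) (auto simp: indicator_def)
      then show ?thesis using A by (simp add: N.prob_space Int_absorb1 sets.sets_into_space)
    qed
    finally show ?thesis .
  qed
  have le: "indicator {\<omega> \<in> space ?P. card {j \<in> J. \<omega> j \<in> A} < k} \<omega> \<le> ennreal (2 ^ k) * (\<Prod>j\<in>J. w (\<omega> j))" for \<omega>
  proof (cases "card {j \<in> J. \<omega> j \<in> A} < k")
    case True
    have "(\<Prod>j\<in>J. w (\<omega> j)) = ennreal (\<Prod>j\<in>J. 1 - indicator A (\<omega> j) / 2)"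
      unfolding w_def by (intro prod_ennreal) (auto simp: indicator_def)
    also have "(\<Prod>j\<in>J. 1 - indicator A (\<omega> j) / 2 :: real) = (\<Prod>j\<in>J. if \<omega> j \<in> A then 1/2 else 1)"
      by (intro prod.cong) auto
    also have "\<dots> = (1/2) ^ card {j \<in> J. \<omega> j \<in> A}"
      using J by (simp add: prod.If_cases Int_def)
    finally have "ennreal (2 ^ k) * (\<Prod>j\<in>J. w (\<omega> j)) = ennreal (2 ^ k * (1/2) ^ card {j \<in> J. \<omega> j \<in> A})"
      by (simp add: ennreal_mult)
    moreover have "(1::real) \<le> 2 ^ k * (1/2) ^ card {j \<in> J. \<omega> j \<in> A}"
      using True power_increasing[of "card {j \<in> J. \<omega> j \<in> A}" k "2::real"]
      by (simp add: power_one_over divide_simps)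
    ultimately show ?thesis by (auto simp: indicator_def)
  qed auto
  have "emeasure ?P {\<omega> \<in> space ?P. card {j \<in> J. \<omega> j \<in> A} < k}
      = (\<integral>\<^sup>+ \<omega>. indicator {\<omega> \<in> space ?P. card {j \<in> J. \<omega> j \<in> A} < k} \<omega> \<partial>?P)"
    using measurable_hits[OF J A] by (intro nn_integral_indicator[symmetric]) measurable
  also have "\<dots> \<le> (\<integral>\<^sup>+ \<omega>. ennreal (2 ^ k) * (\<Prod>j\<in>J. w (\<omega> j)) \<partial>?P)"
    by (intro nn_integral_mono le)
  also have "\<dots> = ennreal (2 ^ k) * (\<integral>\<^sup>+ \<omega>. (\<Prod>j\<in>J. w (\<omega> j)) \<partial>?P)"
    using wj by (intro nn_integral_cmult) measurable
  also have "(\<integral>\<^sup>+ \<omega>. (\<Prod>j\<in>J. w (\<omega> j)) \<partial>?P) = (\<Prod>j\<in>J. \<integral>\<^sup>+ y. w y \<partial>N)"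
    using J by (intro PP.product_nn_integral_prod) auto
  also have "ennreal (2 ^ k) * \<dots> = ennreal (2 ^ k * (1 - measure N A / 2) ^ card J)"
  proof -
    have "0 \<le> 1 - measure N A / 2" using N.prob_le_1[of A] by linarith
    then show ?thesis using J by (simp add: int ennreal_mult ennreal_power)
  qed
  finally show ?thesis .
qed

text \<open>Fubini for null sets: it is enough to vary one coordinate while the others are frozen.\<close>

lemma AE_PiM_coordinate:
  fixes I :: "'i set"
  assumes I: "finite I" "l \<in> I"
    and Q: "Measurable.pred (PiM I (\<lambda>_. N)) Q"
    and ae: "\<And>x. AE y in N. Q (x(l := y))"
  shows "AE x in PiM I (\<lambda>_. N). Q x"
proof -
  interpret PP: product_sigma_finite "\<lambda>_::'i. N" by standard
  define J where "J = I - {l}"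
  have J: "finite J" "l \<notin> J" "I = insert l J" using I by (auto simp: J_def)
  let ?P = "PiM I (\<lambda>_. N)"
  have N0: "{x \<in> space ?P. \<not> Q x} \<in> sets ?P" using Q by measurable
  then have "emeasure ?P {x \<in> space ?P. \<not> Q x} = (\<integral>\<^sup>+ x. indicator {x \<in> space ?P. \<not> Q x} x \<partial>?P)"
    by (intro nn_integral_indicator[symmetric])
  also have "\<dots> = (\<integral>\<^sup>+ x. (\<integral>\<^sup>+ y. indicator {x \<in> space ?P. \<not> Q x} (x(l := y)) \<partial>N) \<partial>PiM J (\<lambda>_. N))"
    unfolding J(3) using N0[unfolded J(3)] J by (intro PP.product_nn_integral_insert) auto
  also have "\<dots> = (\<integral>\<^sup>+ x. 0 \<partial>PiM J (\<lambda>_. N))"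
  proof (intro nn_integral_cong)
    fix x assume x: "x \<in> space (PiM J (\<lambda>_. N))"
    have "AE y in N. indicator {x \<in> space ?P. \<not> Q x} (x(l := y)) = (0::ennreal)"
      using ae[of x] by eventually_elim (auto simp: indicator_def)
    then have "(\<integral>\<^sup>+ y. indicator {x \<in> space ?P. \<not> Q x} (x(l := y)) \<partial>N) = (\<integral>\<^sup>+ y. 0 \<partial>N)"
      by (rule nn_integral_cong_AE)
    then show "(\<integral>\<^sup>+ y. indicator {x \<in> space ?P. \<not> Q x} (x(l := y)) \<partial>N) = 0" by simp
  qed
  finally have "emeasure ?P {x \<in> space ?P. \<not> Q x} = 0" by simp
  then show ?thesis using N0 by (subst AE_iff_measurable[OF N0 refl]) auto
qed

end

section \<open>Moments of the normalised nearest-neighbour volume around a fixed point\<close>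

lemma measure_ball: "measure lborel (ball (x :: 'a::euclidean_space) r) = ball_volume TYPE('a) r"
  by (cases "0 \<le> r") (simp_all add: ball_volume_def content_ball ball_empty)

lemma emeasure_ball_volume:
  "emeasure lborel (ball (x :: 'a::euclidean_space) r) = ennreal (ball_volume TYPE('a) r)"
  by (cases "0 \<le> r") (simp_all add: ball_volume_def emeasure_ball content_ball ball_empty)

lemma ball_volume_eq:
  "ball_volume TYPE('a::euclidean_space) r = unit_ball_vol DIM('a) * max 0 r ^ DIM('a)"
  by (cases "0 \<le> r") (simp_all add: ball_volume_def content_ball ball_empty max_def)

lemma ball_volume_nonneg [simp]: "0 \<le> ball_volume TYPE('a::euclidean_space) r"
  by (simp add: ball_volume_def)

lemma ball_volume_mono: "r \<le> s \<Longrightarrow> ball_volume TYPE('a::euclidean_space) r \<le> ball_volume TYPE('a) s"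
  by (simp add: ball_volume_eq mult_left_mono power_mono)

lemma ball_volume_strict_mono:
  "0 \<le> r \<Longrightarrow> r < s \<Longrightarrow> ball_volume TYPE('a::euclidean_space) r < ball_volume TYPE('a) s"
  by (simp add: ball_volume_eq mult_strict_left_mono power_strict_mono)

lemma ball_volume_pos_iff [simp]: "0 < ball_volume TYPE('a::euclidean_space) r \<longleftrightarrow> 0 < r"
  by (simp add: ball_volume_def)

lemma ball_volume_0 [simp]: "ball_volume TYPE('a::euclidean_space) 0 = 0"
  by (simp add: ball_volume_def)

lemma ball_volume_scale:
  "0 \<le> c \<Longrightarrow> ball_volume TYPE('a::euclidean_space) (c * r) = c ^ DIM('a) * ball_volume TYPE('a) r"
  by (cases "0 \<le> r") (auto simp: ball_volume_eq max_def power_mult_distrib mult_nonneg_nonpos mult_le_0_iff zero_le_mult_iff)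

lemma ball_volume_surj:
  assumes "0 \<le> v"
  obtains r where "0 \<le> r" "ball_volume TYPE('a::euclidean_space) r = v"
proof
  let ?d = "DIM('a)" and ?w = "unit_ball_vol (real DIM('a))"
  show "0 \<le> root ?d (v / ?w)" using assms by simp
  show "ball_volume TYPE('a) (root ?d (v / ?w)) = v"
    using assms by (simp add: ball_volume_eq max_def real_root_pow_pos2 less_imp_neq[symmetric])
qed

lemma ball_volume_measurable [measurable]: "ball_volume TYPE('a::euclidean_space) \<in> borel_measurable borel"
  unfolding ball_volume_eq[abs_def] by measurable

lemma summable_powr_exp: "summable (\<lambda>j. (real j + 1) powr \<beta> * exp (- real j / 2))"
proof (rule summable_comparison_test_bigo)
  show "summable (\<lambda>j. norm (exp (- 1 / 4 :: real) ^ j))" by (simp add: summable_geometric)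
  have "(\<lambda>j. (real j + 1) powr \<beta> * exp (- real j / 2)) \<in> O(\<lambda>j. exp (- real j / 4))" by real_asymp
  moreover have "exp (- real j / 4) = exp (- 1 / 4) ^ j" for j by (simp flip: exp_of_nat_mult)
  ultimately show "(\<lambda>j. (real j + 1) powr \<beta> * exp (- real j / 2)) \<in> O(\<lambda>j. exp (- 1 / 4) ^ j)" by simp
qed

text \<open>For a sample without coincidences this is the volume \<open>U_km\<close> of the estimator at the point \<open>x\<close>, with
the other sample points listed by \<open>J\<close>.\<close>

definition nn_vol :: "nat \<Rightarrow> 'a::euclidean_space \<Rightarrow> (nat \<Rightarrow> 'a) \<Rightarrow> nat set \<Rightarrow> real" where
  "nn_vol k x \<omega> J = real (card J) * ball_volume TYPE('a) (kth k (\<lambda>j. dist x (\<omega> j)) J)"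

lemma nn_vol_nonneg [simp]: "0 \<le> nn_vol k x \<omega> J" by (simp add: nn_vol_def)

lemma ennreal_term_le_suminf: "(f j :: ennreal) \<le> (\<Sum>i. f i)"
  using sum_le_suminf[of f "{j}"] by simp

context
  fixes N :: "'a::euclidean_space measure" and J :: "nat set" and k :: nat
  assumes N: "prob_space N" and sets_N [measurable_cong]: "sets N = sets borel"
    and J: "finite J" and k: "1 \<le> k" "k \<le> card J"
begin

interpretation N: prob_space N by (rule N)

lemma measurable_kth_dist:
  assumes "finite J'" shows "(\<lambda>\<omega>. kth k (\<lambda>j. dist x (\<omega> j)) J') \<in> borel_measurable (PiM J' (\<lambda>_. N))"
proof (rule measurable_kth[OF assms k(1)])
  fix j assume j: "j \<in> J'"
  then have "(\<lambda>\<omega>. \<omega> j) \<in> borel_measurable (PiM J' (\<lambda>_. N))"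
    using measurable_component_singleton[of j J' "\<lambda>_. N"] by (simp add: measurable_cong_sets[OF refl sets_N])
  then show "(\<lambda>\<omega>. dist x (\<omega> j)) \<in> borel_measurable (PiM J' (\<lambda>_. N))"
    by (intro borel_measurable_dist borel_measurable_const)
qed

lemma measurable_nn_vol: "(\<lambda>\<omega>. nn_vol k x \<omega> J) \<in> borel_measurable (PiM J (\<lambda>_. N))"
  using measurable_kth_dist[OF J] unfolding nn_vol_def by measurable

text \<open>Small volumes: split at the powers of one half. The volume is at most \<open>t\<close> only if \<open>k\<close>, hence \<open>l\<close>, points hit
a ball of volume \<open>2 * t / card J\<close>, and the resulting geometric series converges since \<open>\<alpha> < l\<close>. The
parameter \<open>l\<close> allows the \<open>(k+1)\<close>-th neighbour to be treated under the integrability condition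
for \<open>k\<close>.\<close>

lemma nn_integral_nn_vol_small:
  fixes Mu :: ennreal
  assumes l: "1 \<le> l" "l \<le> k" and \<alpha>: "0 \<le> \<alpha>" "\<alpha> < real l" and r: "0 < r"
    and card: "2 / ball_volume TYPE('a) r \<le> real (card J)"
    and Mu: "\<And>s. 0 < s \<Longrightarrow> s \<le> r \<Longrightarrow> emeasure N (ball x s) \<le> Mu * emeasure lborel (ball x s)"
  shows "(\<integral>\<^sup>+ \<omega>. ennreal (nn_vol k x \<omega> J powr (-\<alpha>)) * indicator {\<omega>. 0 < nn_vol k x \<omega> J \<and> nn_vol k x \<omega> J \<le> 1} \<omega> \<partial>PiM J (\<lambda>_. N))
     \<le> ennreal (\<Sum>j. 2 powr ((real j + 1) * \<alpha>) * (2 * (1/2) ^ j) ^ l) * Mu ^ l"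
proof -
  let ?P = "PiM J (\<lambda>_. N)" and ?V = "\<lambda>\<omega>. nn_vol k x \<omega> J"
  note [measurable] = measurable_nn_vol
  have cpos: "real (card J) > 0" using k by simp
  have pt: "ennreal (?V \<omega> powr (-\<alpha>)) * indicator {\<omega>. 0 < ?V \<omega> \<and> ?V \<omega> \<le> 1} \<omega>
      \<le> (\<Sum>j. ennreal (2 powr ((real j + 1) * \<alpha>)) * indicator {\<omega>. ?V \<omega> \<le> (1/2) ^ j} \<omega>)" for \<omega>
  proof (cases "0 < ?V \<omega> \<and> ?V \<omega> \<le> 1")
    case True
    \<comment> \<open>the dyadic level of the volume, with \<open>(1/2) ^ (j + 1) < v \<le> (1/2) ^ j\<close>\<close>
    define v where "v = ?V \<omega>"
    define j where "j = nat \<lfloor>- log 2 v\<rfloor>"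
    have v: "0 < v" "v \<le> 1" using True by (auto simp: v_def)
    have l0: "- log 2 v \<ge> 0" using v by simp
    then have "real j \<le> - log 2 v" "- log 2 v < real j + 1" by (auto simp: j_def)
    then have a: "log 2 v \<le> - real j" "- (real j + 1) < log 2 v" by auto
    have v2: "v = 2 powr (log 2 v)" using v by simp
    have "v \<le> 2 powr (- real j)" using a(1) v2 by (metis powr_mono one_le_numeral)
    then have 1: "v \<le> (1/2) ^ j" by (simp add: powr_minus powr_realpow power_one_over inverse_eq_divide)
    have "v powr (-\<alpha>) = 2 powr (- log 2 v * \<alpha>)" by (subst v2) (simp add: powr_powr)
    also have "\<dots> \<le> 2 powr ((real j + 1) * \<alpha>)"
      using a(2) \<alpha> by (intro powr_mono mult_right_mono) auto
    finally have "ennreal (?V \<omega> powr (-\<alpha>)) * indicator {\<omega>. 0 < ?V \<omega> \<and> ?V \<omega> \<le> 1} \<omega>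
      \<le> ennreal (2 powr ((real j + 1) * \<alpha>)) * indicator {\<omega>. ?V \<omega> \<le> (1/2) ^ j} \<omega>"
      using 1 v by (simp add: v_def ennreal_leI)
    also have "\<dots> \<le> (\<Sum>j. ennreal (2 powr ((real j + 1) * \<alpha>)) * indicator {\<omega>. ?V \<omega> \<le> (1/2) ^ j} \<omega>)"
      by (rule ennreal_term_le_suminf)
    finally show ?thesis .
  qed auto
  have ev: "emeasure ?P {\<omega> \<in> space ?P. ?V \<omega> \<le> t} \<le> ennreal ((2 * t) ^ l) * Mu ^ l" if t: "0 < t" "t \<le> 1" for t
  proof -
    \<comment> \<open>The factor 2 makes the distance strictly smaller than \<open>s\<close>, as the open ball requires.\<close>
    obtain s where s: "0 \<le> s" "ball_volume TYPE('a) s = 2 * t / card J"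
      using t by (elim ball_volume_surj[of "2 * t / card J", rotated]) auto
    have "0 < ball_volume TYPE('a) s" unfolding s(2) using t cpos by simp
    then have s0: "0 < s" by simp
    have "2 * t / card J \<le> 2 / card J" using t cpos by (intro divide_right_mono) auto
    also have "\<dots> \<le> ball_volume TYPE('a) r" using card r cpos by (simp add: field_simps)
    finally have "\<not> ball_volume TYPE('a) r < ball_volume TYPE('a) s" using s by simp
    then have sr: "s \<le> r" using ball_volume_strict_mono[where 'a = 'a, of r s] r by linarith
    have "l \<le> card {j \<in> J. \<omega> j \<in> ball x s}" if "?V \<omega> \<le> t" for \<omega>
    proof -
      have "kth k (\<lambda>j. dist x (\<omega> j)) J < s"
      proof (rule ccontr)
        assume "\<not> ?thesis"
        then have "ball_volume TYPE('a) s \<le> ball_volume TYPE('a) (kth k (\<lambda>j. dist x (\<omega> j)) J)"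
          by (intro ball_volume_mono) simp
        then have "2 * t \<le> ?V \<omega>" unfolding s(2) nn_vol_def using cpos by (simp add: field_simps)
        then show False using that t by simp
      qed
      then show ?thesis using kth_less_iff[OF J k] l by (auto simp: ball_def)
    qed
    then have "emeasure ?P {\<omega> \<in> space ?P. ?V \<omega> \<le> t} \<le> emeasure ?P {\<omega> \<in> space ?P. l \<le> card {j \<in> J. \<omega> j \<in> ball x s}}"
      using measurable_hits[OF N J, of "ball x s"] by (intro emeasure_mono) (auto simp: sets_N)
    also have "\<dots> \<le> (of_nat (card J) * emeasure N (ball x s)) ^ l"
      by (intro emeasure_many_hits[OF N J]) (simp add: sets_N)
    also have "\<dots> \<le> (of_nat (card J) * (Mu * ennreal (2 * t / card J))) ^ l"
      using Mu[OF s0 sr] by (intro power_mono mult_left_mono) (auto simp: emeasure_ball_volume s(2))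
    also have "of_nat (card J) * (Mu * ennreal (2 * t / card J)) = ennreal (2 * t) * Mu"
      using cpos t by (simp add: mult_ac ennreal_of_nat_eq_real_of_nat flip: ennreal_mult)
    finally show ?thesis using t by (simp add: power_mult_distrib ennreal_power)
  qed
  have "(\<integral>\<^sup>+ \<omega>. ennreal (?V \<omega> powr (-\<alpha>)) * indicator {\<omega>. 0 < ?V \<omega> \<and> ?V \<omega> \<le> 1} \<omega> \<partial>?P)
      \<le> (\<integral>\<^sup>+ \<omega>. (\<Sum>j. ennreal (2 powr ((real j + 1) * \<alpha>)) * indicator {\<omega>. ?V \<omega> \<le> (1/2) ^ j} \<omega>) \<partial>?P)"
    by (intro nn_integral_mono pt)
  also have "\<dots> = (\<Sum>j. \<integral>\<^sup>+ \<omega>. ennreal (2 powr ((real j + 1) * \<alpha>)) * indicator {\<omega> \<in> space ?P. ?V \<omega> \<le> (1/2) ^ j} \<omega> \<partial>?P)"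
    by (subst nn_integral_suminf[symmetric]) (auto intro!: nn_integral_cong simp: indicator_def)
  also have "\<dots> = (\<Sum>j. ennreal (2 powr ((real j + 1) * \<alpha>)) * emeasure ?P {\<omega> \<in> space ?P. ?V \<omega> \<le> (1/2) ^ j})"
    by (intro suminf_cong nn_integral_cmult_indicator) measurable
  also have "\<dots> \<le> (\<Sum>j. ennreal (2 powr ((real j + 1) * \<alpha>)) * (ennreal ((2 * (1/2) ^ j) ^ l) * Mu ^ l))"
    by (intro suminf_le mult_left_mono ev) (auto simp: power_le_one)
  also have "\<dots> = (\<Sum>j. ennreal (2 powr ((real j + 1) * \<alpha>) * (2 * (1/2) ^ j) ^ l)) * Mu ^ l"
    by (simp add: ennreal_mult mult.assoc flip: ennreal_suminf_multc)
  also have "(\<Sum>j. ennreal (2 powr ((real j + 1) * \<alpha>) * (2 * (1/2) ^ j) ^ l))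
      = ennreal (\<Sum>j. 2 powr ((real j + 1) * \<alpha>) * (2 * (1/2) ^ j) ^ l)"
  proof (rule suminf_ennreal2)
    have eq: "2 powr ((real j + 1) * \<alpha>) * (2 * (1/2) ^ j) ^ l = 2 powr (\<alpha> + real l) * (2 powr (\<alpha> - real l)) ^ j" for j
    proof -
      have "(2 * (1/2) ^ j) ^ l = (2 powr (1 - real j)) powr real l"
        by (simp add: powr_realpow powr_diff power_one_over inverse_eq_divide)
      then show ?thesis
        by (simp add: powr_powr powr_realpow[symmetric] powr_add[symmetric] algebra_simps)
    qed
    have "(2::real) powr (\<alpha> - real l) < 1" using powr_less_mono[of "\<alpha> - real l" 0 2] \<alpha> by simp
    then show "summable (\<lambda>j. 2 powr ((real j + 1) * \<alpha>) * (2 * (1/2) ^ j) ^ l)"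
      unfolding eq by (intro summable_mult summable_geometric) simp
  qed auto
  finally show ?thesis .
qed

text \<open>Large volumes at distance at most \<open>R\<close>: if \<open>\<mu>\<close> bounds the density of the ball masses from below, then
\<open>\<mu> * V\<close> has an exponential tail that depends neither on \<open>\<mu>\<close> nor on the sample size.\<close>

lemma nn_integral_nn_vol_near:
  assumes \<beta>: "0 < \<beta>" and \<mu>: "0 < \<mu>"
    and lower: "\<And>s. 0 < s \<Longrightarrow> s \<le> R \<Longrightarrow> \<mu> * ball_volume TYPE('a) s \<le> measure N (ball x s)"
  shows "(\<integral>\<^sup>+ \<omega>. ennreal (nn_vol k x \<omega> J powr \<beta>) * indicator {\<omega>. kth k (\<lambda>j. dist x (\<omega> j)) J \<le> R} \<omega> \<partial>PiM J (\<lambda>_. N))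
     \<le> ennreal (\<mu> powr (-\<beta>) * (2 ^ k * (\<Sum>j. (real j + 1) powr \<beta> * exp (- real j / 2))))"
proof -
  let ?P = "PiM J (\<lambda>_. N)" and ?V = "\<lambda>\<omega>. nn_vol k x \<omega> J" and ?D = "\<lambda>\<omega>. kth k (\<lambda>j. dist x (\<omega> j)) J"
  note [measurable] = measurable_nn_vol measurable_kth_dist[OF J]
  have cpos: "real (card J) > 0" using k by simp
  define A where "A j = {\<omega> \<in> space ?P. real j < \<mu> * ?V \<omega> \<and> ?D \<omega> \<le> R}" for j :: nat
  have A[measurable]: "A j \<in> sets ?P" for j unfolding A_def by measurable
  have pt: "ennreal (?V \<omega> powr \<beta>) * indicator {\<omega>. ?D \<omega> \<le> R} \<omega>
      \<le> ennreal (\<mu> powr (-\<beta>)) * (\<Sum>j. ennreal ((real j + 1) powr \<beta>) * indicator (A j) \<omega>)"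
    if sp: "\<omega> \<in> space ?P" for \<omega>
  proof (cases "0 < ?V \<omega> \<and> ?D \<omega> \<le> R")
    case True
    define v where "v = \<mu> * ?V \<omega>"
    have v: "0 < v" using True \<mu> by (simp add: v_def)
    \<comment> \<open>\<open>j < v \<le> j + 1\<close>\<close>
    define j where "j = nat (\<lceil>v\<rceil> - 1)"
    have j: "real j < v" "v \<le> real j + 1" using v unfolding j_def by linarith+
    have "?V \<omega> powr \<beta> = \<mu> powr (-\<beta>) * v powr \<beta>"
      using \<mu> True by (simp add: v_def powr_mult powr_minus)
    also have "\<dots> \<le> \<mu> powr (-\<beta>) * (real j + 1) powr \<beta>"
      using v j \<beta> by (intro mult_left_mono powr_mono2) auto
    finally have "ennreal (?V \<omega> powr \<beta>) * indicator {\<omega>. ?D \<omega> \<le> R} \<omega>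
        \<le> ennreal (\<mu> powr (-\<beta>)) * (ennreal ((real j + 1) powr \<beta>) * indicator (A j) \<omega>)"
      using True j(1) sp by (simp add: A_def v_def ennreal_leI flip: ennreal_mult)
    also have "\<dots> \<le> ennreal (\<mu> powr (-\<beta>)) * (\<Sum>j. ennreal ((real j + 1) powr \<beta>) * indicator (A j) \<omega>)"
      by (intro mult_left_mono ennreal_term_le_suminf) auto
    finally show ?thesis .
  next
    case False
    then have "?V \<omega> = 0 \<or> \<not> ?D \<omega> \<le> R" using nn_vol_nonneg[of k x \<omega> J] by linarith
    then show ?thesis by (auto simp: indicator_def)
  qed
  have ev: "emeasure ?P (A j) \<le> ennreal (2 ^ k * exp (- real j / 2))" for j
  proof -
    obtain s where s: "0 \<le> s" "ball_volume TYPE('a) s = real j / (\<mu> * card J)"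
      using \<mu> by (elim ball_volume_surj[of "real j / (\<mu> * card J)", rotated]) auto
    have far: "s < ?D \<omega>" if "\<omega> \<in> A j" for \<omega>
    proof (rule ccontr)
      assume "\<not> s < ?D \<omega>"
      then have "ball_volume TYPE('a) (?D \<omega>) \<le> ball_volume TYPE('a) s" by (intro ball_volume_mono) simp
      then have "\<mu> * ?V \<omega> \<le> real j" unfolding s(2) nn_vol_def using cpos \<mu> by (simp add: field_simps)
      then show False using that by (simp add: A_def)
    qed
    show ?thesis
    proof (cases "s < R")
      case False
      then have "A j = {}" using far by (force simp: A_def)
      then show ?thesis by simp
    next
      case True
      have q: "real j \<le> card J * measure N (ball x s)"
      proof (cases "s = 0")
        case True
        then have "real j / (\<mu> * card J) = 0" using s(2) by simp
        then show ?thesis using \<mu> cpos by simp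
      next
        case False
        then have "\<mu> * ball_volume TYPE('a) s \<le> measure N (ball x s)" using s True by (intro lower) auto
        then show ?thesis unfolding s(2) using cpos \<mu> by (simp add: field_simps)
      qed
      have "A j \<subseteq> {\<omega> \<in> space ?P. card {j \<in> J. \<omega> j \<in> ball x s} < k}"
      proof
        fix \<omega> assume w: "\<omega> \<in> A j"
        have "\<not> k \<le> card {j \<in> J. dist x (\<omega> j) < s}" using far[OF w] by (subst kth_less_iff[OF J k, symmetric]) simp
        then show "\<omega> \<in> {\<omega> \<in> space ?P. card {j \<in> J. \<omega> j \<in> ball x s} < k}" using w by (auto simp: A_def ball_def)
      qed
      then have "emeasure ?P (A j) \<le> emeasure ?P {\<omega> \<in> space ?P. card {j \<in> J. \<omega> j \<in> ball x s} < k}"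
        using measurable_hits[OF N J, of "ball x s"] by (intro emeasure_mono) (auto simp: sets_N)
      also have "\<dots> \<le> ennreal (2 ^ k * (1 - measure N (ball x s) / 2) ^ card J)"
        by (intro emeasure_few_hits[OF N J]) (simp add: sets_N)
      also have "\<dots> \<le> ennreal (2 ^ k * exp (- real j / 2))"
      proof (intro ennreal_leI mult_left_mono)
        have "(1 - measure N (ball x s) / 2) ^ card J \<le> exp (- measure N (ball x s) / 2) ^ card J"
        proof (rule power_mono)
          show "1 - measure N (ball x s) / 2 \<le> exp (- measure N (ball x s) / 2)"
            using exp_ge_add_one_self[of "- measure N (ball x s) / 2"] by simp
          show "0 \<le> 1 - measure N (ball x s) / 2" using N.prob_le_1[of "ball x s"] by linarith
        qed
        also have "\<dots> = exp (- (card J * measure N (ball x s)) / 2)" by (simp flip: exp_of_nat_mult)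
        also have "\<dots> \<le> exp (- real j / 2)" using q by simp
        finally show "(1 - measure N (ball x s) / 2) ^ card J \<le> exp (- real j / 2)" .
      qed auto
      finally show ?thesis .
    qed
  qed
  have "(\<integral>\<^sup>+ \<omega>. ennreal (?V \<omega> powr \<beta>) * indicator {\<omega>. ?D \<omega> \<le> R} \<omega> \<partial>?P)
      \<le> (\<integral>\<^sup>+ \<omega>. ennreal (\<mu> powr (-\<beta>)) * (\<Sum>j. ennreal ((real j + 1) powr \<beta>) * indicator (A j) \<omega>) \<partial>?P)"
    by (intro nn_integral_mono pt)
  also have "\<dots> = ennreal (\<mu> powr (-\<beta>)) * (\<Sum>j. ennreal ((real j + 1) powr \<beta>) * emeasure ?P (A j))"
    by (simp add: nn_integral_cmult nn_integral_suminf nn_integral_cmult_indicator)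
  also have "\<dots> \<le> ennreal (\<mu> powr (-\<beta>)) * (\<Sum>j. ennreal ((real j + 1) powr \<beta>) * ennreal (2 ^ k * exp (- real j / 2)))"
    by (intro suminf_le mult_left_mono ev) auto
  also have "(\<Sum>j. ennreal ((real j + 1) powr \<beta>) * ennreal (2 ^ k * exp (- real j / 2)))
      = (\<Sum>j. ennreal (2 ^ k * ((real j + 1) powr \<beta> * exp (- real j / 2))))"
    by (intro suminf_cong) (simp add: mult_ac flip: ennreal_mult)
  also have "\<dots> = ennreal (\<Sum>j. 2 ^ k * ((real j + 1) powr \<beta> * exp (- real j / 2)))"
    by (intro suminf_ennreal2 summable_mult summable_powr_exp) auto
  also have "(\<Sum>j. 2 ^ k * ((real j + 1) powr \<beta> * exp (- real j / 2))) = 2 ^ k * (\<Sum>j. (real j + 1) powr \<beta> * exp (- real j / 2))"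
    by (intro suminf_mult summable_powr_exp)
  finally have "(\<integral>\<^sup>+ \<omega>. ennreal (?V \<omega> powr \<beta>) * indicator {\<omega>. ?D \<omega> \<le> R} \<omega> \<partial>?P)
      \<le> ennreal (\<mu> powr (-\<beta>)) * ennreal (2 ^ k * (\<Sum>j. (real j + 1) powr \<beta> * exp (- real j / 2)))" .
  moreover have "0 \<le> 2 ^ k * (\<Sum>j. (real j + 1) powr \<beta> * exp (- real j / 2))"
    by (intro mult_nonneg_nonneg suminf_nonneg[OF summable_powr_exp]) auto
  ultimately show ?thesis by (simp only: ennreal_mult powr_ge_zero)
qed

text \<open>If the neighbour is further away than \<open>R\<close>, its distance is at most that of one of \<open>k\<close>
fixed sample points. Apart from that point, at most \<open>k - 1\<close> of the remaining ones hit the ball of radius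
\<open>R\<close>; this event is independent of the distance in question.\<close>

lemma nn_integral_nn_vol_far:
  assumes \<beta>: "0 < \<beta>"
  shows "(\<integral>\<^sup>+ \<omega>. ennreal (nn_vol k x \<omega> J powr \<beta>) * indicator {\<omega>. R < kth k (\<lambda>j. dist x (\<omega> j)) J} \<omega> \<partial>PiM J (\<lambda>_. N))
     \<le> ennreal (real (card J) powr \<beta> * (real k * 2 ^ k * (1 - measure N (ball x R) / 2) ^ (card J - 1)))
        * (\<integral>\<^sup>+ y. ennreal (ball_volume TYPE('a) (dist x y) powr \<beta>) \<partial>N)"
proof -
  interpret PP: product_sigma_finite "\<lambda>_::nat. N" by standard
  let ?P = "PiM J (\<lambda>_. N)" and ?V = "\<lambda>\<omega>. nn_vol k x \<omega> J" and ?D = "\<lambda>\<omega>. kth k (\<lambda>j. dist x (\<omega> j)) J"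
  let ?v = "\<lambda>y. ennreal (ball_volume TYPE('a) (dist x y) powr \<beta>)"
  define B where "B j = {\<omega> \<in> space (PiM (J - {j}) (\<lambda>_. N)). card {i \<in> J - {j}. \<omega> i \<in> ball x R} < k}" for j
  have B: "B j \<in> sets (PiM (J - {j}) (\<lambda>_. N))" for j
  proof -
    have [measurable]: "(\<lambda>\<omega>. card {i \<in> J - {j}. \<omega> i \<in> ball x R}) \<in> measurable (PiM (J - {j}) (\<lambda>_. N)) (count_space (UNIV :: nat set))"
      using J by (intro measurable_hits[OF N]) (auto simp: sets_N)
    show ?thesis unfolding B_def by measurable
  qed
  obtain J0 where J0: "J0 \<subseteq> J" "card J0 = k" using obtain_subset_with_card_n[OF k(2)] by metis
  have pt: "ennreal (?V \<omega> powr \<beta>) * indicator {\<omega>. R < ?D \<omega>} \<omega>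
     \<le> ennreal (card J powr \<beta>) * (\<Sum>j\<in>J0. ?v (\<omega> j) * indicator (B j) (restrict \<omega> (J - {j})))" if sp: "\<omega> \<in> space ?P" for \<omega>
  proof (cases "R < ?D \<omega>")
    case True
    have "\<exists>j\<in>J0. ?D \<omega> \<le> dist x (\<omega> j)"
    proof (rule ccontr)
      assume "\<not> ?thesis"
      then have "J0 \<subseteq> {j \<in> J. dist x (\<omega> j) < ?D \<omega>}" using J0 by auto
      then have "card J0 \<le> card {j \<in> J. dist x (\<omega> j) < ?D \<omega>}" using J by (intro card_mono) auto
      then have "k \<le> card {j \<in> J. dist x (\<omega> j) < ?D \<omega>}" using J0 by simp
      then have "?D \<omega> < ?D \<omega>" by (subst kth_less_iff[OF J k])
      then show False by simp
    qed
    then obtain j where j: "j \<in> J0" "?D \<omega> \<le> dist x (\<omega> j)" by blast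
    have "card {i \<in> J - {j}. \<omega> i \<in> ball x R} \<le> card {i \<in> J. dist x (\<omega> i) < R}"
      using J by (intro card_mono) auto
    moreover have "\<not> k \<le> card {i \<in> J. dist x (\<omega> i) < R}" using True by (subst kth_less_iff[OF J k, symmetric]) simp
    moreover have "{i \<in> J - {j}. restrict \<omega> (J - {j}) i \<in> ball x R} = {i \<in> J - {j}. \<omega> i \<in> ball x R}" by auto
    ultimately have inB: "restrict \<omega> (J - {j}) \<in> B j"
      using sp by (auto simp: B_def space_PiM PiE_iff)
    have "?V \<omega> powr \<beta> = card J powr \<beta> * ball_volume TYPE('a) (?D \<omega>) powr \<beta>"
      by (simp add: nn_vol_def powr_mult)
    also have "\<dots> \<le> card J powr \<beta> * ball_volume TYPE('a) (dist x (\<omega> j)) powr \<beta>"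
      using j \<beta> by (intro mult_left_mono powr_mono2 ball_volume_mono) auto
    finally have "ennreal (?V \<omega> powr \<beta>) * indicator {\<omega>. R < ?D \<omega>} \<omega>
       \<le> ennreal (card J powr \<beta>) * (?v (\<omega> j) * indicator (B j) (restrict \<omega> (J - {j})))"
      using True inB by (simp add: ennreal_leI flip: ennreal_mult)
    also have "\<dots> \<le> ennreal (card J powr \<beta>) * (\<Sum>j\<in>J0. ?v (\<omega> j) * indicator (B j) (restrict \<omega> (J - {j})))"
      using j J0 J finite_subset[OF J0(1) J] by (intro mult_left_mono member_le_sum) auto
    finally show ?thesis .
  qed auto
  have meas: "(\<lambda>\<omega>. ?v (\<omega> j) * indicator (B j) (restrict \<omega> (J - {j}))) \<in> borel_measurable ?P" if "j \<in> J" for j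
  proof -
    have c: "(\<lambda>\<omega>. \<omega> j) \<in> measurable ?P N" using that by (rule measurable_component_singleton)
    have r: "(\<lambda>\<omega>. restrict \<omega> (J - {j})) \<in> measurable ?P (PiM (J - {j}) (\<lambda>_. N))"
      by (intro measurable_restrict_subset) auto
    have "?v \<in> borel_measurable N" by measurable
    then show ?thesis
      by (intro borel_measurable_times_ennreal measurable_compose[OF c] measurable_compose[OF r]
          borel_measurable_indicator B)
  qed
  have one: "(\<integral>\<^sup>+ \<omega>. ?v (\<omega> j) * indicator (B j) (restrict \<omega> (J - {j})) \<partial>?P)
     \<le> ennreal (2 ^ k * (1 - measure N (ball x R) / 2) ^ (card J - 1)) * (\<integral>\<^sup>+ y. ?v y \<partial>N)" if j: "j \<in> J" for j
  proof -
    have ins: "insert j (J - {j}) = J" using j by auto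
    let ?Q = "PiM (J - {j}) (\<lambda>_. N)"
    have "(\<integral>\<^sup>+ \<omega>. ?v (\<omega> j) * indicator (B j) (restrict \<omega> (J - {j})) \<partial>?P)
       = (\<integral>\<^sup>+ \<omega>. \<integral>\<^sup>+ y. ?v y * indicator (B j) (restrict (fun_upd \<omega> j y) (J - {j})) \<partial>N \<partial>?Q)"
      using PP.product_nn_integral_insert[of "J - {j}" j "\<lambda>\<omega>. ?v (\<omega> j) * indicator (B j) (restrict \<omega> (J - {j}))"]
        meas[OF j] J unfolding ins by simp
    also have "\<dots> = (\<integral>\<^sup>+ \<omega>. (\<integral>\<^sup>+ y. ?v y \<partial>N) * indicator (B j) \<omega> \<partial>?Q)"
    proof (intro nn_integral_cong)
      fix \<omega> assume w: "\<omega> \<in> space ?Q"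
      have "restrict (fun_upd \<omega> j y) (J - {j}) = \<omega>" for y
        using w by (auto simp: space_PiM PiE_def extensional_def restrict_def fun_eq_iff)
      then show "(\<integral>\<^sup>+ y. ?v y * indicator (B j) (restrict (fun_upd \<omega> j y) (J - {j})) \<partial>N) = (\<integral>\<^sup>+ y. ?v y \<partial>N) * indicator (B j) \<omega>"
        by (simp add: nn_integral_multc)
    qed
    also have "\<dots> = (\<integral>\<^sup>+ y. ?v y \<partial>N) * emeasure ?Q (B j)"
      using B by (intro nn_integral_cmult_indicator) auto
    also have "\<dots> \<le> (\<integral>\<^sup>+ y. ?v y \<partial>N) * ennreal (2 ^ k * (1 - measure N (ball x R) / 2) ^ card (J - {j}))"
      unfolding B_def using J by (intro mult_left_mono emeasure_few_hits[OF N]) (auto simp: sets_N)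
    finally show ?thesis using j J by (simp add: mult.commute)
  qed
  have "(\<integral>\<^sup>+ \<omega>. ennreal (?V \<omega> powr \<beta>) * indicator {\<omega>. R < ?D \<omega>} \<omega> \<partial>?P)
    \<le> (\<integral>\<^sup>+ \<omega>. ennreal (card J powr \<beta>) * (\<Sum>j\<in>J0. ?v (\<omega> j) * indicator (B j) (restrict \<omega> (J - {j}))) \<partial>?P)"
    by (intro nn_integral_mono pt)
  also have "\<dots> = ennreal (card J powr \<beta>) * (\<Sum>j\<in>J0. \<integral>\<^sup>+ \<omega>. ?v (\<omega> j) * indicator (B j) (restrict \<omega> (J - {j})) \<partial>?P)"
  proof -
    have m: "(\<lambda>\<omega>. ?v (\<omega> j) * indicator (B j) (restrict \<omega> (J - {j}))) \<in> borel_measurable ?P" if "j \<in> J0" for j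
      using meas[of j] that J0 by auto
    show ?thesis by (simp only: nn_integral_cmult[OF borel_measurable_sum[OF m]] nn_integral_sum[OF m])
  qed
  also have "\<dots> \<le> ennreal (card J powr \<beta>) * (\<Sum>j\<in>J0. ennreal (2 ^ k * (1 - measure N (ball x R) / 2) ^ (card J - 1)) * (\<integral>\<^sup>+ y. ?v y \<partial>N))"
    using J0 by (intro mult_left_mono sum_mono one) auto
  also have "\<dots> = ennreal (real (card J) powr \<beta> * (real k * 2 ^ k * (1 - measure N (ball x R) / 2) ^ (card J - 1)))
        * (\<integral>\<^sup>+ y. ?v y \<partial>N)"
  proof -
    have "0 \<le> 1 - measure N (ball x R) / 2" using N.prob_le_1[of "ball x R"] by linarith
    then have "0 \<le> (1 - measure N (ball x R) / 2) ^ (card J - 1)" by (rule zero_le_power)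
    then show ?thesis using J0 by (simp add: ennreal_mult ennreal_of_nat_eq_real_of_nat mult_ac)
  qed
  finally show ?thesis .
qed

end

section \<open>Mass of balls and the lower density\<close>

text \<open>The recursion \<open>K * s ^ d * g t powr \<theta> \<le> g (t + s)\<close> with \<open>\<theta> < 1\<close> forgets how small \<open>g r\<close> is.
With \<open>q s = g (r + s) / s powr \<gamma>\<close>, where \<open>\<gamma>\<close> is the exponent that makes the recursion scale
invariant, it reads \<open>K' * q s powr \<theta> \<le> q (2 * s)\<close>. Now \<open>q s\<close> is at least 1 for tiny \<open>s\<close>, whatever the
value of \<open>g r > 0\<close>, and doubling preserves the bound \<open>Q\<close>, up to \<open>s = r\<close>.\<close>

lemma doubling_lower_bound:
  fixes g :: "real \<Rightarrow> real" and K \<theta> r :: real and d :: nat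
  assumes K: "0 < K" and \<theta>: "0 < \<theta>" "\<theta> < 1" and d: "1 \<le> d" and r: "0 < r"
    and g: "mono g" "0 < g r"
    and H: "\<And>t s. r \<le> t \<Longrightarrow> 0 < s \<Longrightarrow> s \<le> r \<Longrightarrow> K * s ^ d * g t powr \<theta> \<le> g (t + s)"
  defines "\<gamma> \<equiv> real d / (1 - \<theta>)"
  shows "min 1 ((K * 2 powr (-\<gamma>)) powr (1 / (1 - \<theta>))) * r powr \<gamma> \<le> g (2 * r)"
proof -
  define K' where "K' = K * 2 powr (-\<gamma>)"
  define Q where "Q = min 1 (K' powr (1 / (1 - \<theta>)))"
  define q where "q s = g (r + s) / s powr \<gamma>" for s
  have K': "0 < K'" using K by (simp add: K'_def)
  have Q: "0 < Q" "Q \<le> 1" using K' by (auto simp: Q_def)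
  have \<gamma>: "0 < \<gamma>" using d \<theta> by (simp add: \<gamma>_def)
  have \<gamma>d: "\<gamma> * \<theta> = \<gamma> - real d" using \<theta> by (simp add: \<gamma>_def field_simps)
  have gpos: "0 < g t" if "r \<le> t" for t using g that by (meson less_le_trans monoD)
  have QK: "Q \<le> K' * Q powr \<theta>"
  proof -
    have "Q powr (1 - \<theta>) \<le> (K' powr (1 / (1 - \<theta>))) powr (1 - \<theta>)"
      using Q \<theta> by (intro powr_mono2) (auto simp: Q_def)
    also have "\<dots> = K'" using K' \<theta> by (simp add: powr_powr)
    finally have le: "Q powr (1 - \<theta>) \<le> K'" .
    have "Q = Q powr ((1 - \<theta>) + \<theta>)" using Q by simp
    also have "\<dots> = Q powr (1 - \<theta>) * Q powr \<theta>" by (rule powr_add)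
    also have "\<dots> \<le> K' * Q powr \<theta>" using le by (rule mult_right_mono) simp
    finally show ?thesis .
  qed
  have step: "Q \<le> q (2 * s)" if s: "0 < s" "2 * s \<le> r" "Q \<le> q s" for s
  proof -
    have e: "g (r + s) = q s * s powr \<gamma>" using s by (simp add: q_def)
    have e2: "r + s + s = r + 2 * s" by simp
    have "K * s ^ d * g (r + s) powr \<theta> \<le> g (r + s + s)" using s by (intro H) auto
    then have "K * s ^ d * (q s * s powr \<gamma>) powr \<theta> \<le> g (r + 2 * s)" by (simp only: e e2)
    also have "K * s ^ d * (q s * s powr \<gamma>) powr \<theta> = K * q s powr \<theta> * s powr \<gamma>"
    proof -
      have "(q s * s powr \<gamma>) powr \<theta> = q s powr \<theta> * s powr (\<gamma> - real d)"
        using s Q by (simp add: powr_mult powr_powr \<gamma>d)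
      moreover have "s ^ d * s powr (\<gamma> - real d) = s powr \<gamma>"
        using s by (simp add: powr_diff powr_realpow)
      ultimately show ?thesis by (simp add: mult_ac)
    qed
    finally have "K * q s powr \<theta> * s powr \<gamma> / (2 * s) powr \<gamma> \<le> q (2 * s)"
      unfolding q_def using s by (intro divide_right_mono) auto
    also have "K * q s powr \<theta> * s powr \<gamma> / (2 * s) powr \<gamma> = K' * q s powr \<theta>"
      using s by (simp add: K'_def powr_mult powr_minus field_simps)
    finally have "K' * q s powr \<theta> \<le> q (2 * s)" .
    moreover have "K' * Q powr \<theta> \<le> K' * q s powr \<theta>"
      using K' Q s \<theta> by (intro mult_left_mono powr_mono2) auto
    ultimately show ?thesis using QK by linarith
  qed
  have "(\<lambda>N. (r / 2 ^ N) powr \<gamma>) \<longlonglongrightarrow> 0"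
    using r \<gamma> by real_asymp
  then have "eventually (\<lambda>N. (r / 2 ^ N) powr \<gamma> < g r) sequentially"
    using g(2) by (intro order_tendstoD)
  then obtain N where N: "(r / 2 ^ N) powr \<gamma> < g r" by (auto simp: eventually_sequentially)
  have "Q \<le> q (r / 2 ^ N)"
  proof -
    have "g r \<le> g (r + r / 2 ^ N)" using g r by (intro monoD[OF g(1)]) auto
    then have "1 \<le> q (r / 2 ^ N)" using N r by (simp add: q_def)
    then show ?thesis using Q by simp
  qed
  moreover have "Q \<le> q (r / 2 ^ (N - j)) " if "Q \<le> q (r / 2 ^ N)" "j \<le> N" for j
    using that
  proof (induction j)
    case (Suc j)
    then have e: "r / 2 ^ (N - Suc j) = 2 * (r / 2 ^ (N - j))"
      by (simp add: Suc_diff_Suc[symmetric] field_simps)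
    have "r / 2 ^ (N - Suc j) \<le> r" using r by (simp add: divide_le_eq_1 field_simps)
    then show ?case unfolding e using Suc r by (intro step) auto
  qed simp
  ultimately have "Q \<le> q (r / 2 ^ (N - N))" by blast
  then have "Q \<le> q r" by simp
  then show ?thesis using r by (simp add: q_def Q_def K'_def field_simps mult_2)
qed

lemma prob_space_law: "prob_density p \<Longrightarrow> prob_space (law p)"
  by (rule prob_spaceI) (auto simp: law_def prob_density_def emeasure_density cong: nn_integral_cong)

lemma sets_law [measurable_cong, simp]: "sets (law p) = sets borel" and space_law [simp]: "space (law p) = UNIV"
  by (simp_all add: law_def)

lemma measurable_emeasure_ball:
  assumes p: "prob_density p"
  shows "(\<lambda>x. emeasure (law p) (ball x r)) \<in> borel_measurable borel"
proof -
  interpret N: prob_space "law p" by (rule prob_space_law[OF p])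
  have "(\<lambda>x. \<integral>\<^sup>+ y. indicator {y. dist x y < r} y \<partial>law p) \<in> borel_measurable borel"
    by measurable
  moreover have "(\<integral>\<^sup>+ y. indicator {y. dist x y < r} y \<partial>law p) = emeasure (law p) (ball x r)" for x
    by (subst nn_integral_indicator) (auto simp: ball_def)
  ultimately show ?thesis by simp
qed

lemma nn_integral_law:
  assumes "prob_density p" "F \<in> borel_measurable borel"
  shows "(\<integral>\<^sup>+ x. F x \<partial>law p) = (\<integral>\<^sup>+ x. ennreal (p x) * F x \<partial>lborel)"
  using assms unfolding law_def prob_density_def by (intro nn_integral_density) auto

text \<open>Measurability is asked of the smaller function \<open>F\<close> alone: \<open>Q\<close> will be a supremum or an infimum over all radii.\<close>

lemma nn_integral_law_le:
  assumes p: "prob_density p" and F: "F \<in> borel_measurable borel"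
    and c: "0 < c" and le: "\<And>x. F x \<le> ennreal c * Q x"
  shows "(\<integral>\<^sup>+ x. F x \<partial>law p) \<le> ennreal c * (\<integral>\<^sup>+ x. ennreal (p x) * Q x \<partial>lborel)"
proof -
  have [measurable]: "p \<in> borel_measurable borel" using p by (simp add: prob_density_def)
  have "F x = ennreal c * (ennreal (1 / c) * F x)" for x
  proof -
    have "ennreal c * (ennreal (1 / c) * F x) = ennreal (c * (1 / c)) * F x"
      using c by (simp only: ennreal_mult mult.assoc less_imp_le divide_nonneg_nonneg zero_le_one)
    then show ?thesis using c by simp
  qed
  then have "(\<integral>\<^sup>+ x. F x \<partial>law p) = (\<integral>\<^sup>+ x. ennreal c * (ennreal (1 / c) * F x) \<partial>law p)" by simp
  also have "\<dots> = ennreal c * (\<integral>\<^sup>+ x. ennreal (p x) * (ennreal (1 / c) * F x) \<partial>lborel)"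
  proof -
    have m: "(\<lambda>x. ennreal (1 / c) * F x) \<in> borel_measurable borel" using F by measurable
    then have m': "(\<lambda>x. ennreal (1 / c) * F x) \<in> borel_measurable (law p)"
      by (simp add: measurable_cong_sets[OF sets_law])
    show ?thesis by (simp only: nn_integral_cmult[OF m'] nn_integral_law[OF p m])
  qed
  also have "\<dots> \<le> ennreal c * (\<integral>\<^sup>+ x. ennreal (p x) * Q x \<partial>lborel)"
  proof (intro mult_left_mono nn_integral_mono)
    fix x
    have "ennreal (1 / c) * F x \<le> ennreal (1 / c) * (ennreal c * Q x)" using le by (intro mult_left_mono) auto
    also have "\<dots> = ennreal (1 / c * c) * Q x"
      using c by (simp only: ennreal_mult mult.assoc less_imp_le divide_nonneg_nonneg zero_le_one)
    finally show "ennreal (1 / c) * F x \<le> Q x" using c by simp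
  qed auto
  finally show ?thesis .
qed

lemma lower_density_le:
  assumes "0 < s" "s \<le> r"
  shows "lower_density p r x \<le> emeasure (law p) (ball x s) / emeasure lborel (ball x s)"
  unfolding lower_density_def using assms by (intro INF_lower) auto

lemma upper_density_ge:
  assumes "0 < s" "s \<le> r"
  shows "emeasure (law p) (ball x s) / emeasure lborel (ball x s) \<le> upper_density p r x"
  unfolding upper_density_def using assms by (intro SUP_upper) auto

lemma emeasure_ball_le_upper_density:
  fixes x :: "'a::euclidean_space"
  assumes "0 < s" "s \<le> r"
  shows "emeasure (law p) (ball x s) \<le> upper_density p r x * emeasure lborel (ball x s)"
proof -
  have e: "emeasure lborel (ball x s) = ennreal (ball_volume TYPE('a) s)" by (rule emeasure_ball_volume)
  have v: "ball_volume TYPE('a) s \<noteq> 0" using assms ball_volume_pos_iff[of s, where 'a = 'a] by linarith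
  have "emeasure lborel (ball x s) \<noteq> 0" "emeasure lborel (ball x s) \<noteq> \<infinity>" 
    using v unfolding e by auto
  then have "emeasure (law p) (ball x s) = emeasure (law p) (ball x s) * emeasure lborel (ball x s) / emeasure lborel (ball x s)"
    by (intro mult_divide_eq_ennreal[symmetric]) auto
  also have "\<dots> = emeasure (law p) (ball x s) / emeasure lborel (ball x s) * emeasure lborel (ball x s)"
    by (simp add: mult.commute ennreal_times_divide)
  also have "\<dots> \<le> upper_density p r x * emeasure lborel (ball x s)"
    using upper_density_ge[OF assms] by (intro mult_right_mono) auto
  finally show ?thesis .
qed

context
  fixes p :: "'a::euclidean_space \<Rightarrow> real" and r b :: real
  assumes p: "prob_density p" and r: "0 < r" and b: "0 < b"
begin

interpretation N: prob_space "law p" by (rule prob_space_law[OF p])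

lemma lower_density_le_real:
  assumes "0 < s" "s \<le> r"
  shows "lower_density p r x \<le> ennreal (measure (law p) (ball x s) / ball_volume TYPE('a) s)"
  using lower_density_le[OF assms, of p x] assms
  by (simp add: N.emeasure_eq_measure emeasure_ball_volume divide_ennreal)

lemma lower_density_finite: "lower_density p r x < \<infinity>"
  using lower_density_le_real[OF r order_refl] by (rule le_less_trans) simp

lemma xi_square_ge:
  assumes c: "0 < c" and m: "m \<le> ennreal c"
  shows "ennreal (c powr (- (2 * b))) \<le> xi_neg_powr (\<lambda>t. t\<^sup>2) b m"
proof (cases "m = 0")
  case False
  have mf: "m < \<infinity>" using m by (rule le_less_trans) simp
  have m0: "0 < enn2real m" using False mf by (simp add: enn2real_positive_iff zero_less_iff_neq_zero)
  have "enn2real m \<le> c" using m c mf by (simp add: enn2real_leI)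
  then have "c powr (- (2 * b)) \<le> enn2real m powr (- (2 * b))" using m0 b by (intro powr_mono2') auto
  also have "\<dots> = (enn2real m powr (- b))\<^sup>2"
    using m0 by (simp add: power2_eq_square flip: powr_add)
  finally show ?thesis using False by (simp add: xi_neg_powr_def ennreal_leI)
qed (simp add: xi_neg_powr_def)

lemma xi_square_eq:
  assumes "m \<noteq> 0" "m < \<infinity>"
  shows "xi_neg_powr (\<lambda>t. t\<^sup>2) b m = ennreal (enn2real m powr (- (2 * b)))"
proof -
  have m0: "0 < enn2real m" using assms by (simp add: enn2real_positive_iff zero_less_iff_neq_zero)
  then show ?thesis using assms by (simp add: xi_neg_powr_def power2_eq_square flip: powr_add)
qed

text \<open>For every centre in the ball of radius \<open>t\<close> around \<open>x\<close>, the ball of radius \<open>s\<close> lies in the one of radius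
\<open>t + s\<close> around \<open>x\<close>; this bounds the lower density there from above.\<close>

lemma mass_times_xi_le:
  assumes t: "0 < t" and s: "0 < s" "s \<le> r" and pos: "0 < measure (law p) (ball x (t + s))"
  shows "ennreal (measure (law p) (ball x t) * (measure (law p) (ball x (t + s)) / ball_volume TYPE('a) s) powr (- (2 * b)))
    \<le> (\<integral>\<^sup>+ y. ennreal (p y) * xi_neg_powr (\<lambda>t. t\<^sup>2) b (lower_density p r y) \<partial>lborel)"
proof -
  define c where "c = measure (law p) (ball x (t + s)) / ball_volume TYPE('a) s"
  have c: "0 < c" using pos s by (simp add: c_def)
  have "ennreal (measure (law p) (ball x t) * c powr (- (2 * b))) = (\<integral>\<^sup>+ y. ennreal (c powr (- (2 * b))) * indicator (ball x t) y \<partial>law p)"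
  proof -
    have "(\<integral>\<^sup>+ y. ennreal (c powr (- (2 * b))) * indicator (ball x t) y \<partial>law p)
        = ennreal (c powr (- (2 * b))) * ennreal (measure (law p) (ball x t))"
      by (subst nn_integral_cmult_indicator) (simp_all add: N.emeasure_eq_measure)
    also have "\<dots> = ennreal (c powr (- (2 * b)) * measure (law p) (ball x t))"
      by (intro ennreal_mult[symmetric]) auto
    finally show ?thesis by (simp only: mult.commute)
  qed
  also have "\<dots> = (\<integral>\<^sup>+ y. ennreal (p y) * (ennreal (c powr (- (2 * b))) * indicator (ball x t) y) \<partial>lborel)"
  proof (rule nn_integral_law[OF p])
    have "ball x t \<in> sets borel" by (rule borel_open[OF open_ball])
    then show "(\<lambda>y. ennreal (c powr (- (2 * b))) * indicator (ball x t) y) \<in> borel_measurable borel"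
      by (intro borel_measurable_times_ennreal borel_measurable_const borel_measurable_indicator)
  qed
  also have "\<dots> \<le> (\<integral>\<^sup>+ y. ennreal (p y) * xi_neg_powr (\<lambda>t. t\<^sup>2) b (lower_density p r y) \<partial>lborel)"
  proof (intro nn_integral_mono mult_left_mono)
    fix y
    show "ennreal (c powr (- (2 * b))) * indicator (ball x t) y \<le> xi_neg_powr (\<lambda>t. t\<^sup>2) b (lower_density p r y)"
    proof (cases "y \<in> ball x t")
      case True
      have "z \<in> ball x (t + s)" if "z \<in> ball y s" for z
        using that True dist_triangle[of x z y] by simp
      then have "measure (law p) (ball y s) \<le> measure (law p) (ball x (t + s))"
        by (intro N.finite_measure_mono) auto
      then have "measure (law p) (ball y s) / ball_volume TYPE('a) s \<le> c"
        unfolding c_def using s by (intro divide_right_mono) auto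
      then have "lower_density p r y \<le> ennreal c"
        using lower_density_le_real[OF s, of y] by (meson ennreal_leI order_trans)
      then show ?thesis using xi_square_ge[OF c] True by simp
    qed simp
  qed auto
  finally show ?thesis by (simp add: c_def)
qed

text \<open>Let \<open>\<beta> = 2 * b\<close> and let \<open>g t\<close> be the mass of the ball of radius \<open>t\<close> around \<open>x\<close>. The preceding lemma bounds
\<open>g t\<close> by a constant times the power \<open>\<beta>\<close> of \<open>g (t + s) / s ^ d\<close>. Since \<open>\<beta> > 1\<close>, the recursion above
applies with \<open>\<theta> = 1 / \<beta>\<close>. In particular the support of the density is bounded in this case.\<close>

lemma ball_mass_bounded_below:
  assumes b1: "1 < 2 * b"
    and fin: "(\<integral>\<^sup>+ y. ennreal (p y) * xi_neg_powr (\<lambda>t. t\<^sup>2) b (lower_density p r y) \<partial>lborel) < \<infinity>"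
  shows "\<exists>\<delta>>0. \<forall>x. 0 < measure (law p) (ball x r) \<longrightarrow> \<delta> \<le> measure (law p) (ball x (2 * r))"
proof -
  define L where "L = (\<integral>\<^sup>+ y. ennreal (p y) * xi_neg_powr (\<lambda>t. t\<^sup>2) b (lower_density p r y) \<partial>lborel)"
  define I where "I = max 1 (enn2real L)"
  have I: "0 < I" "L \<le> ennreal I"
  proof -
    have "ennreal (enn2real L) \<le> ennreal I" by (intro ennreal_leI) (simp add: I_def)
    moreover have "ennreal (enn2real L) = L" using fin by (intro ennreal_enn2real) (simp add: L_def)
    ultimately show "L \<le> ennreal I" by simp
  qed (simp add: I_def)
  define \<beta> where "\<beta> = 2 * b"
  define \<theta> where "\<theta> = 1 / \<beta>"
  define \<omega> where "\<omega> = unit_ball_vol (real DIM('a))"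
  define K where "K = I powr (-\<theta>) * \<omega>"
  have \<beta>: "1 < \<beta>" using b1 by (simp add: \<beta>_def)
  have \<theta>: "0 < \<theta>" "\<theta> < 1" using \<beta> by (auto simp: \<theta>_def)
  have K: "0 < K" using I by (simp add: K_def \<omega>_def)
  define \<delta> where "\<delta> = min 1 ((K * 2 powr (-(real DIM('a) / (1 - \<theta>)))) powr (1 / (1 - \<theta>))) * r powr (real DIM('a) / (1 - \<theta>))"
  have "0 < \<delta>" using K r by (simp add: \<delta>_def)
  moreover have "\<delta> \<le> measure (law p) (ball x (2 * r))" if x: "0 < measure (law p) (ball x r)" for x
  proof -
    let ?g = "\<lambda>t. measure (law p) (ball x t)"
    have mono: "mono ?g" by (intro monoI N.finite_measure_mono) auto
    have H: "K * s ^ DIM('a) * ?g t powr \<theta> \<le> ?g (t + s)" if t: "r \<le> t" and s: "0 < s" "s \<le> r" for t s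
    proof -
      have gt: "0 < ?g t" "0 < ?g (t + s)"
        using x monoD[OF mono t] monoD[OF mono, of r "t + s"] t s by auto
      define v where "v = ball_volume TYPE('a) s"
      have v: "0 < v" "v = \<omega> * s ^ DIM('a)" using s by (simp_all add: v_def ball_volume_eq \<omega>_def)
      define w where "w = ?g (t + s) / v"
      have w: "0 < w" using gt v by (simp add: w_def)
      have "ennreal (?g t * w powr (- \<beta>)) \<le> L"
        unfolding w_def v_def \<beta>_def L_def using t s r gt by (intro mass_times_xi_le) auto
      also note I(2)
      finally have le: "?g t * w powr (- \<beta>) \<le> I" using I by (simp add: ennreal_le_iff)
      have "?g t = ?g t * w powr (- \<beta>) * w powr \<beta>" using w by (simp add: powr_minus)
      also have "\<dots> \<le> I * w powr \<beta>" using le by (rule mult_right_mono) simp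
      finally have "?g t \<le> I * (?g (t + s) / v) powr \<beta>" by (simp only: w_def)
      then have "?g t powr \<theta> \<le> (I * (?g (t + s) / v) powr \<beta>) powr \<theta>"
        using gt \<theta> by (intro powr_mono2) auto
      also have "\<dots> = I powr \<theta> * (?g (t + s) / v)"
        using I gt v \<beta> by (simp add: powr_mult powr_powr \<theta>_def)
      finally have "I powr (-\<theta>) * v * ?g t powr \<theta> \<le> I powr (-\<theta>) * v * (I powr \<theta> * (?g (t + s) / v))"
        using v by (intro mult_left_mono) auto
      also have "\<dots> = ?g (t + s)" using I(1) v(1) by (simp add: powr_minus)
      also have "I powr (-\<theta>) * v = K * s ^ DIM('a)" unfolding K_def v(2) by (rule mult.assoc[symmetric])
      finally show ?thesis .
    qed
    show ?thesis unfolding \<delta>_def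
      by (rule doubling_lower_bound[OF K \<theta> _ r mono x H]) (simp_all add: Suc_leI)
  qed
  ultimately show ?thesis by blast
qed

text \<open>The lower density vanishes where the ball has no mass, and there the integrand is infinite.\<close>

lemma AE_ball_mass_pos:
  assumes fin: "(\<integral>\<^sup>+ y. ennreal (p y) * xi_neg_powr (\<lambda>t. t\<^sup>2) b (lower_density p r y) \<partial>lborel) < \<infinity>"
  shows "AE x in law p. 0 < measure (law p) (ball x r)"
proof -
  note [measurable] = measurable_emeasure_ball[OF p, of r]
  define Z where "Z = {x. emeasure (law p) (ball x r) = 0}"
  have Z[measurable]: "Z \<in> sets borel" unfolding Z_def by measurable
  have "(\<integral>\<^sup>+ x. \<infinity> * indicator Z x \<partial>law p) \<le> ennreal 1 * (\<integral>\<^sup>+ y. ennreal (p y) * xi_neg_powr (\<lambda>t. t\<^sup>2) b (lower_density p r y) \<partial>lborel)"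
  proof (rule nn_integral_law_le[OF p])
    fix x show "\<infinity> * indicator Z x \<le> ennreal 1 * xi_neg_powr (\<lambda>t. t\<^sup>2) b (lower_density p r x)"
    proof (cases "x \<in> Z")
      case True
      then have "lower_density p r x = 0"
        using lower_density_le[OF r order_refl, of p x] by (simp add: Z_def)
      then show ?thesis by (simp add: xi_neg_powr_def)
    qed simp
  qed auto
  then have "\<infinity> * emeasure (law p) Z < \<infinity>" using fin by (simp add: nn_integral_cmult_indicator)
  then have "emeasure (law p) Z = 0" by (cases "emeasure (law p) Z = 0") (auto simp: ennreal_top_mult)
  then have "AE x in law p. x \<notin> Z" by (intro AE_not_in) (simp add: null_sets_def)
  then show ?thesis
  proof eventually_elim
    case (elim x)
    then have "measure (law p) (ball x r) \<noteq> 0" by (auto simp: Z_def N.emeasure_eq_measure)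
    then show ?case using measure_nonneg[of "law p" "ball x r"] by linarith
  qed
qed

end

section \<open>Moments of the nearest-neighbour volume around a sample point\<close>

text \<open>Dominated convergence. For \<open>\<beta> \<le> 1\<close> the factor in front of \<open>h\<close> is at most 1; for \<open>\<beta> > 1\<close> it is bounded
because \<open>q\<close> stays away from zero.\<close>

lemma nn_integral_powr_decay:
  fixes M :: "'b measure" and q :: "'b \<Rightarrow> real" and h :: "'b \<Rightarrow> ennreal" and \<beta> :: real
  assumes q[measurable]: "q \<in> borel_measurable M" and h[measurable]: "h \<in> borel_measurable M"
    and fin: "(\<integral>\<^sup>+ x. h x \<partial>M) < \<infinity>"
    and q1: "\<And>x. q x \<le> 1" and q0: "AE x in M. 0 < q x"
    and \<beta>: "\<beta> \<le> 1 \<or> (\<exists>\<delta>>0. AE x in M. \<delta> \<le> q x)"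
  shows "(\<lambda>n. \<integral>\<^sup>+ x. ennreal (real n powr (\<beta> - 1) * (1 - q x) ^ (n - 1)) * h x \<partial>M) \<longlonglongrightarrow> 0"
proof -
  define c where "c u n = real n powr (\<beta> - 1) * (1 - u) ^ (n - 1)" for u :: real and n :: nat
  have c0: "0 \<le> c u n" if "u \<le> 1" for u n using that by (simp add: c_def)
  have lim: "c u \<longlonglongrightarrow> 0" if u: "0 < u" "u \<le> 1" for u
  proof (rule tendsto_sandwich[where f = "\<lambda>_. 0"])
    show "(\<lambda>n. real n powr (\<beta> - 1) * exp (- u * (real n - 1))) \<longlonglongrightarrow> 0" using u by real_asymp
    show "eventually (\<lambda>n. c u n \<le> real n powr (\<beta> - 1) * exp (- u * (real n - 1))) sequentially"
      using eventually_ge_at_top[of 1]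
    proof eventually_elim
      case (elim n)
      have "(1 - u) ^ (n - 1) \<le> exp (- u) ^ (n - 1)"
        using u exp_ge_add_one_self[of "- u"] by (intro power_mono) auto
      also have "\<dots> = exp (- u * (real n - 1))"
        using elim by (simp flip: exp_of_nat_mult add: of_nat_diff mult.commute)
      finally show ?case unfolding c_def by (rule mult_left_mono) simp
    qed
  qed (use c0 u in auto)
  have "\<exists>B\<ge>0. AE x in M. \<forall>n. c (q x) n \<le> B"
  proof (cases "\<beta> \<le> 1")
    case True
    have le1: "c (q x) n \<le> 1" if "0 < q x" for x n
    proof (cases "n = 0")
      case False
      have "real n powr (\<beta> - 1) \<le> real n powr 0" using True False by (intro powr_mono) auto
      moreover have "(1 - q x) ^ (n - 1) \<le> 1" using that q1[of x] by (intro power_le_one) auto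
      ultimately have "c (q x) n \<le> 1 * 1"
        unfolding c_def using False q1[of x] by (intro mult_mono) auto
      then show ?thesis by simp
    qed (simp add: c_def)
    have "AE x in M. \<forall>n. c (q x) n \<le> 1" using q0 by eventually_elim (use le1 in auto)
    then show ?thesis by (intro exI[of _ 1]) auto
  next
    case False
    then obtain \<delta> where \<delta>: "0 < \<delta>" "AE x in M. \<delta> \<le> q x" using \<beta> by auto
    define \<delta>' where "\<delta>' = min \<delta> 1"
    have d: "0 < \<delta>'" "\<delta>' \<le> 1" using \<delta> by (auto simp: \<delta>'_def)
    have "Bseq (c \<delta>')" using lim[OF d] convergent_imp_Bseq convergentI by blast
    then obtain B where B: "0 < B" "\<And>n. norm (c \<delta>' n) \<le> B" unfolding Bseq_def by blast
    have le: "c (q x) n \<le> B" if "\<delta> \<le> q x" for x n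
    proof -
      have "c (q x) n \<le> c \<delta>' n" unfolding c_def
        using that q1[of x] by (intro mult_left_mono power_mono) (auto simp: \<delta>'_def)
      then show ?thesis using B(2)[of n] by simp
    qed
    have "AE x in M. \<forall>n. c (q x) n \<le> B" using \<delta>(2) by eventually_elim (use le in auto)
    then show ?thesis using B(1) by (intro exI[of _ B]) auto
  qed
  then obtain B where B: "0 \<le> B" "AE x in M. \<forall>n. c (q x) n \<le> B" by blast
  have "(\<lambda>n. \<integral>\<^sup>+ x. ennreal (c (q x) n) * h x \<partial>M) \<longlonglongrightarrow> (\<integral>\<^sup>+ x. 0 \<partial>M)"
  proof (rule nn_integral_dominated_convergence)
    show "(\<lambda>x. ennreal (c (q x) n) * h x) \<in> borel_measurable M" for n unfolding c_def by measurable
    show "(\<lambda>x. ennreal B * h x) \<in> borel_measurable M" by measurable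
    show "(\<integral>\<^sup>+ x. ennreal B * h x \<partial>M) < \<infinity>"
      using fin by (simp add: nn_integral_cmult ennreal_mult_less_top)
    show "AE x in M. ennreal (c (q x) n) * h x \<le> ennreal B * h x" for n
      using B(2) by eventually_elim (intro mult_right_mono ennreal_leI, auto)
    have "AE x in M. h x \<noteq> \<infinity>" using fin by (intro nn_integral_PInf_AE) auto
    then show "AE x in M. (\<lambda>n. ennreal (c (q x) n) * h x) \<longlonglongrightarrow> 0"
      using q0
    proof eventually_elim
      case (elim x)
      define e where "e = enn2real (h x)"
      have e: "h x = ennreal e" "0 \<le> e" using elim by (simp_all add: e_def less_top)
      have "(\<lambda>n. ennreal (c (q x) n * e)) \<longlonglongrightarrow> ennreal (0 * e)"
        using elim q1[of x] by (intro tendsto_ennrealI tendsto_mult_right lim) auto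
      then show ?case using e c0[OF q1[of x]] by (simp add: ennreal_mult)
    qed
  qed simp_all
  then show ?thesis by (simp add: c_def)
qed

lemma ennreal_cmult_less_top_cancel:
  assumes "0 < c" "ennreal c * t < \<infinity>" shows "t < \<infinity>"
  using assms by (auto simp: ennreal_mult_less_top)

context
  fixes p :: "'a::euclidean_space \<Rightarrow> real"
  assumes p: "prob_density p"
begin

interpretation N: prob_space "law p" by (rule prob_space_law[OF p])

lemma measurable_measure_ball: "(\<lambda>x. measure (law p) (ball x r)) \<in> borel_measurable borel"
  using measurable_emeasure_ball[OF p] unfolding measure_def by measurable

lemma measurable_nn_vol_joint:
  assumes I: "finite I" "i \<in> I" "J \<subseteq> I" and k: "1 \<le> k"
  shows "(\<lambda>\<omega>. kth k (\<lambda>j. dist (\<omega> i) (\<omega> j)) J) \<in> borel_measurable (PiM I (\<lambda>_. law p))"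
    and "(\<lambda>\<omega>. nn_vol k (\<omega> i) \<omega> J) \<in> borel_measurable (PiM I (\<lambda>_. law p))"
proof -
  have c: "(\<lambda>\<omega>. \<omega> j) \<in> borel_measurable (PiM I (\<lambda>_. law p))" if "j \<in> I" for j
    using measurable_component_singleton[OF that, of "\<lambda>_. law p"] by (simp add: measurable_cong_sets[OF refl sets_law])
  show *: "(\<lambda>\<omega>. kth k (\<lambda>j. dist (\<omega> i) (\<omega> j)) J) \<in> borel_measurable (PiM I (\<lambda>_. law p))"
  proof (rule measurable_kth[OF _ k])
    show "finite J" using I finite_subset by blast
    show "(\<lambda>\<omega>. dist (\<omega> i) (\<omega> j)) \<in> borel_measurable (PiM I (\<lambda>_. law p))" if "j \<in> J" for j
      using that I by (intro borel_measurable_dist c) auto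
  qed
  show "(\<lambda>\<omega>. nn_vol k (\<omega> i) \<omega> J) \<in> borel_measurable (PiM I (\<lambda>_. law p))"
    unfolding nn_vol_def
    by (intro borel_measurable_times borel_measurable_const measurable_compose[OF * ball_volume_measurable])
qed

text \<open>Conditioning on the \<open>i\<close>-th sample point.\<close>

lemma nn_integral_PiM_slice:
  fixes F :: "real \<Rightarrow> real \<Rightarrow> ennreal"
  assumes I: "finite I" "i \<in> I" and k: "1 \<le> k"
    and F: "(\<lambda>(u, v). F u v) \<in> borel_measurable (borel \<Otimes>\<^sub>M borel)"
  shows "(\<integral>\<^sup>+ \<omega>. F (nn_vol k (\<omega> i) \<omega> (I - {i})) (kth k (\<lambda>j. dist (\<omega> i) (\<omega> j)) (I - {i})) \<partial>PiM I (\<lambda>_. law p))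
     = (\<integral>\<^sup>+ x. (\<integral>\<^sup>+ \<omega>. F (nn_vol k x \<omega> (I - {i})) (kth k (\<lambda>j. dist x (\<omega> j)) (I - {i})) \<partial>PiM (I - {i}) (\<lambda>_. law p)) \<partial>law p)" (is "?L = (\<integral>\<^sup>+ x. ?f x \<partial>_)")
    and "(\<lambda>x. \<integral>\<^sup>+ \<omega>. F (nn_vol k x \<omega> (I - {i})) (kth k (\<lambda>j. dist x (\<omega> j)) (I - {i})) \<partial>PiM (I - {i}) (\<lambda>_. law p)) \<in> borel_measurable borel"
proof -
  interpret PP: product_sigma_finite "\<lambda>_::nat. law p" by standard
  define J where "J = I - {i}"
  have J: "finite J" "i \<notin> J" "I = insert i J" using I by (auto simp: J_def)
  interpret pJ: prob_space "PiM J (\<lambda>_. law p)" by (intro prob_space_PiM prob_space_law p)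
  define f where "f \<omega> = F (nn_vol k (\<omega> i) \<omega> J) (kth k (\<lambda>j. dist (\<omega> i) (\<omega> j)) J)" for \<omega> :: "nat \<Rightarrow> 'a"
  have JI: "J \<subseteq> I" by (auto simp: J_def)
  have "(\<lambda>\<omega>. (\<lambda>(u, v). F u v) (nn_vol k (\<omega> i) \<omega> J, kth k (\<lambda>j. dist (\<omega> i) (\<omega> j)) J)) \<in> borel_measurable (PiM I (\<lambda>_. law p))"
    by (intro measurable_compose[OF _ F] measurable_Pair measurable_nn_vol_joint[OF I JI k])
  then have f: "f \<in> borel_measurable (PiM (insert i J) (\<lambda>_. law p))" by (simp add: f_def[abs_def] J(3))
  have upd: "f (fun_upd \<omega> i x) = F (nn_vol k x \<omega> J) (kth k (\<lambda>j. dist x (\<omega> j)) J)" for \<omega> x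
  proof -
    have "kth k (\<lambda>j. dist x ((fun_upd \<omega> i x) j)) J = kth k (\<lambda>j. dist x (\<omega> j)) J"
      using J(2) by (intro kth_cong) auto
    then show ?thesis by (simp add: f_def nn_vol_def)
  qed
  have "integral\<^sup>N (PiM (insert i J) (\<lambda>_. law p)) f = (\<integral>\<^sup>+ x. (\<integral>\<^sup>+ \<omega>. f (fun_upd \<omega> i x) \<partial>PiM J (\<lambda>_. law p)) \<partial>law p)"
    by (rule PP.product_nn_integral_insert_rev[OF J(1,2) f])
  then show "?L = (\<integral>\<^sup>+ x. ?f x \<partial>law p)"
    unfolding upd J_def[symmetric] J(3)[symmetric] by (simp add: f_def[abs_def])
  have "(\<lambda>(x, \<omega>). f (fun_upd \<omega> i x)) \<in> borel_measurable (law p \<Otimes>\<^sub>M PiM J (\<lambda>_. law p))"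
    using f by measurable
  then have "(\<lambda>x. \<integral>\<^sup>+ \<omega>. f (fun_upd \<omega> i x) \<partial>PiM J (\<lambda>_. law p)) \<in> borel_measurable (law p)"
    using pJ.borel_measurable_nn_integral[of "\<lambda>x \<omega>. f (fun_upd \<omega> i x)" "law p"] by simp
  then show "?f \<in> borel_measurable borel"
    unfolding upd J_def[symmetric] by (simp add: measurable_cong_sets[OF sets_law])
qed

lemma small_moment:
  assumes l: "1 \<le> l" "l \<le> k" and \<alpha>: "0 \<le> \<alpha>" "\<alpha> < real l" and r: "0 < r"
    and fin: "(\<integral>\<^sup>+ x. ennreal (p x) * upper_density p r x ^ l \<partial>lborel) < \<infinity>"
  shows "\<exists>K\<ge>0. \<forall>I i. finite I \<longrightarrow> i \<in> I \<longrightarrow> k < card I \<longrightarrow> 2 / ball_volume TYPE('a) r \<le> real (card (I - {i})) \<longrightarrow>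
     (\<integral>\<^sup>+ \<omega>. ennreal (nn_vol k (\<omega> i) \<omega> (I - {i}) powr (-\<alpha>)) * indicator {0<..1} (nn_vol k (\<omega> i) \<omega> (I - {i})) \<partial>PiM I (\<lambda>_. law p)) \<le> ennreal K"
proof -
  define L where "L = (\<integral>\<^sup>+ x. ennreal (p x) * upper_density p r x ^ l \<partial>lborel)"
  define S where "S = (\<Sum>j. 2 powr ((real j + 1) * \<alpha>) * (2 * (1/2) ^ j) ^ l)"
  define c where "c = max 1 S"
  have k1: "1 \<le> k" using l by simp
  have L: "L = ennreal (enn2real L)" using fin by (intro ennreal_enn2real[symmetric]) (simp add: L_def)
  show ?thesis
  proof (intro exI[of _ "c * enn2real L"] conjI allI impI)
    fix I :: "nat set" and i
    assume I: "finite I" "i \<in> I" "k < card I" and card: "2 / ball_volume TYPE('a) r \<le> real (card (I - {i}))"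
    let ?F = "\<lambda>u v :: real. ennreal (u powr (-\<alpha>)) * indicator {0<..1} u"
    have F: "(\<lambda>(u, v). ?F u v) \<in> borel_measurable (borel \<Otimes>\<^sub>M borel)" by measurable
    have kJ: "finite (I - {i})" "k \<le> card (I - {i})" using I by auto
    note sl = nn_integral_PiM_slice[OF I(1,2) k1 F]
    have "(\<integral>\<^sup>+ x. (\<integral>\<^sup>+ \<omega>. ?F (nn_vol k x \<omega> (I - {i})) (kth k (\<lambda>j. dist x (\<omega> j)) (I - {i})) \<partial>PiM (I - {i}) (\<lambda>_. law p)) \<partial>law p)
        \<le> ennreal c * (\<integral>\<^sup>+ x. ennreal (p x) * upper_density p r x ^ l \<partial>lborel)"
    proof (rule nn_integral_law_le[OF p sl(2)])
      fix x
      have "(\<integral>\<^sup>+ \<omega>. ?F (nn_vol k x \<omega> (I - {i})) 0 \<partial>PiM (I - {i}) (\<lambda>_. law p)) \<le> ennreal S * upper_density p r x ^ l"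
        using nn_integral_nn_vol_small[OF prob_space_law[OF p] sets_law kJ(1) k1 kJ(2), where x = x and Mu = "upper_density p r x",
            OF l \<alpha> r card emeasure_ball_le_upper_density]
        by (simp add: S_def indicator_def)
      also have "\<dots> \<le> ennreal c * upper_density p r x ^ l" by (intro mult_right_mono ennreal_leI) (auto simp: c_def)
      finally show "(\<integral>\<^sup>+ \<omega>. ?F (nn_vol k x \<omega> (I - {i})) (kth k (\<lambda>j. dist x (\<omega> j)) (I - {i})) \<partial>PiM (I - {i}) (\<lambda>_. law p)) \<le> ennreal c * upper_density p r x ^ l" .
    qed (simp add: c_def)
    also have "\<dots> = ennreal (c * enn2real L)"
      unfolding L_def[symmetric] by (subst L) (simp add: ennreal_mult c_def)
    finally show "(\<integral>\<^sup>+ \<omega>. ?F (nn_vol k (\<omega> i) \<omega> (I - {i})) 0 \<partial>PiM I (\<lambda>_. law p)) \<le> ennreal (c * enn2real L)"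
      unfolding sl(1)[symmetric] .
  qed (simp add: c_def)
qed

text \<open>A ball of radius \<open>s \<le> 2 * r\<close> contains the ball of radius \<open>s / 2 \<le> r\<close>, so up to a factor
\<open>2 ^ d\<close> the lower density controls the masses of all balls of radius at most \<open>2 * r\<close>.\<close>

lemma near_moment:
  assumes k: "1 \<le> k" and b: "0 < b" and r: "0 < r"
    and fin: "(\<integral>\<^sup>+ y. ennreal (p y) * xi_neg_powr (\<lambda>t. t\<^sup>2) b (lower_density p r y) \<partial>lborel) < \<infinity>"
  shows "\<exists>K\<ge>0. \<forall>I i. finite I \<longrightarrow> i \<in> I \<longrightarrow> k < card I \<longrightarrow>
     (\<integral>\<^sup>+ \<omega>. ennreal (nn_vol k (\<omega> i) \<omega> (I - {i}) powr (2 * b)) * indicator {..2 * r} (kth k (\<lambda>j. dist (\<omega> i) (\<omega> j)) (I - {i})) \<partial>PiM I (\<lambda>_. law p)) \<le> ennreal K"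
proof -
  define L where "L = (\<integral>\<^sup>+ y. ennreal (p y) * xi_neg_powr (\<lambda>t. t\<^sup>2) b (lower_density p r y) \<partial>lborel)"
  define S where "S = 2 ^ k * (\<Sum>j. (real j + 1) powr (2 * b) * exp (- real j / 2))"
  define c where "c = max 1 ((2 ^ DIM('a)) powr (2 * b) * S)"
  have S0: "0 \<le> S" unfolding S_def by (intro mult_nonneg_nonneg suminf_nonneg[OF summable_powr_exp]) auto
  have L: "L = ennreal (enn2real L)" using fin by (intro ennreal_enn2real[symmetric]) (simp add: L_def)
  show ?thesis
  proof (intro exI[of _ "c * enn2real L"] conjI allI impI)
    fix I :: "nat set" and i
    assume I: "finite I" "i \<in> I" "k < card I"
    let ?F = "\<lambda>u v :: real. ennreal (u powr (2 * b)) * indicator {..2 * r} v"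
    have F: "(\<lambda>(u, v). ?F u v) \<in> borel_measurable (borel \<Otimes>\<^sub>M borel)" by measurable
    have kJ: "finite (I - {i})" "k \<le> card (I - {i})" using I by auto
    note sl = nn_integral_PiM_slice[OF I(1,2) k F]
    have "(\<integral>\<^sup>+ x. (\<integral>\<^sup>+ \<omega>. ?F (nn_vol k x \<omega> (I - {i})) (kth k (\<lambda>j. dist x (\<omega> j)) (I - {i})) \<partial>PiM (I - {i}) (\<lambda>_. law p)) \<partial>law p)
        \<le> ennreal c * (\<integral>\<^sup>+ y. ennreal (p y) * xi_neg_powr (\<lambda>t. t\<^sup>2) b (lower_density p r y) \<partial>lborel)"
    proof (rule nn_integral_law_le[OF p sl(2)])
      fix x
      let ?m = "lower_density p r x"
      show "(\<integral>\<^sup>+ \<omega>. ?F (nn_vol k x \<omega> (I - {i})) (kth k (\<lambda>j. dist x (\<omega> j)) (I - {i})) \<partial>PiM (I - {i}) (\<lambda>_. law p))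
        \<le> ennreal c * xi_neg_powr (\<lambda>t. t\<^sup>2) b ?m"
      proof (cases "?m = 0")
        case True
        then show ?thesis by (simp add: xi_neg_powr_def c_def ennreal_mult_top)
      next
        case False
        have mf: "?m < \<infinity>" by (rule lower_density_finite[OF p r b])
        define \<mu> where "\<mu> = enn2real ?m"
        have \<mu>: "0 < \<mu>" using False mf by (simp add: \<mu>_def enn2real_positive_iff zero_less_iff_neq_zero)
        have low: "\<mu> / 2 ^ DIM('a) * ball_volume TYPE('a) s \<le> measure (law p) (ball x s)" if s: "0 < s" "s \<le> 2 * r" for s
        proof -
          have s2: "0 < s / 2" "s / 2 \<le> r" using s by auto
          have "\<mu> \<le> measure (law p) (ball x (s / 2)) / ball_volume TYPE('a) (s / 2)"
            unfolding \<mu>_def using lower_density_le_real[OF p r b s2] by (intro enn2real_leI) auto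
          moreover have v: "0 < ball_volume TYPE('a) (s / 2)" using s by simp
          ultimately have "\<mu> * ball_volume TYPE('a) (s / 2) \<le> measure (law p) (ball x (s / 2))"
            by (simp only: pos_le_divide_eq)
          also have "\<dots> \<le> measure (law p) (ball x s)" using s by (intro N.finite_measure_mono) auto
          also have "\<mu> * ball_volume TYPE('a) (s / 2) = \<mu> / 2 ^ DIM('a) * ball_volume TYPE('a) s"
            using ball_volume_scale[of 2 "s / 2", where 'a = 'a] by simp
          finally show ?thesis .
        qed
        have "(\<integral>\<^sup>+ \<omega>. ?F (nn_vol k x \<omega> (I - {i})) (kth k (\<lambda>j. dist x (\<omega> j)) (I - {i})) \<partial>PiM (I - {i}) (\<lambda>_. law p))
          \<le> ennreal ((\<mu> / 2 ^ DIM('a)) powr (- (2 * b)) * S)"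
          using nn_integral_nn_vol_near[OF prob_space_law[OF p] sets_law kJ(1) k kJ(2), where \<beta> = "2 * b" and \<mu> = "\<mu> / 2 ^ DIM('a)" and R = "2 * r" and x = x] b \<mu> low
          by (simp add: S_def indicator_def)
        also have "(\<mu> / 2 ^ DIM('a)) powr (- (2 * b)) * S = (2 ^ DIM('a)) powr (2 * b) * S * \<mu> powr (- (2 * b))"
          using \<mu> by (simp add: powr_divide powr_minus field_simps)
        also have "\<dots> \<le> c * \<mu> powr (- (2 * b))" by (intro mult_right_mono) (auto simp: c_def)
        also have "ennreal (c * \<mu> powr (- (2 * b))) = ennreal c * xi_neg_powr (\<lambda>t. t\<^sup>2) b ?m"
          by (simp only: xi_square_eq[OF p r b False mf] \<mu>_def) (intro ennreal_mult, auto simp: c_def)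
        finally show ?thesis by (simp add: ennreal_leI)
      qed
    qed (simp add: c_def)
    also have "\<dots> = ennreal (c * enn2real L)"
      unfolding L_def[symmetric] by (subst L) (simp add: ennreal_mult c_def)
    finally show "(\<integral>\<^sup>+ \<omega>. ?F (nn_vol k (\<omega> i) \<omega> (I - {i})) (kth k (\<lambda>j. dist (\<omega> i) (\<omega> j)) (I - {i})) \<partial>PiM I (\<lambda>_. law p)) \<le> ennreal (c * enn2real L)"
      unfolding sl(1)[symmetric] .
  qed (simp add: c_def)
qed

text \<open>Finiteness of the upper limit yields one \<open>m\<close> at which the integral over far pairs is finite; near pairs
have bounded ball volumes.\<close>

lemma pair_moment_finite:
  fixes \<kappa> :: "nat \<Rightarrow> real"
  assumes b: "0 < b"
    and lim: "limsup (\<lambda>m. ennreal ((real m powr b)\<^sup>2) *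
           (\<integral>\<^sup>+ y. (\<integral>\<^sup>+ x. indicator {z. norm (z - y) > ball_radius TYPE('a) (\<kappa> m / real m)} x *
               ennreal (p x * p y * (ball_volume TYPE('a) (norm (x - y)) powr b)\<^sup>2) \<partial>lborel) \<partial>lborel)) < \<infinity>"
  shows "(\<integral>\<^sup>+ x. (\<integral>\<^sup>+ y. ennreal (ball_volume TYPE('a) (dist x y) powr (2 * b)) \<partial>law p) \<partial>law p) < \<infinity>"
proof -
  have pm[measurable]: "p \<in> borel_measurable borel" and p0: "\<And>x. 0 \<le> p x" using p by (auto simp: prob_density_def)
  let ?T = "\<lambda>m. \<integral>\<^sup>+ y. (\<integral>\<^sup>+ x. indicator {z. norm (z - y) > ball_radius TYPE('a) (\<kappa> m / real m)} x *
               ennreal (p x * p y * (ball_volume TYPE('a) (norm (x - y)) powr b)\<^sup>2) \<partial>lborel) \<partial>lborel"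
  have "eventually (\<lambda>m. ennreal ((real m powr b)\<^sup>2) * ?T m < \<infinity>) sequentially"
    using lim by (rule Limsup_lessD)
  then obtain m where m: "1 \<le> m" "ennreal ((real m powr b)\<^sup>2) * ?T m < \<infinity>"
    by (metis (no_types, lifting) eventually_sequentially le_cases)
  define R where "R = ball_radius TYPE('a) (\<kappa> m / real m)"
  have "0 < (real m powr b)\<^sup>2" using m(1) by simp
  then have T: "?T m < \<infinity>" using m(2) by (rule ennreal_cmult_less_top_cancel)
  define B where "B = ball_volume TYPE('a) R powr (2 * b)"
  define u where "u x y = indicator {z. norm (z - y) > R} x * ennreal (ball_volume TYPE('a) (norm (x - y)) powr (2 * b))" for x y :: 'a
  have um: "(\<lambda>(y, x). u x y) \<in> borel_measurable (borel \<Otimes>\<^sub>M borel)"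
    unfolding u_def indicator_def by measurable
  have ule: "ennreal (ball_volume TYPE('a) (dist y x) powr (2 * b)) \<le> ennreal B + u x y" for x y :: 'a
  proof (cases "norm (x - y) > R")
    case False
    then have "ball_volume TYPE('a) (dist y x) powr (2 * b) \<le> B"
      unfolding B_def using b by (intro powr_mono2 ball_volume_mono) (auto simp: dist_norm norm_minus_commute)
    then have "ennreal (ball_volume TYPE('a) (dist y x) powr (2 * b)) \<le> ennreal B" by (rule ennreal_leI)
    then show ?thesis using add_increasing2[of "u x y"] by simp
  qed (simp add: u_def dist_norm norm_minus_commute)
  have um2: "(\<lambda>x. u x y) \<in> borel_measurable borel" for y
    unfolding u_def indicator_def by measurable
  have um3: "(\<lambda>y. \<integral>\<^sup>+ x. u x y \<partial>law p) \<in> borel_measurable borel"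
    using N.borel_measurable_nn_integral[of "\<lambda>y x. u x y" borel] um by (simp add: measurable_cong_sets[OF sets_pair_measure_cong[OF refl sets_law]])
  have "(\<integral>\<^sup>+ y. (\<integral>\<^sup>+ x. ennreal (ball_volume TYPE('a) (dist y x) powr (2 * b)) \<partial>law p) \<partial>law p)
     \<le> (\<integral>\<^sup>+ y. (\<integral>\<^sup>+ x. ennreal B + u x y \<partial>law p) \<partial>law p)"
    by (intro nn_integral_mono ule)
  also have "\<dots> = (\<integral>\<^sup>+ y. ennreal B + (\<integral>\<^sup>+ x. u x y \<partial>law p) \<partial>law p)"
    using um2 by (intro nn_integral_cong) (subst nn_integral_add, auto simp: measurable_cong_sets[OF sets_law] N.emeasure_space_1[simplified])
  also have "\<dots> = ennreal B + (\<integral>\<^sup>+ y. (\<integral>\<^sup>+ x. u x y \<partial>law p) \<partial>law p)"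
    using um3 by (subst nn_integral_add) (auto simp: measurable_cong_sets[OF sets_law] N.emeasure_space_1[simplified])
  also have "(\<integral>\<^sup>+ y. (\<integral>\<^sup>+ x. u x y \<partial>law p) \<partial>law p) = (\<integral>\<^sup>+ y. ennreal (p y) * (\<integral>\<^sup>+ x. ennreal (p x) * u x y \<partial>lborel) \<partial>lborel)"
    by (simp only: nn_integral_law[OF p um3]) (simp only: nn_integral_law[OF p um2])
  also have "\<dots> = ?T m"
  proof (intro nn_integral_cong)
    fix y
    have "ennreal (p y) * (\<integral>\<^sup>+ x. ennreal (p x) * u x y \<partial>lborel) = (\<integral>\<^sup>+ x. ennreal (p y) * (ennreal (p x) * u x y) \<partial>lborel)"
      using um2[of y] by (intro nn_integral_cmult[symmetric]) measurable
    also have "\<dots> = (\<integral>\<^sup>+ x. indicator {z. norm (z - y) > ball_radius TYPE('a) (\<kappa> m / real m)} x *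
               ennreal (p x * p y * (ball_volume TYPE('a) (norm (x - y)) powr b)\<^sup>2) \<partial>lborel)"
    proof (intro nn_integral_cong)
      fix x
      have "ball_volume TYPE('a) (norm (x - y)) powr (2 * b) = (ball_volume TYPE('a) (norm (x - y)) powr b)\<^sup>2"
        unfolding power2_eq_square by (simp flip: powr_add)
      then show "ennreal (p y) * (ennreal (p x) * u x y) = indicator {z. norm (z - y) > ball_radius TYPE('a) (\<kappa> m / real m)} x *
               ennreal (p x * p y * (ball_volume TYPE('a) (norm (x - y)) powr b)\<^sup>2)"
        using p0 by (simp add: u_def R_def[symmetric] ennreal_mult mult_ac)
    qed
    finally show "ennreal (p y) * (\<integral>\<^sup>+ x. ennreal (p x) * u x y \<partial>lborel) = (\<integral>\<^sup>+ x. indicator {z. norm (z - y) > ball_radius TYPE('a) (\<kappa> m / real m)} x *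
               ennreal (p x * p y * (ball_volume TYPE('a) (norm (x - y)) powr b)\<^sup>2) \<partial>lborel)" .
  qed
  also have "ennreal B + ?T m < \<infinity>" using T by simp
  finally show ?thesis .
qed

text \<open>The positive mass of the balls of radius \<open>r\<close>, and for \<open>2 * b > 1\<close> the uniform lower bound at radius \<open>2 * r\<close>,
are what the dominated convergence lemma requires.\<close>

lemma far_moment:
  assumes k: "1 \<le> k" and b: "0 < b" and r: "0 < r"
    and fin: "(\<integral>\<^sup>+ y. ennreal (p y) * xi_neg_powr (\<lambda>t. t\<^sup>2) b (lower_density p r y) \<partial>lborel) < \<infinity>"
    and pair: "(\<integral>\<^sup>+ x. (\<integral>\<^sup>+ y. ennreal (ball_volume TYPE('a) (dist x y) powr (2 * b)) \<partial>law p) \<partial>law p) < \<infinity>"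
  shows "\<exists>e :: nat \<Rightarrow> ennreal. e \<longlonglongrightarrow> 0 \<and> (\<forall>I i. finite I \<longrightarrow> i \<in> I \<longrightarrow> k < card I \<longrightarrow>
     (\<integral>\<^sup>+ \<omega>. ennreal (nn_vol k (\<omega> i) \<omega> (I - {i}) powr (2 * b)) * indicator {2 * r<..} (kth k (\<lambda>j. dist (\<omega> i) (\<omega> j)) (I - {i})) \<partial>PiM I (\<lambda>_. law p))
     \<le> of_nat (card I - 1) * e (card I - 1))"
proof -
  define h where "h x = (\<integral>\<^sup>+ y. ennreal (ball_volume TYPE('a) (dist x y) powr (2 * b)) \<partial>law p)" for x
  define q where "q x = measure (law p) (ball x (2 * r)) / 2" for x
  define w where "w n = (\<integral>\<^sup>+ x. ennreal (real n powr (2 * b - 1) * (1 - q x) ^ (n - 1)) * h x \<partial>law p)" for n :: nat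
  have hm: "h \<in> borel_measurable (law p)" unfolding h_def by measurable
  have qm: "q \<in> borel_measurable (law p)"
    unfolding q_def using measurable_measure_ball[of "2 * r"] by (simp add: measurable_cong_sets[OF sets_law])
  have q1: "q x \<le> 1" for x using N.prob_le_1[of "ball x (2 * r)"] unfolding q_def by linarith
  have mono: "measure (law p) (ball x r) \<le> measure (law p) (ball x (2 * r))" for x
    using r by (intro N.finite_measure_mono) auto
  note pos = AE_ball_mass_pos[OF p r b fin]
  have "w \<longlonglongrightarrow> 0"
    unfolding w_def
  proof (rule nn_integral_powr_decay[OF qm hm _ q1])
    show "(\<integral>\<^sup>+ x. h x \<partial>law p) < \<infinity>" using pair by (simp add: h_def)
    show "AE x in law p. 0 < q x" using pos
    proof eventually_elim
      case (elim x) then show ?case using mono[of x] by (simp add: q_def)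
    qed
    show "2 * b \<le> 1 \<or> (\<exists>\<delta>>0. AE x in law p. \<delta> \<le> q x)"
    proof (cases "2 * b \<le> 1")
      case False
      then obtain \<delta> where \<delta>: "0 < \<delta>" "\<And>x. 0 < measure (law p) (ball x r) \<Longrightarrow> \<delta> \<le> measure (law p) (ball x (2 * r))"
        using ball_mass_bounded_below[OF p r b _ fin] by force
      have "AE x in law p. \<delta> / 2 \<le> q x" using pos by eventually_elim (use \<delta> in \<open>auto simp: q_def\<close>)
      then show ?thesis using \<delta>(1) by (intro disjI2 exI[of _ "\<delta> / 2"]) simp
    qed simp
  qed
  then have lim: "(\<lambda>n. ennreal (real k * 2 ^ k) * w n) \<longlonglongrightarrow> 0"
    using ennreal_tendsto_cmult[of "ennreal (real k * 2 ^ k)" w 0 sequentially] \<open>w \<longlonglongrightarrow> 0\<close> by simp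
  show ?thesis
  proof (intro exI[of _ "\<lambda>n. ennreal (real k * 2 ^ k) * w n"] conjI allI impI lim)
    fix I :: "nat set" and i
    assume I: "finite I" "i \<in> I" "k < card I"
    define n where "n = card I - 1"
    let ?F = "\<lambda>u v :: real. ennreal (u powr (2 * b)) * indicator {2 * r<..} v"
    have F: "(\<lambda>(u, v). ?F u v) \<in> borel_measurable (borel \<Otimes>\<^sub>M borel)" by measurable
    have kJ: "finite (I - {i})" "k \<le> card (I - {i})" and n: "card (I - {i}) = n" "1 \<le> n" using I k by (auto simp: n_def)
    note sl = nn_integral_PiM_slice[OF I(1,2) k F]
    have "(\<integral>\<^sup>+ x. (\<integral>\<^sup>+ \<omega>. ?F (nn_vol k x \<omega> (I - {i})) (kth k (\<lambda>j. dist x (\<omega> j)) (I - {i})) \<partial>PiM (I - {i}) (\<lambda>_. law p)) \<partial>law p)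
       \<le> (\<integral>\<^sup>+ x. ennreal (real n * (real k * 2 ^ k)) * (ennreal (real n powr (2 * b - 1) * (1 - q x) ^ (n - 1)) * h x) \<partial>law p)"
    proof (intro nn_integral_mono)
      fix x
      have q0: "0 \<le> (1 - q x) ^ (n - 1)" using q1[of x] by simp
      have "(\<integral>\<^sup>+ \<omega>. ?F (nn_vol k x \<omega> (I - {i})) (kth k (\<lambda>j. dist x (\<omega> j)) (I - {i})) \<partial>PiM (I - {i}) (\<lambda>_. law p))
        \<le> ennreal (real n powr (2 * b) * (real k * 2 ^ k * (1 - q x) ^ (n - 1))) * h x"
        using nn_integral_nn_vol_far[OF prob_space_law[OF p] sets_law kJ(1) k kJ(2), where \<beta> = "2 * b" and x = x and R = "2 * r"] b n
        by (simp add: h_def q_def indicator_def)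
      also have "real n powr (2 * b) = real n * real n powr (2 * b - 1)"
        using n by (simp add: powr_diff)
      also have "real n * real n powr (2 * b - 1) * (real k * 2 ^ k * (1 - q x) ^ (n - 1))
          = (real n * (real k * 2 ^ k)) * (real n powr (2 * b - 1) * (1 - q x) ^ (n - 1))" by (simp add: mult_ac)
      also have "ennreal \<dots> * h x = ennreal (real n * (real k * 2 ^ k)) * (ennreal (real n powr (2 * b - 1) * (1 - q x) ^ (n - 1)) * h x)"
        using q0 by (subst ennreal_mult) (auto simp: mult.assoc)
      finally show "(\<integral>\<^sup>+ \<omega>. ?F (nn_vol k x \<omega> (I - {i})) (kth k (\<lambda>j. dist x (\<omega> j)) (I - {i})) \<partial>PiM (I - {i}) (\<lambda>_. law p))
        \<le> ennreal (real n * (real k * 2 ^ k)) * (ennreal (real n powr (2 * b - 1) * (1 - q x) ^ (n - 1)) * h x)" .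
    qed
    also have "\<dots> = ennreal (real n * (real k * 2 ^ k)) * w n"
      unfolding w_def
    proof (rule nn_integral_cmult)
      note [measurable] = qm hm
      show "(\<lambda>x. ennreal (real n powr (2 * b - 1) * (1 - q x) ^ (n - 1)) * h x) \<in> borel_measurable (law p)"
        by measurable
    qed
    also have "\<dots> = of_nat n * (ennreal (real k * 2 ^ k) * w n)"
    proof -
      have "ennreal (real n * (real k * 2 ^ k)) = ennreal (real n) * ennreal (real k * 2 ^ k)"
        by (intro ennreal_mult) auto
      then show ?thesis by (simp only: ennreal_of_nat_eq_real_of_nat mult.assoc)
    qed
    finally show "(\<integral>\<^sup>+ \<omega>. ?F (nn_vol k (\<omega> i) \<omega> (I - {i})) (kth k (\<lambda>j. dist (\<omega> i) (\<omega> j)) (I - {i})) \<partial>PiM I (\<lambda>_. law p))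
       \<le> of_nat (card I - 1) * (ennreal (real k * 2 ^ k) * w (card I - 1))"
      unfolding sl(1)[symmetric] n_def .
  qed
qed

end

section \<open>Second moments of the summands\<close>

lemma nn_integral_real_bound:
  assumes f: "f \<in> borel_measurable M" "\<And>x. 0 \<le> f x" and A: "0 \<le> A" "(\<integral>\<^sup>+ x. ennreal (f x) \<partial>M) \<le> ennreal A"
  shows "integrable M f" "(\<integral>x. f x \<partial>M) \<le> A"
proof -
  have "(\<integral>\<^sup>+ x. ennreal (f x) \<partial>M) < \<infinity>" using A(2) by (rule le_less_trans) simp
  then show i: "integrable M f" using f by (intro integrableI_nonneg) auto
  have "ennreal (\<integral>x. f x \<partial>M) \<le> ennreal A"
    using A(2) nn_integral_eq_integral[OF i] f(2) by simp
  then show "(\<integral>x. f x \<partial>M) \<le> A" using A(1) by (simp add: ennreal_le_iff)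
qed

lemma integrable_square_sum:
  fixes f :: "'i \<Rightarrow> 'b \<Rightarrow> real"
  assumes "finite S" "\<And>i. i \<in> S \<Longrightarrow> f i \<in> borel_measurable M" "\<And>i. i \<in> S \<Longrightarrow> integrable M (\<lambda>x. (f i x)\<^sup>2)"
  shows "integrable M (\<lambda>x. (\<Sum>i\<in>S. f i x)\<^sup>2)"
  using assms
proof (induction S)
  case (insert i S)
  have "integrable M (\<lambda>x. (f i x - (- (\<Sum>i\<in>S. f i x)))\<^sup>2)"
    using insert by (intro integrable_square_diff) auto
  then show ?case using insert by simp
qed simp

context
  fixes p :: "'a::euclidean_space \<Rightarrow> real"
  assumes p: "prob_density p"
begin

interpretation N: prob_space "law p" by (rule prob_space_law[OF p])

text \<open>Points are null sets of the law, which has a density.\<close>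

lemma AE_distinct:
  fixes I :: "nat set"
  assumes I: "finite I"
  shows "AE \<omega> in PiM I (\<lambda>_. law p). \<forall>i\<in>I. \<forall>j\<in>I. i \<noteq> j \<longrightarrow> \<omega> i \<noteq> \<omega> j"
proof (intro AE_finite_allI I)
  fix i j assume ij: "i \<in> I" "j \<in> I"
  show "AE \<omega> in PiM I (\<lambda>_. law p). i \<noteq> j \<longrightarrow> \<omega> i \<noteq> \<omega> j"
  proof (cases "i = j")
    case False
    have c: "(\<lambda>\<omega>. \<omega> j) \<in> borel_measurable (PiM I (\<lambda>_. law p))" if "j \<in> I" for j
      using measurable_component_singleton[OF that, of "\<lambda>_. law p"] by (simp add: measurable_cong_sets[OF refl sets_law])
    have d: "(\<lambda>\<omega>. dist (\<omega> i) (\<omega> j)) \<in> borel_measurable (PiM I (\<lambda>_. law p))"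
      by (intro borel_measurable_dist c ij)
    have "AE \<omega> in PiM I (\<lambda>_. law p). dist (\<omega> i) (\<omega> j) \<noteq> 0"
    proof (rule AE_PiM_coordinate[OF prob_space_law[OF p] I ij(2)])
      show "Measurable.pred (PiM I (\<lambda>_. law p)) (\<lambda>\<omega>. dist (\<omega> i) (\<omega> j) \<noteq> 0)"
        using d by measurable
      fix x :: "nat \<Rightarrow> 'a"
      have "AE y in lborel. y \<noteq> x i" by (rule AE_lborel_singleton)
      then have "AE y in law p. y \<noteq> x i"
        using p unfolding law_def prob_density_def by (subst AE_density) auto
      then show "AE y in law p. dist ((x(j := y)) i) ((x(j := y)) j) \<noteq> 0"
        by eventually_elim (use False in auto)
    qed
    then show ?thesis by eventually_elim auto
  qed simp
qed

lemma nn_vol_pos: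
  assumes "finite I" "i \<in> I" "1 \<le> k" "k < card I" and d: "\<forall>i\<in>I. \<forall>j\<in>I. i \<noteq> j \<longrightarrow> \<omega> i \<noteq> (\<omega> j :: 'a)"
  shows "0 < nn_vol k (\<omega> i) \<omega> (I - {i})"
proof -
  have J: "finite (I - {i})" "k \<le> card (I - {i})" using assms by auto
  obtain j where j: "j \<in> I - {i}" "kth k (\<lambda>j. dist (\<omega> i) (\<omega> j)) (I - {i}) = dist (\<omega> i) (\<omega> j)"
    using kth_attained[OF J(1) assms(3) J(2)] by blast
  have "0 < card (I - {i})" using J assms(3) by linarith
  moreover have "\<omega> i \<noteq> \<omega> j" using d j(1) assms(2) by auto
  ultimately show ?thesis by (simp add: nn_vol_def j(2) zero_less_mult_iff)
qed

lemma small_moment_eventually: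
  assumes l: "1 \<le> l" "l \<le> k" "- (2 * a) < real l" and U: "property_U p l a"
  shows "\<exists>K\<ge>0. \<forall>\<^sub>F m in sequentially. \<forall>i\<in>{1..m}.
     (\<integral>\<^sup>+ \<omega>. ennreal (nn_vol k (\<omega> i) \<omega> ({1..m} - {i}) powr (2 * a)) * indicator {0<..1} (nn_vol k (\<omega> i) \<omega> ({1..m} - {i})) \<partial>PiM {1..m} (\<lambda>_. law p)) \<le> ennreal K"
proof (cases "0 \<le> a")
  case True
  show ?thesis
  proof (intro exI[of _ 1] conjI always_eventually allI ballI)
    fix m i :: nat
    interpret P: prob_space "PiM {1..m} (\<lambda>_. law p)" by (intro prob_space_PiM prob_space_law p)
    have "ennreal (v powr (2 * a)) * indicator {0<..1} v \<le> 1" for v :: real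
    proof (cases "v \<in> {0<..1}")
      case t: True
      then have "v powr (2 * a) \<le> 1 powr (2 * a)" using True by (intro powr_mono2) auto
      then show ?thesis using t by simp
    qed simp
    then have "(\<integral>\<^sup>+ \<omega>. ennreal (nn_vol k (\<omega> i) \<omega> ({1..m} - {i}) powr (2 * a)) * indicator {0<..1} (nn_vol k (\<omega> i) \<omega> ({1..m} - {i})) \<partial>PiM {1..m} (\<lambda>_. law p))
      \<le> (\<integral>\<^sup>+ \<omega>. 1 \<partial>PiM {1..m} (\<lambda>_. law p))" by (intro nn_integral_mono)
    also have "(\<integral>\<^sup>+ \<omega>. 1 \<partial>PiM {1..m} (\<lambda>_. law p)) = 1"
      by (simp only: nn_integral_const P.emeasure_space_1 mult_1)
    finally show "(\<integral>\<^sup>+ \<omega>. ennreal (nn_vol k (\<omega> i) \<omega> ({1..m} - {i}) powr (2 * a)) * indicator {0<..1} (nn_vol k (\<omega> i) \<omega> ({1..m} - {i})) \<partial>PiM {1..m} (\<lambda>_. law p)) \<le> ennreal 1"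
      by (simp only: ennreal_1 mult_zero_right add_0_right)
  qed simp
next
  case False
  then obtain r where r: "0 < r" "(\<integral>\<^sup>+ x. ennreal (p x) * upper_density p r x ^ l \<partial>lborel) < \<infinity>"
    using U by (auto simp: property_U_def)
  have \<alpha>: "0 \<le> - (2 * a)" using False by simp
  obtain K where K: "0 \<le> K" "\<And>I i. finite I \<Longrightarrow> i \<in> I \<Longrightarrow> k < card I \<Longrightarrow> 2 / ball_volume TYPE('a) r \<le> real (card (I - {i})) \<Longrightarrow>
     (\<integral>\<^sup>+ \<omega>. ennreal (nn_vol k (\<omega> i) \<omega> (I - {i}) powr (- (- (2 * a)))) * indicator {0<..1} (nn_vol k (\<omega> i) \<omega> (I - {i})) \<partial>PiM I (\<lambda>_. law p)) \<le> ennreal K"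
    using small_moment[OF p l(1,2) \<alpha> l(3) r] by blast
  have "\<forall>\<^sub>F m in sequentially. k < m \<and> 2 / ball_volume TYPE('a) r \<le> real (m - 1)"
    by (intro eventually_conj eventually_gt_at_top) real_asymp
  then have "\<forall>\<^sub>F m in sequentially. \<forall>i\<in>{1..m}.
     (\<integral>\<^sup>+ \<omega>. ennreal (nn_vol k (\<omega> i) \<omega> ({1..m} - {i}) powr (2 * a)) * indicator {0<..1} (nn_vol k (\<omega> i) \<omega> ({1..m} - {i})) \<partial>PiM {1..m} (\<lambda>_. law p)) \<le> ennreal K"
  proof eventually_elim
    case (elim m)
    show ?case
    proof
      fix i assume i: "i \<in> {1..m}"
      then have "card ({1..m} - {i}) = m - 1" by simp
      then show "(\<integral>\<^sup>+ \<omega>. ennreal (nn_vol k (\<omega> i) \<omega> ({1..m} - {i}) powr (2 * a)) * indicator {0<..1} (nn_vol k (\<omega> i) \<omega> ({1..m} - {i})) \<partial>PiM {1..m} (\<lambda>_. law p)) \<le> ennreal K"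
        using K(2)[of "{1..m}" i] i elim by simp
    qed
  qed
  then show ?thesis using K(1) by blast
qed

lemma large_moment_eventually:
  assumes k: "1 \<le> k" and L: "property_L p (\<lambda>t. t\<^sup>2) b"
  shows "\<exists>K\<ge>0. \<exists>e :: nat \<Rightarrow> ennreal. e \<longlonglongrightarrow> 0 \<and> (\<forall>m>k. \<forall>i\<in>{1..m}.
     (\<integral>\<^sup>+ \<omega>. ennreal (nn_vol k (\<omega> i) \<omega> ({1..m} - {i}) powr (2 * b)) * indicator {1<..} (nn_vol k (\<omega> i) \<omega> ({1..m} - {i})) \<partial>PiM {1..m} (\<lambda>_. law p))
     \<le> ennreal K + of_nat (m - 1) * e (m - 1))"
proof (cases "b \<le> 0")
  case True
  show ?thesis
  proof (intro exI[of _ 1] exI[of _ "\<lambda>_. 0"] conjI allI ballI impI)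
    fix m i :: nat
    interpret P: prob_space "PiM {1..m} (\<lambda>_. law p)" by (intro prob_space_PiM prob_space_law p)
    have "ennreal (v powr (2 * b)) * indicator {1<..} v \<le> 1" for v :: real
    proof (cases "1 < v")
      case t: True
      then have "v powr (2 * b) \<le> v powr 0" using True by (intro powr_mono) auto
      then show ?thesis using t by simp
    qed simp
    then have "(\<integral>\<^sup>+ \<omega>. ennreal (nn_vol k (\<omega> i) \<omega> ({1..m} - {i}) powr (2 * b)) * indicator {1<..} (nn_vol k (\<omega> i) \<omega> ({1..m} - {i})) \<partial>PiM {1..m} (\<lambda>_. law p))
      \<le> (\<integral>\<^sup>+ \<omega>. 1 \<partial>PiM {1..m} (\<lambda>_. law p))" by (intro nn_integral_mono)
    also have "(\<integral>\<^sup>+ \<omega>. 1 \<partial>PiM {1..m} (\<lambda>_. law p)) = 1"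
      by (simp only: nn_integral_const P.emeasure_space_1 mult_1)
    finally show "(\<integral>\<^sup>+ \<omega>. ennreal (nn_vol k (\<omega> i) \<omega> ({1..m} - {i}) powr (2 * b)) * indicator {1<..} (nn_vol k (\<omega> i) \<omega> ({1..m} - {i})) \<partial>PiM {1..m} (\<lambda>_. law p)) \<le> ennreal 1 + of_nat (m - 1) * 0"
      by (simp only: ennreal_1 mult_zero_right add_0_right)
  qed simp_all
next
  case False
  then have b: "0 < b" by simp
  obtain r where r: "0 < r" "(\<integral>\<^sup>+ x. ennreal (p x) * xi_neg_powr (\<lambda>t. t\<^sup>2) b (lower_density p r x) \<partial>lborel) < \<infinity>"
    using L b by (auto simp: property_L_def)
  obtain \<kappa> :: "nat \<Rightarrow> real" where "limsup (\<lambda>m. ennreal ((real m powr b)\<^sup>2) *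
           (\<integral>\<^sup>+ y. (\<integral>\<^sup>+ x. indicator {z. norm (z - y) > ball_radius TYPE('a) (\<kappa> m / real m)} x *
               ennreal (p x * p y * (ball_volume TYPE('a) (norm (x - y)) powr b)\<^sup>2) \<partial>lborel) \<partial>lborel)) < \<infinity>"
    using L b by (auto simp: property_L_def)
  then have pair: "(\<integral>\<^sup>+ x. (\<integral>\<^sup>+ y. ennreal (ball_volume TYPE('a) (dist x y) powr (2 * b)) \<partial>law p) \<partial>law p) < \<infinity>"
    by (rule pair_moment_finite[OF p b])
  obtain K where K: "0 \<le> K" "\<And>I i. finite I \<Longrightarrow> i \<in> I \<Longrightarrow> k < card I \<Longrightarrow>
     (\<integral>\<^sup>+ \<omega>. ennreal (nn_vol k (\<omega> i) \<omega> (I - {i}) powr (2 * b)) * indicator {..2 * r} (kth k (\<lambda>j. dist (\<omega> i) (\<omega> j)) (I - {i})) \<partial>PiM I (\<lambda>_. law p)) \<le> ennreal K"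
    using near_moment[OF p k b r] by blast
  obtain e :: "nat \<Rightarrow> ennreal" where e: "e \<longlonglongrightarrow> 0" "\<And>I i. finite I \<Longrightarrow> i \<in> I \<Longrightarrow> k < card I \<Longrightarrow>
     (\<integral>\<^sup>+ \<omega>. ennreal (nn_vol k (\<omega> i) \<omega> (I - {i}) powr (2 * b)) * indicator {2 * r<..} (kth k (\<lambda>j. dist (\<omega> i) (\<omega> j)) (I - {i})) \<partial>PiM I (\<lambda>_. law p))
     \<le> of_nat (card I - 1) * e (card I - 1)"
    using far_moment[OF p k b r pair] by blast
  show ?thesis
  proof (intro exI[of _ K] exI[of _ e] conjI allI ballI impI K(1) e(1))
    fix m i :: nat assume m: "k < m" "i \<in> {1..m}"
    let ?P = "PiM {1..m} (\<lambda>_. law p)" and ?J = "{1..m} - {i}"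
    have i: "finite {1..m}" "i \<in> {1..m}" "k < card {1..m}" using m by auto
    note meas = measurable_nn_vol_joint[OF p i(1,2) Diff_subset k, of "{i}"]
    let ?u = "\<lambda>\<omega>. ennreal (nn_vol k (\<omega> i) \<omega> ?J powr (2 * b))" and ?D = "\<lambda>\<omega>. kth k (\<lambda>j. dist (\<omega> i) (\<omega> j)) ?J"
    have um: "?u \<in> borel_measurable ?P" using meas(2) by measurable
    have m1: "(\<lambda>\<omega>. ?u \<omega> * indicator {..2 * r} (?D \<omega>)) \<in> borel_measurable ?P"
      "(\<lambda>\<omega>. ?u \<omega> * indicator {2 * r<..} (?D \<omega>)) \<in> borel_measurable ?P"
      by (intro borel_measurable_times_ennreal um measurable_compose[OF meas(1) borel_measurable_indicator]; simp)+
    have "(\<integral>\<^sup>+ \<omega>. ?u \<omega> * indicator {1<..} (nn_vol k (\<omega> i) \<omega> ?J) \<partial>?P)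
      \<le> (\<integral>\<^sup>+ \<omega>. ?u \<omega> * indicator {..2 * r} (?D \<omega>) + ?u \<omega> * indicator {2 * r<..} (?D \<omega>) \<partial>?P)"
      by (intro nn_integral_mono) (auto simp: indicator_def)
    also have "\<dots> = (\<integral>\<^sup>+ \<omega>. ?u \<omega> * indicator {..2 * r} (?D \<omega>) \<partial>?P) + (\<integral>\<^sup>+ \<omega>. ?u \<omega> * indicator {2 * r<..} (?D \<omega>) \<partial>?P)"
      by (rule nn_integral_add[OF m1])
    also have "\<dots> \<le> ennreal K + of_nat (m - 1) * e (m - 1)"
      using K(2)[OF i] e(2)[OF i] by (intro add_mono) simp_all
    finally show "(\<integral>\<^sup>+ \<omega>. ?u \<omega> * indicator {1<..} (nn_vol k (\<omega> i) \<omega> ?J) \<partial>?P) \<le> ennreal K + of_nat (m - 1) * e (m - 1)" .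
  qed
qed

text \<open>The rate \<open>o(m)\<close> is what the factor \<open>1/m\<close> in the variance bound can absorb. The case \<open>l = k\<close> concerns the \<open>k\<close>-th
neighbour and the case \<open>k = l + 1\<close> the next one.\<close>

lemma phi_moment:
  fixes \<phi> :: "real \<Rightarrow> real"
  assumes l: "1 \<le> l" "l \<le> k" "- (2 * a) < real l"
    and \<phi>: "\<phi> \<in> borel_measurable borel" and env: "\<And>u. u > 0 \<Longrightarrow> \<bar>\<phi> u\<bar> \<le> C * envelope a b u"
    and U: "property_U p l a" and L: "property_L p (\<lambda>t. t\<^sup>2) b"
  shows "\<exists>e :: nat \<Rightarrow> real. e \<longlonglongrightarrow> 0 \<and> (\<forall>\<^sub>F m in sequentially. 0 \<le> e m \<and> (\<forall>i\<in>{1..m}.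
     (\<integral>\<^sup>+ \<omega>. ennreal ((\<phi> (nn_vol k (\<omega> i) \<omega> ({1..m} - {i})))\<^sup>2) \<partial>PiM {1..m} (\<lambda>_. law p)) \<le> ennreal (real m * e m)))"
proof -
  have k: "1 \<le> k" using l by simp
  obtain K1 where K1: "0 \<le> K1" "\<forall>\<^sub>F m in sequentially. \<forall>i\<in>{1..m}.
     (\<integral>\<^sup>+ \<omega>. ennreal (nn_vol k (\<omega> i) \<omega> ({1..m} - {i}) powr (2 * a)) * indicator {0<..1} (nn_vol k (\<omega> i) \<omega> ({1..m} - {i})) \<partial>PiM {1..m} (\<lambda>_. law p)) \<le> ennreal K1"
    using small_moment_eventually[OF l U] by blast
  obtain K2 e where K2: "0 \<le> K2" "(e :: nat \<Rightarrow> ennreal) \<longlonglongrightarrow> 0" "\<And>m i. k < m \<Longrightarrow> i \<in> {1..m} \<Longrightarrow>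
     (\<integral>\<^sup>+ \<omega>. ennreal (nn_vol k (\<omega> i) \<omega> ({1..m} - {i}) powr (2 * b)) * indicator {1<..} (nn_vol k (\<omega> i) \<omega> ({1..m} - {i})) \<partial>PiM {1..m} (\<lambda>_. law p))
     \<le> ennreal K2 + of_nat (m - 1) * e (m - 1)"
    using large_moment_eventually[OF k L] by blast
  define E where "E m = C\<^sup>2 * ((K1 + K2) / real m + enn2real (e (m - 1)))" for m
  have e1: "(\<lambda>m. e (m - 1)) \<longlonglongrightarrow> 0"
    using K2(2) by (rule filterlim_compose) (simp add: filterlim_minus_const_nat_at_top)
  have "(\<lambda>m. enn2real (e (m - 1))) \<longlonglongrightarrow> 0" using e1 by (intro tendsto_enn2real) simp_all
  from tendsto_mult[OF tendsto_const tendsto_add[OF lim_const_over_n this]]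
  have "(\<lambda>m. C\<^sup>2 * ((K1 + K2) / real m + enn2real (e (m - 1)))) \<longlonglongrightarrow> C\<^sup>2 * (0 + 0)" .
  then have "E \<longlonglongrightarrow> 0" by (simp add: E_def[abs_def])
  moreover have "\<forall>\<^sub>F m in sequentially. e (m - 1) < \<infinity>"
    using e1 by (rule order_tendstoD) simp
  then have "\<forall>\<^sub>F m in sequentially. 0 \<le> E m \<and> (\<forall>i\<in>{1..m}.
     (\<integral>\<^sup>+ \<omega>. ennreal ((\<phi> (nn_vol k (\<omega> i) \<omega> ({1..m} - {i})))\<^sup>2) \<partial>PiM {1..m} (\<lambda>_. law p)) \<le> ennreal (real m * E m))"
    using K1(2) eventually_gt_at_top[of k]
  proof eventually_elim
    case (elim m)
    have E0: "0 \<le> E m" using K1 K2 by (simp add: E_def)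
    moreover have "(\<integral>\<^sup>+ \<omega>. ennreal ((\<phi> (nn_vol k (\<omega> i) \<omega> ({1..m} - {i})))\<^sup>2) \<partial>PiM {1..m} (\<lambda>_. law p)) \<le> ennreal (real m * E m)"
      if i: "i \<in> {1..m}" for i
    proof -
      let ?P = "PiM {1..m} (\<lambda>_. law p)" and ?V = "\<lambda>\<omega>. nn_vol k (\<omega> i) \<omega> ({1..m} - {i})"
      have ki: "k < card {1..m}" using elim by simp
      have V: "?V \<in> borel_measurable ?P"
        using i by (intro measurable_nn_vol_joint(2)[OF p _ _ _ k]) auto
      define A where "A v = ennreal (v powr (2 * a)) * indicator {0<..1} v" for v :: real
      define B where "B v = ennreal (v powr (2 * b)) * indicator {1<..} v" for v :: real
      have AB: "A \<in> borel_measurable borel" "B \<in> borel_measurable borel" unfolding A_def B_def by measurable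
      note ABV = measurable_compose[OF V AB(1)] measurable_compose[OF V AB(2)]
      have pt: "ennreal ((\<phi> v)\<^sup>2) \<le> ennreal (C\<^sup>2) * (A v + B v)" if v: "0 < v" for v
      proof -
        have "(\<phi> v)\<^sup>2 \<le> (C * envelope a b v)\<^sup>2" using env[OF v] by (rule abs_le_square_iff[THEN iffD1, OF order_trans]) simp
        then have 1: "ennreal ((\<phi> v)\<^sup>2) \<le> ennreal (C\<^sup>2) * ennreal ((envelope a b v)\<^sup>2)"
          by (simp add: power_mult_distrib ennreal_leI flip: ennreal_mult)
        have sq: "(v powr c)\<^sup>2 = v powr (2 * c)" for c by (simp add: power2_eq_square flip: powr_add)
        have "ennreal ((envelope a b v)\<^sup>2) = A v + B v"
          using v by (auto simp: envelope_def A_def B_def sq)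
        then show ?thesis using 1 by simp
      qed
      have "AE \<omega> in ?P. ennreal ((\<phi> (?V \<omega>))\<^sup>2) \<le> ennreal (C\<^sup>2) * (A (?V \<omega>) + B (?V \<omega>))"
        using AE_distinct[OF finite_atLeastAtMost]
      proof eventually_elim
        case d: (elim \<omega>)
        show ?case by (rule pt[OF nn_vol_pos[OF finite_atLeastAtMost i k ki d]])
      qed
      then have "(\<integral>\<^sup>+ \<omega>. ennreal ((\<phi> (?V \<omega>))\<^sup>2) \<partial>?P) \<le> (\<integral>\<^sup>+ \<omega>. ennreal (C\<^sup>2) * (A (?V \<omega>) + B (?V \<omega>)) \<partial>?P)"
        by (rule nn_integral_mono_AE)
      also have "\<dots> = ennreal (C\<^sup>2) * ((\<integral>\<^sup>+ \<omega>. A (?V \<omega>) \<partial>?P) + (\<integral>\<^sup>+ \<omega>. B (?V \<omega>) \<partial>?P))"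
        by (simp only: nn_integral_cmult[OF borel_measurable_add[OF ABV]] nn_integral_add[OF ABV])
      also have "\<dots> \<le> ennreal (C\<^sup>2) * (ennreal K1 + (ennreal K2 + of_nat (m - 1) * e (m - 1)))"
        using elim(2) K2(3)[OF elim(3) i] i unfolding A_def B_def by (intro mult_left_mono add_mono) auto
      also have "of_nat (m - 1) * e (m - 1) = ennreal (real (m - 1) * enn2real (e (m - 1)))"
      proof -
        have "e (m - 1) = ennreal (enn2real (e (m - 1)))" using elim(1) by (intro ennreal_enn2real[symmetric]) simp
        then show ?thesis by (metis ennreal_mult ennreal_of_nat_eq_real_of_nat enn2real_nonneg of_nat_0_le_iff)
      qed
      also have "ennreal (C\<^sup>2) * (ennreal K1 + (ennreal K2 + ennreal (real (m - 1) * enn2real (e (m - 1)))))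
         = ennreal (C\<^sup>2 * (K1 + (K2 + real (m - 1) * enn2real (e (m - 1)))))"
        using K1(1) K2(1) by (simp add: ennreal_mult)
      also have "\<dots> \<le> ennreal (C\<^sup>2 * (K1 + (K2 + real m * enn2real (e (m - 1)))))"
        by (intro ennreal_leI mult_left_mono add_left_mono mult_right_mono) auto
      also have "C\<^sup>2 * (K1 + (K2 + real m * enn2real (e (m - 1)))) = real m * E m"
        using elim(3) by (simp add: E_def field_simps)
      finally show ?thesis .
    qed
    ultimately show ?case by blast
  qed
  ultimately show ?thesis by blast
qed

end

section \<open>Variance of the nearest-neighbour statistic\<close>

lemma measurable_sample_component:
  "i \<in> I \<Longrightarrow> (\<lambda>\<omega>. \<omega> i) \<in> borel_measurable (PiM I (\<lambda>_. law p))"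
  using measurable_component_singleton[of i I "\<lambda>_. law p"] by (simp add: measurable_cong_sets[OF refl sets_law])

text \<open>The image of the sample as a set, as it enters \<open>knn_dist\<close>, is the image of these indices, on which the sample is
injective. They take finitely many values, each on a measurable event.\<close>

definition first_occurrences :: "(nat \<Rightarrow> 'a) \<Rightarrow> nat set \<Rightarrow> nat set" where
  "first_occurrences x J = {j \<in> J. \<forall>l\<in>J. l < j \<longrightarrow> x l \<noteq> x j}"

lemma first_occurrences_eq_iff:
  assumes "K \<subseteq> J"
  shows "first_occurrences x J = K \<longleftrightarrow> (\<forall>j\<in>J. (j \<in> K) = (\<forall>l\<in>J. l < j \<longrightarrow> x l \<noteq> x j))"
  unfolding first_occurrences_def using assms by blast

lemma first_occurrences_represent:
  shows inj_on_first_occurrences: "inj_on x (first_occurrences x J)"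
    and image_first_occurrences: "x ` first_occurrences x J = x ` J"
proof -
  show "inj_on x (first_occurrences x J)"
    by (rule inj_onI) (auto simp: first_occurrences_def, metis linorder_neqE_nat)
  have ex: "\<exists>l\<in>first_occurrences x J. x l = x j" if "j \<in> J" for j
  proof -
    define l where "l = (LEAST l. l \<in> J \<and> x l = x j)"
    have l: "l \<in> J \<and> x l = x j" unfolding l_def using that by (intro LeastI) auto
    have "\<not> (l' \<in> J \<and> x l' = x j)" if "l' < l" for l' using that unfolding l_def by (rule not_less_Least)
    then have "l \<in> first_occurrences x J" using l by (auto simp: first_occurrences_def)
    then show ?thesis using l by blast
  qed
  have "x ` J \<subseteq> x ` first_occurrences x J"
  proof (rule image_subsetI)
    fix j assume "j \<in> J"
    then obtain l where "l \<in> first_occurrences x J" "x l = x j" using ex by blast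
    then show "x j \<in> x ` first_occurrences x J" by (metis imageI)
  qed
  moreover have "first_occurrences x J \<subseteq> J" by (auto simp: first_occurrences_def)
  ultimately show "x ` first_occurrences x J = x ` J" by blast
qed

lemma knn_dist_image:
  assumes "inj_on x J"
  shows "knn_dist k y (x ` J) = kth k (\<lambda>j. dist y (x j)) J"
proof -
  have "image_mset (dist y) (mset_set (x ` J)) = image_mset (\<lambda>j. dist y (x j)) (mset_set J)"
    using assms by (simp flip: image_mset_mset_set add: multiset.map_comp comp_def)
  then show ?thesis by (simp add: knn_dist_def kth_def)
qed

lemma knn_dist_first_occurrences:
  "knn_dist k y (x ` J) = kth k (\<lambda>j. dist y (x j)) (first_occurrences x J)"
  using knn_dist_image[OF inj_on_first_occurrences, of k y x J] by (simp add: image_first_occurrences)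

lemma U_stat_eq_nn_vol:
  fixes x :: "nat \<Rightarrow> 'a::euclidean_space"
  assumes "i \<in> {1..m}" "inj_on x ({1..m} - {i})"
  shows "U_stat k m x i = nn_vol k (x i) x ({1..m} - {i})"
proof -
  have "real (card ({1..m} - {i})) = real m - 1" using assms(1) by (auto simp: of_nat_diff)
  then show ?thesis unfolding U_stat_def nn_vol_def measure_ball knn_dist_image[OF assms(2)] by (simp only:)
qed

lemma measurable_U_stat:
  fixes p :: "'a::euclidean_space \<Rightarrow> real"
  assumes i: "i \<in> {1..m}" and k: "1 \<le> k"
  shows "(\<lambda>\<omega>. U_stat k m \<omega> i) \<in> borel_measurable (PiM {1..m} (\<lambda>_. law p))"
proof -
  let ?P = "PiM {1..m} (\<lambda>_. law p)" and ?J = "{1..m} - {i}"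
  have fin: "finite (Pow ?J)" by simp
  have d: "(\<lambda>\<omega>. dist (\<omega> j) (\<omega> l)) \<in> borel_measurable ?P" if "j \<in> {1..m}" "l \<in> {1..m}" for j l
    using that by (intro borel_measurable_dist measurable_sample_component)
  define G where "G K \<omega> = kth k (\<lambda>j. dist (\<omega> i) (\<omega> j)) K" for K and \<omega> :: "nat \<Rightarrow> 'a"
  have G: "G K \<in> borel_measurable ?P" if "K \<in> Pow ?J" for K
    unfolding G_def
  proof (rule measurable_kth[OF _ k])
    show "finite K" using that finite_subset[of K ?J] by blast
    show "(\<lambda>\<omega>. dist (\<omega> i) (\<omega> j)) \<in> borel_measurable ?P" if "j \<in> K" for j
      using that \<open>K \<in> Pow ?J\<close> i by (intro d) blast+
  qed
  have ev: "{\<omega> \<in> space ?P. first_occurrences \<omega> ?J = K} \<in> sets ?P" if "K \<in> Pow ?J" for K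
  proof -
    have eq: "{\<omega> \<in> space ?P. first_occurrences \<omega> ?J = K}
      = {\<omega> \<in> space ?P. \<forall>j\<in>?J. (j \<in> K) = (\<forall>l\<in>?J. l < j \<longrightarrow> dist (\<omega> l) (\<omega> j) \<noteq> 0)}"
      unfolding dist_eq_0_iff using first_occurrences_eq_iff[OF PowD[OF that]] by blast
    have fJ: "finite ?J" by simp
    have 1: "Measurable.pred ?P (\<lambda>\<omega>. l < j \<longrightarrow> dist (\<omega> l) (\<omega> j) \<noteq> 0)" if "j \<in> ?J" "l \<in> ?J" for j l
    proof -
      have [measurable]: "(\<lambda>\<omega>. dist (\<omega> l) (\<omega> j)) \<in> borel_measurable ?P" using that by (intro d) auto
      show ?thesis by measurable
    qed
    have 2: "Measurable.pred ?P (\<lambda>\<omega>. \<forall>l\<in>?J. l < j \<longrightarrow> dist (\<omega> l) (\<omega> j) \<noteq> 0)" if "j \<in> ?J" for j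
      by (rule pred_intros_finite(3)[OF fJ 1[OF that]])
    have 3: "Measurable.pred ?P (\<lambda>\<omega>. (j \<in> K) = (\<forall>l\<in>?J. l < j \<longrightarrow> dist (\<omega> l) (\<omega> j) \<noteq> 0))" if "j \<in> ?J" for j
    proof (rule pred_intros_logic(6)[OF _ 2[OF that]])
      show "Measurable.pred ?P (\<lambda>\<omega>. j \<in> K)" by (rule measurable_const) simp
    qed
    have "Measurable.pred ?P (\<lambda>\<omega>. \<forall>j\<in>?J. (j \<in> K) = (\<forall>l\<in>?J. l < j \<longrightarrow> dist (\<omega> l) (\<omega> j) \<noteq> 0))"
      by (rule pred_intros_finite(3)[OF fJ 3])
    then show ?thesis unfolding eq pred_def .
  qed
  have "(\<lambda>\<omega>. \<Sum>K\<in>Pow ?J. indicator {\<omega> \<in> space ?P. first_occurrences \<omega> ?J = K} \<omega> * G K \<omega>) \<in> borel_measurable ?P"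
    using ev G by (intro borel_measurable_sum borel_measurable_times borel_measurable_indicator)
  moreover have "(\<Sum>K\<in>Pow ?J. indicator {\<omega> \<in> space ?P. first_occurrences \<omega> ?J = K} \<omega> * G K \<omega>) = knn_dist k (\<omega> i) (\<omega> ` ?J)"
    if "\<omega> \<in> space ?P" for \<omega>
  proof -
    have "first_occurrences \<omega> ?J \<in> Pow ?J" by (auto simp: first_occurrences_def)
    then have "(\<Sum>K\<in>Pow ?J. if first_occurrences \<omega> ?J = K then G K \<omega> else 0) = G (first_occurrences \<omega> ?J) \<omega>"
      using fin by (simp only: sum.delta' if_True)
    moreover have "indicator {\<omega> \<in> space ?P. first_occurrences \<omega> ?J = K} \<omega> * G K \<omega> = (if first_occurrences \<omega> ?J = K then G K \<omega> else 0)" for K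
      using that by (simp add: indicator_def)
    ultimately show ?thesis by (simp only: G_def knn_dist_first_occurrences)
  qed
  ultimately have kd: "(\<lambda>\<omega>. knn_dist k (\<omega> i) (\<omega> ` ?J)) \<in> borel_measurable ?P"
    by (rule measurable_cong[THEN iffD1, rotated])
  show ?thesis
    unfolding U_stat_def measure_ball
    by (intro borel_measurable_times borel_measurable_const measurable_compose[OF kd ball_volume_measurable])
qed

context
  fixes p :: "'a::euclidean_space \<Rightarrow> real"
  assumes p: "prob_density p"
begin

text \<open>The factor \<open>card I - 1\<close> is kept when a point is removed, so that \<open>T - g l\<close> only involves the summands that
\<open>l\<close> affects. Cauchy--Schwarz bounds the square of this difference by the number of its terms, at most \<open>1 + c * k\<close>, times the
sum of squares. Summing over \<open>l\<close> counts each \<open>i\<close> at most \<open>k\<close> times.\<close>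

lemma variance_bound:
  fixes \<phi> :: "real \<Rightarrow> real" and I :: "nat set" and k :: nat
  defines "P \<equiv> PiM I (\<lambda>_. law p)"
  defines "V \<equiv> \<lambda>k \<omega> i J. (real (card I - 1)) * ball_volume TYPE('a) (nn_dist k \<omega> i J)"
  assumes \<phi>: "\<phi> \<in> borel_measurable borel" and k: "1 \<le> k" and I: "finite I" "Suc k < card I"
    and AB: "0 \<le> A"
      "\<And>i. i \<in> I \<Longrightarrow> (\<integral>\<^sup>+ \<omega>. ennreal ((\<phi> (V k \<omega> i (I - {i})))\<^sup>2) \<partial>P) \<le> ennreal A"
      "\<And>i. i \<in> I \<Longrightarrow> (\<integral>\<^sup>+ \<omega>. ennreal ((\<phi> (V (Suc k) \<omega> i (I - {i})))\<^sup>2) \<partial>P) \<le> ennreal A"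
    and c: "\<forall>(x :: nat \<Rightarrow> 'a) I k l. finite I \<longrightarrow> 1 \<le> k \<longrightarrow> k < card I \<longrightarrow> l \<in> I
       \<longrightarrow> (\<forall>i\<in>I - {l}. x i \<noteq> x l)
       \<longrightarrow> card {i \<in> I - {l}. dist (x i) (x l) \<le> nn_dist k x i (I - {i})} \<le> c * k"
  shows "integrable P (\<lambda>\<omega>. (1 / real (card I) * (\<Sum>i\<in>I. \<phi> (V k \<omega> i (I - {i}))))\<^sup>2)"
    and "(\<integral>\<omega>. (1 / real (card I) * (\<Sum>i\<in>I. \<phi> (V k \<omega> i (I - {i}))))\<^sup>2 \<partial>P)
      - (\<integral>\<omega>. 1 / real (card I) * (\<Sum>i\<in>I. \<phi> (V k \<omega> i (I - {i}))) \<partial>P)\<^sup>2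
      \<le> 2 * (1 + real (c * k)) * (1 + 2 * real k) * (A / real (card I))"
proof -
  interpret P: prob_space P unfolding P_def by (intro prob_space_PiM prob_space_law p)
  define n where "n = card I"
  have n: "0 < n" using I by (simp add: n_def)
  define a where "a i \<omega> = \<phi> (V k \<omega> i (I - {i}))" for i \<omega>
  define a' where "a' i \<omega> = \<phi> (V (Suc k) \<omega> i (I - {i}))" for i \<omega>
  define r where "r l i \<omega> = \<phi> (V k \<omega> i (I - {i} - {l}))" for l i \<omega>
  define T where "T \<omega> = 1 / real n * (\<Sum>i\<in>I. a i \<omega>)" for \<omega>
  define g where "g l \<omega> = 1 / real n * (\<Sum>i\<in>I - {l}. r l i \<omega>)" for l \<omega>
  have Vm: "(\<lambda>\<omega>. \<phi> (V k' \<omega> i J)) \<in> borel_measurable P" if "1 \<le> k'" "i \<in> I" "J \<subseteq> I" for k' i J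
    unfolding P_def V_def nn_dist_def
    using measurable_compose[OF measurable_nn_vol_joint(1)[OF p I(1) that(2,3,1)] ball_volume_measurable]
    by (intro measurable_compose[OF _ \<phi>] borel_measurable_times borel_measurable_const)
  have am: "a i \<in> borel_measurable P" "a' i \<in> borel_measurable P" if "i \<in> I" for i
    using Vm[of k i "I - {i}"] Vm[of "Suc k" i "I - {i}"] that k by (auto simp: a_def[abs_def] a'_def[abs_def])
  have rm: "r l i \<in> borel_measurable P" if "i \<in> I" for l i
    using Vm[of k i "I - {i} - {l}"] that k by (auto simp: r_def[abs_def])
  have a2: "integrable P (\<lambda>\<omega>. (a i \<omega>)\<^sup>2)" "(\<integral>\<omega>. (a i \<omega>)\<^sup>2 \<partial>P) \<le> A" if "i \<in> I" for i
  proof -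
    have "(\<lambda>\<omega>. (a i \<omega>)\<^sup>2) \<in> borel_measurable P" by (intro borel_measurable_power am that)
    note b = nn_integral_real_bound[OF this zero_le_power2 AB(1) AB(2)[OF that, folded a_def]]
    show "integrable P (\<lambda>\<omega>. (a i \<omega>)\<^sup>2)" "(\<integral>\<omega>. (a i \<omega>)\<^sup>2 \<partial>P) \<le> A" by (rule b)+
  qed
  have a'2: "integrable P (\<lambda>\<omega>. (a' i \<omega>)\<^sup>2)" "(\<integral>\<omega>. (a' i \<omega>)\<^sup>2 \<partial>P) \<le> A" if "i \<in> I" for i
  proof -
    have "(\<lambda>\<omega>. (a' i \<omega>)\<^sup>2) \<in> borel_measurable P" by (intro borel_measurable_power am that)
    note b = nn_integral_real_bound[OF this zero_le_power2 AB(1) AB(3)[OF that, folded a'_def]]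
    show "integrable P (\<lambda>\<omega>. (a' i \<omega>)\<^sup>2)" "(\<integral>\<omega>. (a' i \<omega>)\<^sup>2 \<partial>P) \<le> A" by (rule b)+
  qed
  have kJ: "finite (I - {i})" "k < card (I - {i})" if "i \<in> I" for i using that I by auto
  have r_cases: "r l i \<omega> = a i \<omega> \<or> r l i \<omega> = a' i \<omega>" if "i \<in> I" "l \<in> I - {i}" for l i \<omega>
    using kth_remove[OF kJ(1)[OF that(1)] that(2) k kJ(2)[OF that(1)], of "\<lambda>j. dist (\<omega> i) (\<omega> j)"]
    by (auto simp: r_def a_def a'_def V_def nn_dist_def)
  have r2: "integrable P (\<lambda>\<omega>. (r l i \<omega>)\<^sup>2)" if "i \<in> I" "l \<in> I - {i}" for l i
  proof (rule Bochner_Integration.integrable_bound)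
    show "integrable P (\<lambda>\<omega>. (a i \<omega>)\<^sup>2 + (a' i \<omega>)\<^sup>2)" using a2(1)[OF that(1)] a'2(1)[OF that(1)] by auto
    show "(\<lambda>\<omega>. (r l i \<omega>)\<^sup>2) \<in> borel_measurable P" using rm[OF that(1)] by measurable
    show "AE \<omega> in P. norm ((r l i \<omega>)\<^sup>2) \<le> norm ((a i \<omega>)\<^sup>2 + (a' i \<omega>)\<^sup>2)"
      using r_cases[OF that] by (intro AE_I2) (metis abs_of_nonneg add_increasing add_increasing2 order_refl real_norm_def sum_power2_ge_zero zero_le_power2)
  qed
  have Tm: "T \<in> borel_measurable P" unfolding T_def using am by (intro borel_measurable_times borel_measurable_sum) auto
  have T2: "integrable P (\<lambda>\<omega>. (T \<omega>)\<^sup>2)"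
    unfolding T_def power_mult_distrib using am(1) a2(1) I(1)
    by (intro integrable_mult_right integrable_square_sum) auto
  have gm: "g l \<in> borel_measurable P" if "l \<in> I" for l
    unfolding g_def using rm by (intro borel_measurable_times borel_measurable_sum) auto
  have g2: "integrable P (\<lambda>\<omega>. (g l \<omega>)\<^sup>2)" if "l \<in> I" for l
    unfolding g_def power_mult_distrib using rm r2 I(1) that
    by (intro integrable_mult_right integrable_square_sum) auto
  have gupd: "g l (fun_upd \<omega> l y) = g l \<omega>" if "l \<in> I" for l \<omega> y
  proof -
    have "r l i (fun_upd \<omega> l y) = r l i \<omega>" if "i \<in> I - {l}" for i
    proof -
      have "nn_dist k (fun_upd \<omega> l y) i (I - {i} - {l}) = nn_dist k \<omega> i (I - {i} - {l})"
        unfolding nn_dist_def using that by (intro kth_cong) auto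
      then show ?thesis by (simp add: r_def V_def)
    qed
    then show ?thesis by (simp add: g_def)
  qed
  have d2: "integrable P (\<lambda>\<omega>. (T \<omega> - g l \<omega>)\<^sup>2)" if "l \<in> I" for l
    using Tm T2 gm g2 that by (intro integrable_square_diff) auto
  define Q where "Q \<omega> = (\<Sum>i\<in>I. (a i \<omega>)\<^sup>2 + (a' i \<omega>)\<^sup>2)" for \<omega>
  define K where "K = (1 + real (c * k)) * (1 + 2 * real k)"
  have pt: "(\<Sum>l\<in>I. (T \<omega> - g l \<omega>)\<^sup>2) \<le> 1 / (real n)\<^sup>2 * (K * Q \<omega>)"
    if dis: "\<forall>i\<in>I. \<forall>j\<in>I. i \<noteq> j \<longrightarrow> \<omega> i \<noteq> \<omega> j" for \<omega>
  proof -
    define aff where "aff l i \<longleftrightarrow> nn_dist k \<omega> i (I - {i} - {l}) \<noteq> nn_dist k \<omega> i (I - {i})" for l i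
    define S where "S l = {i \<in> I - {l}. aff l i}" for l
    let ?b = "\<lambda>i. 2 * (a i \<omega>)\<^sup>2 + 2 * (a' i \<omega>)\<^sup>2"
    have fS: "finite (S l)" for l using I(1) by (simp add: S_def)
    have Sc: "card (S l) \<le> c * k" if "l \<in> I" for l
    proof -
      have "S l \<subseteq> {i \<in> I - {l}. dist (\<omega> i) (\<omega> l) \<le> nn_dist k \<omega> i (I - {i})}"
      proof
        fix i assume "i \<in> S l"
        then have i: "i \<in> I" "i \<in> I - {l}" "l \<in> I - {i}" "aff l i" using that by (auto simp: S_def)
        then have "dist (\<omega> i) (\<omega> l) \<le> nn_dist k \<omega> i (I - {i})"
          unfolding aff_def nn_dist_def by (intro kth_remove_affects(1)[OF kJ(1)[OF i(1)] i(3) k kJ(2)[OF i(1)]])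
        then show "i \<in> {i \<in> I - {l}. dist (\<omega> i) (\<omega> l) \<le> nn_dist k \<omega> i (I - {i})}" using i(2) by simp
      qed
      then have "card (S l) \<le> card {i \<in> I - {l}. dist (\<omega> i) (\<omega> l) \<le> nn_dist k \<omega> i (I - {i})}"
        using I(1) by (intro card_mono) auto
      also have "\<dots> \<le> c * k" using I k that dis by (intro c[rule_format]) auto
      finally show ?thesis .
    qed
    have one: "(T \<omega> - g l \<omega>)\<^sup>2 \<le> 1 / (real n)\<^sup>2 * ((1 + real (c * k)) * ((a l \<omega>)\<^sup>2 + (\<Sum>i\<in>S l. ?b i)))" if l: "l \<in> I" for l
    proof -
      let ?y = "\<lambda>i. if i = l then a l \<omega> else a i \<omega> - a' i \<omega>"
      have lS: "l \<notin> S l" by (simp add: S_def)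
      have "T \<omega> - g l \<omega> = 1 / real n * (a l \<omega> + (\<Sum>i\<in>I - {l}. a i \<omega> - r l i \<omega>))"
        unfolding T_def g_def using I(1) l by (simp add: sum.remove sum_subtractf algebra_simps)
      also have "(\<Sum>i\<in>I - {l}. a i \<omega> - r l i \<omega>) = (\<Sum>i\<in>S l. a i \<omega> - a' i \<omega>)"
      proof -
        have "(\<Sum>i\<in>I - {l}. a i \<omega> - r l i \<omega>) = (\<Sum>i\<in>S l. a i \<omega> - r l i \<omega>)"
          using I(1) by (intro sum.mono_neutral_right) (auto simp: S_def aff_def a_def r_def V_def)
        also have "\<dots> = (\<Sum>i\<in>S l. a i \<omega> - a' i \<omega>)"
        proof (intro sum.cong refl)
          fix i assume i: "i \<in> S l"
          then have i': "i \<in> I" "l \<in> I - {i}" "aff l i" using l by (auto simp: S_def)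
          then have "nn_dist k \<omega> i (I - {i} - {l}) = nn_dist (Suc k) \<omega> i (I - {i})"
            unfolding aff_def nn_dist_def by (intro kth_remove_affects(2)[OF kJ(1)[OF i'(1)] i'(2) k kJ(2)[OF i'(1)]])
          then show "a i \<omega> - r l i \<omega> = a i \<omega> - a' i \<omega>" by (simp add: r_def a'_def V_def)
        qed
        finally show ?thesis .
      qed
      also have "a l \<omega> + (\<Sum>i\<in>S l. a i \<omega> - a' i \<omega>) = (\<Sum>i\<in>insert l (S l). ?y i)"
        using fS[of l] lS by (simp, intro sum.cong) auto
      finally have sq: "(T \<omega> - g l \<omega>)\<^sup>2 = 1 / (real n)\<^sup>2 * (\<Sum>i\<in>insert l (S l). ?y i)\<^sup>2"
        by (simp add: power_mult_distrib power_divide)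
      have "(\<Sum>i\<in>insert l (S l). ?y i)\<^sup>2 \<le> real (card (insert l (S l))) * (\<Sum>i\<in>insert l (S l). (?y i)\<^sup>2)"
        using sum_squared_le_sum_of_squares[of ?y "insert l (S l)"] by (simp only: mult.commute)
      also have "\<dots> \<le> (1 + real (c * k)) * (\<Sum>i\<in>insert l (S l). (?y i)\<^sup>2)"
      proof (intro mult_right_mono)
        show "real (card (insert l (S l))) \<le> 1 + real (c * k)"
          using Sc[OF l] fS[of l] lS by simp (metis of_nat_le_iff of_nat_mult)
      qed (simp add: sum_nonneg)
      also have "(\<Sum>i\<in>insert l (S l). (?y i)\<^sup>2) = (a l \<omega>)\<^sup>2 + (\<Sum>i\<in>S l. (a i \<omega> - a' i \<omega>)\<^sup>2)"
        using fS[of l] lS by (simp, intro sum.cong) auto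
      also have "(1 + real (c * k)) * ((a l \<omega>)\<^sup>2 + (\<Sum>i\<in>S l. (a i \<omega> - a' i \<omega>)\<^sup>2))
          \<le> (1 + real (c * k)) * ((a l \<omega>)\<^sup>2 + (\<Sum>i\<in>S l. ?b i))"
      proof (intro mult_left_mono add_left_mono sum_mono)
        fix i show "(a i \<omega> - a' i \<omega>)\<^sup>2 \<le> ?b i"
          using zero_le_power2[of "a i \<omega> + a' i \<omega>"] by (simp add: power2_diff power2_sum)
      qed simp
      finally show ?thesis unfolding sq by (intro mult_left_mono) auto
    qed
    \<comment> \<open>double counting of the pairs in which \<open>l\<close> affects \<open>i\<close>\<close>
    have sw: "(\<Sum>l\<in>I. \<Sum>i\<in>S l. ?b i) \<le> (\<Sum>i\<in>I. real k * ?b i)"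
    proof -
      have "(\<Sum>l\<in>I. \<Sum>i\<in>S l. ?b i) = (\<Sum>l\<in>I. \<Sum>i\<in>I. if i \<in> S l then ?b i else 0)"
      proof (rule sum.cong[OF refl])
        fix l
        have "I \<inter> S l = S l" by (auto simp: S_def)
        then show "(\<Sum>i\<in>S l. ?b i) = (\<Sum>i\<in>I. if i \<in> S l then ?b i else 0)"
          using sum.inter_restrict[OF I(1), of ?b "S l"] by (simp only:)
      qed
      also have "\<dots> = (\<Sum>i\<in>I. \<Sum>l\<in>I. if i \<in> S l then ?b i else 0)" by (rule sum.swap)
      also have "\<dots> = (\<Sum>i\<in>I. real (card {l \<in> I. i \<in> S l}) * ?b i)"
        using I(1) by (simp add: sum.If_cases Int_def)
      also have "\<dots> \<le> (\<Sum>i\<in>I. real k * ?b i)"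
      proof (intro sum_mono mult_right_mono)
        fix i assume i: "i \<in> I"
        have eq: "{l \<in> I. i \<in> S l} = {l \<in> I - {i}. kth k (\<lambda>j. dist (\<omega> i) (\<omega> j)) (I - {i} - {l}) \<noteq> kth k (\<lambda>j. dist (\<omega> i) (\<omega> j)) (I - {i})}"
          using i by (auto simp: S_def aff_def nn_dist_def)
        have "card {l \<in> I. i \<in> S l} \<le> k" unfolding eq by (rule card_kth_affects[OF kJ(1)[OF i] k kJ(2)[OF i]])
        then show "real (card {l \<in> I. i \<in> S l}) \<le> real k" by simp
      qed simp
      finally show ?thesis .
    qed
    have "(\<Sum>l\<in>I. (T \<omega> - g l \<omega>)\<^sup>2) \<le> (\<Sum>l\<in>I. 1 / (real n)\<^sup>2 * ((1 + real (c * k)) * ((a l \<omega>)\<^sup>2 + (\<Sum>i\<in>S l. ?b i))))"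
      by (intro sum_mono one)
    also have "\<dots> = 1 / (real n)\<^sup>2 * ((1 + real (c * k)) * ((\<Sum>l\<in>I. (a l \<omega>)\<^sup>2) + (\<Sum>l\<in>I. \<Sum>i\<in>S l. ?b i)))"
      by (simp only: sum_distrib_left[symmetric] sum.distrib)
    also have "\<dots> \<le> 1 / (real n)\<^sup>2 * ((1 + real (c * k)) * ((1 + 2 * real k) * Q \<omega>))"
    proof (intro mult_left_mono)
      have "(\<Sum>l\<in>I. (a l \<omega>)\<^sup>2) \<le> Q \<omega>" unfolding Q_def by (intro sum_mono) simp
      moreover have "(\<Sum>i\<in>I. real k * ?b i) = 2 * real k * Q \<omega>"
        unfolding Q_def sum_distrib_left by (intro sum.cong) (auto simp: algebra_simps)
      ultimately show "(\<Sum>l\<in>I. (a l \<omega>)\<^sup>2) + (\<Sum>l\<in>I. \<Sum>i\<in>S l. ?b i) \<le> (1 + 2 * real k) * Q \<omega>"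
        using sw by (simp add: distrib_right)
    qed auto
    finally show ?thesis by (simp add: K_def mult.assoc)
  qed
  have Qi: "integrable P Q" "(\<integral>\<omega>. Q \<omega> \<partial>P) \<le> 2 * real n * A"
  proof -
    show "integrable P Q" unfolding Q_def using a2(1) a'2(1) by (intro Bochner_Integration.integrable_sum Bochner_Integration.integrable_add) auto
    have "(\<integral>\<omega>. Q \<omega> \<partial>P) = (\<Sum>i\<in>I. (\<integral>\<omega>. (a i \<omega>)\<^sup>2 \<partial>P) + (\<integral>\<omega>. (a' i \<omega>)\<^sup>2 \<partial>P))"
      unfolding Q_def using a2(1) a'2(1) by (subst Bochner_Integration.integral_sum) auto
    also have "\<dots> \<le> (\<Sum>i\<in>I. A + A)" using a2(2) a'2(2) by (intro sum_mono add_mono) auto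
    finally show "(\<integral>\<omega>. Q \<omega> \<partial>P) \<le> 2 * real n * A" by (simp add: n_def algebra_simps)
  qed
  have dis: "AE \<omega> in P. \<forall>i\<in>I. \<forall>j\<in>I. i \<noteq> j \<longrightarrow> \<omega> i \<noteq> \<omega> j"
    unfolding P_def by (rule AE_distinct[OF p I(1)])
  have "(\<integral>\<omega>. (T \<omega>)\<^sup>2 \<partial>P) - (\<integral>\<omega>. T \<omega> \<partial>P)\<^sup>2 \<le> (\<Sum>l\<in>I. \<integral>\<omega>. (T \<omega> - g l \<omega>)\<^sup>2 \<partial>P)"
    unfolding P_def
    by (rule efron_stein[OF prob_space_law[OF p] I(1) Tm[unfolded P_def] T2[unfolded P_def]
          gm[unfolded P_def] g2[unfolded P_def] gupd])
  also have "\<dots> = (\<integral>\<omega>. (\<Sum>l\<in>I. (T \<omega> - g l \<omega>)\<^sup>2) \<partial>P)"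
    using d2 by (intro Bochner_Integration.integral_sum[symmetric])
  also have "\<dots> \<le> (\<integral>\<omega>. 1 / (real n)\<^sup>2 * (K * Q \<omega>) \<partial>P)"
  proof (rule integral_mono_AE)
    show "AE \<omega> in P. (\<Sum>l\<in>I. (T \<omega> - g l \<omega>)\<^sup>2) \<le> 1 / (real n)\<^sup>2 * (K * Q \<omega>)"
      using dis by eventually_elim (rule pt)
    show "integrable P (\<lambda>\<omega>. \<Sum>l\<in>I. (T \<omega> - g l \<omega>)\<^sup>2)" using d2 by (intro Bochner_Integration.integrable_sum)
    show "integrable P (\<lambda>\<omega>. 1 / (real n)\<^sup>2 * (K * Q \<omega>))" using Qi(1) by (intro integrable_mult_right)
  qed
  also have "\<dots> = 1 / (real n)\<^sup>2 * (K * (\<integral>\<omega>. Q \<omega> \<partial>P))" by simp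
  also have "\<dots> \<le> 1 / (real n)\<^sup>2 * (K * (2 * real n * A))"
    using Qi(2) by (intro mult_left_mono) (auto simp: K_def)
  also have "\<dots> = 2 * (1 + real (c * k)) * (1 + 2 * real k) * (A / real n)"
    using n by (simp add: K_def power2_eq_square field_simps)
  finally show "(\<integral>\<omega>. (1 / real (card I) * (\<Sum>i\<in>I. \<phi> (V k \<omega> i (I - {i}))))\<^sup>2 \<partial>P)
      - (\<integral>\<omega>. 1 / real (card I) * (\<Sum>i\<in>I. \<phi> (V k \<omega> i (I - {i}))) \<partial>P)\<^sup>2
      \<le> 2 * (1 + real (c * k)) * (1 + 2 * real k) * (A / real (card I))"
    by (simp only: T_def a_def n_def)
  show "integrable P (\<lambda>\<omega>. (1 / real (card I) * (\<Sum>i\<in>I. \<phi> (V k \<omega> i (I - {i}))))\<^sup>2)"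
    using T2 by (simp only: T_def a_def n_def)
qed

end

section \<open>Convergence of the variance\<close>

text \<open>Measurability of \<open>\<phi>\<close> on the positive half-line comes from the existence of its Laplace transform.\<close>

lemma estimator_function_measurable:
  assumes "estimator_function f k \<phi>"
  shows "(\<lambda>u. if 0 < u then \<phi> u else \<phi> 0) \<in> borel_measurable borel"
proof -
  define F where "F u = indicator {0<..} u * (u ^ (k - 1) * \<phi> u * exp (- u))" for u :: real
  have "set_integrable lborel {0<..} (\<lambda>u. u ^ (k - 1) * \<phi> u * exp (- 1 * u))"
    using assms unfolding estimator_function_def by (metis zero_less_one)
  then have F: "F \<in> borel_measurable borel"
    unfolding set_integrable_def F_def[abs_def] by (auto dest: borel_measurable_integrable)
  have "(\<lambda>u. if 0 < u then \<phi> u else \<phi> 0) = (\<lambda>u. if 0 < u then F u * exp u / u ^ (k - 1) else \<phi> 0)"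
    by (auto simp: F_def fun_eq_iff exp_minus field_simps)
  also have "\<dots> \<in> borel_measurable borel" using F by measurable
  finally show ?thesis .
qed

lemma U_stat_nonneg: "1 \<le> m \<Longrightarrow> 0 \<le> U_stat k m x i"
  by (simp add: U_stat_def)

lemma T_hat_cong_pos:
  assumes "\<And>u. 0 \<le> u \<Longrightarrow> \<phi> u = \<phi>' u" shows "T_hat \<phi> k m x = T_hat \<phi>' k m x"
proof -
  have "\<phi> (U_stat k m x i) = \<phi>' (U_stat k m x i)" if "i \<in> {1..m}" for i
    using that by (intro assms U_stat_nonneg) simp
  then show ?thesis by (simp add: T_hat_def)
qed

lemma T_hat_cong:
  assumes "\<And>i. i \<in> {1..m} \<Longrightarrow> x i = y i" shows "T_hat \<phi> k m x = T_hat \<phi> k m y"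
proof -
  have "U_stat k m x i = U_stat k m y i" if "i \<in> {1..m}" for i
  proof -
    have "x ` ({1..m} - {i}) = y ` ({1..m} - {i})" using assms by (intro image_cong) auto
    then show ?thesis using assms[OF that] by (simp only: U_stat_def)
  qed
  then show ?thesis by (simp add: T_hat_def)
qed

lemma distr_sample:
  assumes M: "prob_space M" and iid: "iid_with_density M X p" and m: "1 \<le> m"
  shows "(\<lambda>\<omega>. \<lambda>i\<in>{1..m}. X i \<omega>) \<in> measurable M (PiM {1..m} (\<lambda>_. borel))"
    and "distr M (PiM {1..m} (\<lambda>_. borel)) (\<lambda>\<omega>. \<lambda>i\<in>{1..m}. X i \<omega>) = PiM {1..m} (\<lambda>_. law p)"
proof -
  interpret prob_space M by (rule M)
  have d: "distributed M lborel (X i) (\<lambda>x. ennreal (p x))" if "i \<in> {1..m}" for i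
    using iid that by (simp add: iid_with_density_def)
  have rv: "X i \<in> borel_measurable M" if "i \<in> {1..m}" for i
    using distributed_measurable[OF d[OF that]] by simp
  show "(\<lambda>\<omega>. \<lambda>i\<in>{1..m}. X i \<omega>) \<in> measurable M (PiM {1..m} (\<lambda>_. borel))"
    by (intro measurable_restrict rv)
  have "indep_vars (\<lambda>_. borel) X {1..m}"
    using iid unfolding iid_with_density_def by (auto intro: indep_vars_subset)
  moreover have "{1..m} \<noteq> {}" using m by simp
  ultimately have "distr M (PiM {1..m} (\<lambda>_. borel)) (\<lambda>\<omega>. \<lambda>i\<in>{1..m}. X i \<omega>) = PiM {1..m} (\<lambda>i. distr M borel (X i))"
    using indep_vars_iff_distr_eq_PiM'[of "{1..m}" X "\<lambda>_. borel"] rv by blast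
  also have "\<dots> = PiM {1..m} (\<lambda>_. law p)"
  proof (intro PiM_cong refl)
    fix i assume "i \<in> {1..m}"
    from distributed_distr_eq_density[OF d[OF this]]
    show "distr M borel (X i) = law p"
      by (simp add: law_def cong: distr_cong)
  qed
  finally show "distr M (PiM {1..m} (\<lambda>_. borel)) (\<lambda>\<omega>. \<lambda>i\<in>{1..m}. X i \<omega>) = PiM {1..m} (\<lambda>_. law p)" .
qed

text \<open>The statistic is almost surely the average over index families, and its moments depend only on the joint
law of the first \<open>m\<close> sample points, a product measure.\<close>

lemma T_hat_moments_product:
  fixes M :: "'w measure" and X :: "nat \<Rightarrow> 'w \<Rightarrow> 'a::euclidean_space" and \<phi> :: "real \<Rightarrow> real"
  assumes M: "prob_space M" and p: "prob_density p" and iid: "iid_with_density M X p"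
    and \<phi>: "\<phi> \<in> borel_measurable borel" and k: "1 \<le> k" and m: "1 \<le> m"
  defines "T \<equiv> \<lambda>\<omega> :: nat \<Rightarrow> 'a. 1 / real (card {1..m}) *
      (\<Sum>i\<in>{1..m}. \<phi> (real (card {1..m} - 1) * ball_volume TYPE('a) (nn_dist k \<omega> i ({1..m} - {i}))))"
  shows "(\<lambda>\<omega>. T_hat \<phi> k m (\<lambda>i. X i \<omega>)) \<in> borel_measurable M"
    and "integrable M (\<lambda>\<omega>. (T_hat \<phi> k m (\<lambda>i. X i \<omega>))\<^sup>2) \<longleftrightarrow> integrable (PiM {1..m} (\<lambda>_. law p)) (\<lambda>\<omega>. (T \<omega>)\<^sup>2)"
    and "(\<integral>\<omega>. T_hat \<phi> k m (\<lambda>i. X i \<omega>) \<partial>M) = (\<integral>\<omega>. T \<omega> \<partial>PiM {1..m} (\<lambda>_. law p))"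
    and "(\<integral>\<omega>. (T_hat \<phi> k m (\<lambda>i. X i \<omega>))\<^sup>2 \<partial>M) = (\<integral>\<omega>. (T \<omega>)\<^sup>2 \<partial>PiM {1..m} (\<lambda>_. law p))"
proof -
  let ?P = "PiM {1..m} (\<lambda>_. law p)" and ?B = "PiM {1..m} (\<lambda>_. borel) :: (nat \<Rightarrow> 'a) measure"
  define R where "R \<omega> = (\<lambda>i\<in>{1..m}. X i \<omega>)" for \<omega>
  note R = distr_sample[OF M iid m, folded R_def]
  have sets: "sets ?P = sets ?B" by (intro sets_PiM_cong) simp_all
  have Th: "T_hat \<phi> k m \<in> borel_measurable ?P"
    unfolding T_hat_def[abs_def]
    by (intro borel_measurable_times borel_measurable_const borel_measurable_sum
        measurable_compose[OF measurable_U_stat[OF _ k] \<phi>])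
  then have Tb: "T_hat \<phi> k m \<in> borel_measurable ?B" by (simp only: measurable_cong_sets[OF sets refl])
  then have Tb2: "(\<lambda>\<omega>. (T_hat \<phi> k m \<omega>)\<^sup>2) \<in> borel_measurable ?B" by measurable
  have XR: "T_hat \<phi> k m (\<lambda>i. X i \<omega>) = T_hat \<phi> k m (R \<omega>)" for \<omega>
    by (intro T_hat_cong) (simp add: R_def)
  have Tm: "T \<in> borel_measurable ?P"
    unfolding T_def nn_dist_def
    by (intro borel_measurable_times borel_measurable_const borel_measurable_sum
        measurable_compose[OF _ \<phi>] measurable_compose[OF _ ball_volume_measurable]
        measurable_nn_vol_joint(1)[OF p finite_atLeastAtMost _ Diff_subset k])
  have ae: "AE \<omega> in ?P. T_hat \<phi> k m \<omega> = T \<omega>"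
    using AE_distinct[OF p finite_atLeastAtMost]
  proof eventually_elim
    case (elim \<omega>)
    have "U_stat k m \<omega> i = real (card {1..m} - 1) * ball_volume TYPE('a) (nn_dist k \<omega> i ({1..m} - {i}))"
      if i: "i \<in> {1..m}" for i
    proof -
      have "inj_on \<omega> ({1..m} - {i})" using elim by (auto simp: inj_on_def)
      then have "U_stat k m \<omega> i = nn_vol k (\<omega> i) \<omega> ({1..m} - {i})" by (rule U_stat_eq_nn_vol[OF i])
      moreover have "card ({1..m} - {i}) = card {1..m} - 1" by (rule card_Diff_singleton[OF i])
      ultimately show ?thesis by (simp only: nn_vol_def nn_dist_def)
    qed
    then show ?case by (simp add: T_hat_def T_def)
  qed
  have ae2: "AE \<omega> in ?P. (T_hat \<phi> k m \<omega>)\<^sup>2 = (T \<omega>)\<^sup>2" using ae by eventually_elim simp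
  show "(\<lambda>\<omega>. T_hat \<phi> k m (\<lambda>i. X i \<omega>)) \<in> borel_measurable M"
    unfolding XR by (rule measurable_compose[OF R(1) Tb])
  show "integrable M (\<lambda>\<omega>. (T_hat \<phi> k m (\<lambda>i. X i \<omega>))\<^sup>2) \<longleftrightarrow> integrable ?P (\<lambda>\<omega>. (T \<omega>)\<^sup>2)"
    unfolding XR integrable_distr_eq[OF R(1) Tb2, symmetric] R(2)
    using ae2 by (intro integrable_cong_AE borel_measurable_power Th Tm)
  show "(\<integral>\<omega>. T_hat \<phi> k m (\<lambda>i. X i \<omega>) \<partial>M) = (\<integral>\<omega>. T \<omega> \<partial>?P)"
    unfolding XR integral_distr[OF R(1) Tb, symmetric] R(2)
    using ae by (intro integral_cong_AE Th Tm)
  show "(\<integral>\<omega>. (T_hat \<phi> k m (\<lambda>i. X i \<omega>))\<^sup>2 \<partial>M) = (\<integral>\<omega>. (T \<omega>)\<^sup>2 \<partial>?P)"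
    unfolding XR integral_distr[OF R(1) Tb2, symmetric] R(2)
    using ae2 by (intro integral_cong_AE borel_measurable_power Th Tm)
qed

theorem mainTheorem2:
  fixes M :: "'w measure"
    and X :: "nat \<Rightarrow> 'w \<Rightarrow> real ^ 'd"
    and p :: "real ^ 'd \<Rightarrow> real"
    and f \<phi> :: "real \<Rightarrow> real"
    and a b C :: real
    and k :: nat
  assumes "prob_space M"
    and "prob_density p"
    and "iid_with_density M X p"
    and "k \<ge> 1" and "real k > - 2 * a"
    and "estimator_function f k \<phi>"
    and "\<And>u. u > 0 \<Longrightarrow> \<bar>\<phi> u\<bar> \<le> C * envelope a b u"
    and "property_U p k a"
    and "property_L p (\<lambda>t. t\<^sup>2) b"
  shows "(\<forall>\<^sub>F m in sequentially.
            integrable M (\<lambda>\<omega>. T_hat \<phi> k m (\<lambda>i. X i \<omega>)) \<and>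
            integrable M (\<lambda>\<omega>. (T_hat \<phi> k m (\<lambda>i. X i \<omega>))\<^sup>2)) \<and>
         (\<lambda>m. prob_space.variance M (\<lambda>\<omega>. T_hat \<phi> k m (\<lambda>i. X i \<omega>))) \<longlonglongrightarrow> 0"
proof -
  note p = assms(2) and k = assms(4)
  interpret prob_space M by (rule assms(1))
  \<comment> \<open>Volumes are nonnegative, so the values of \<open>\<phi>\<close> at negative arguments can be changed to make it Borel.\<close>
  define \<phi>' where "\<phi>' u = (if 0 < u then \<phi> u else \<phi> 0)" for u
  have \<phi>': "\<phi>' \<in> borel_measurable borel"
    unfolding \<phi>'_def[abs_def] by (rule estimator_function_measurable[OF assms(6)])
  have env: "\<bar>\<phi>' u\<bar> \<le> C * envelope a b u" if "u > 0" for u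
    using assms(7)[OF that] that by (simp add: \<phi>'_def)
  define T where "T m \<omega> = T_hat \<phi> k m (\<lambda>i. X i \<omega>)" for m \<omega>
  have T: "T m = (\<lambda>\<omega>. T_hat \<phi>' k m (\<lambda>i. X i \<omega>))" for m
    unfolding T_def by (intro ext T_hat_cong_pos) (auto simp: \<phi>'_def)
  obtain c where c: "\<forall>(x :: nat \<Rightarrow> real ^ 'd) I k l. finite I \<longrightarrow> 1 \<le> k \<longrightarrow> k < card I \<longrightarrow> l \<in> I
       \<longrightarrow> (\<forall>i\<in>I - {l}. x i \<noteq> x l)
       \<longrightarrow> card {i \<in> I - {l}. dist (x i) (x l) \<le> nn_dist k x i (I - {i})} \<le> c * k"
    using card_reverse_neighbours[where 'a = "real ^ 'd"] by (rule exE)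
  have ka: "- (2 * a) < real k" using assms(5) by simp
  obtain e1 where e1: "e1 \<longlonglongrightarrow> 0" "\<forall>\<^sub>F m in sequentially. 0 \<le> e1 m \<and> (\<forall>i\<in>{1..m}.
     (\<integral>\<^sup>+ \<omega>. ennreal ((\<phi>' (nn_vol k (\<omega> i) \<omega> ({1..m} - {i})))\<^sup>2) \<partial>PiM {1..m} (\<lambda>_. law p)) \<le> ennreal (real m * e1 m))"
    using phi_moment[OF p k order_refl ka \<phi>' env assms(8,9)] by blast
  obtain e2 where e2: "e2 \<longlonglongrightarrow> 0" "\<forall>\<^sub>F m in sequentially. 0 \<le> e2 m \<and> (\<forall>i\<in>{1..m}.
     (\<integral>\<^sup>+ \<omega>. ennreal ((\<phi>' (nn_vol (Suc k) (\<omega> i) \<omega> ({1..m} - {i})))\<^sup>2) \<partial>PiM {1..m} (\<lambda>_. law p)) \<le> ennreal (real m * e2 m))"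
    using phi_moment[OF p k le_SucI[OF order_refl] ka \<phi>' env assms(8,9)] by blast
  define B where "B = 2 * (1 + real (c * k)) * (1 + 2 * real k)"
  have main: "\<forall>\<^sub>F m in sequentially. integrable M (T m) \<and> integrable M (\<lambda>\<omega>. (T m \<omega>)\<^sup>2) \<and>
      variance (T m) \<le> B * (e1 m + e2 m)"
    using e1(2) e2(2) eventually_gt_at_top[of "Suc k"]
  proof eventually_elim
    case (elim m)
    let ?P = "PiM {1..m} (\<lambda>_. law p)"
    let ?V = "\<lambda>k \<omega> i J. real (card {1..m} - 1) * ball_volume TYPE(real ^ 'd) (nn_dist k \<omega> i J)"
    have m: "1 \<le> m" "Suc k < card {1..m}" using elim by auto
    have V: "?V l \<omega> i ({1..m} - {i}) = nn_vol l (\<omega> i) \<omega> ({1..m} - {i})" if i: "i \<in> {1..m}" for l i and \<omega> :: "nat \<Rightarrow> real ^ 'd"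
      unfolding nn_vol_def nn_dist_def card_Diff_singleton[OF i] ..
    define A where "A = real m * (e1 m + e2 m)"
    have A0: "0 \<le> A" using elim by (simp add: A_def)
    have A1: "(\<integral>\<^sup>+ \<omega>. ennreal ((\<phi>' (?V k \<omega> i ({1..m} - {i})))\<^sup>2) \<partial>?P) \<le> ennreal A" if i: "i \<in> {1..m}" for i
    proof -
      have "(\<integral>\<^sup>+ \<omega>. ennreal ((\<phi>' (?V k \<omega> i ({1..m} - {i})))\<^sup>2) \<partial>?P) \<le> ennreal (real m * e1 m)"
        unfolding V[OF i] using elim(1) i by blast
      also have "\<dots> \<le> ennreal A" using elim by (intro ennreal_leI) (simp add: A_def mult_left_mono)
      finally show ?thesis .
    qed
    have A2: "(\<integral>\<^sup>+ \<omega>. ennreal ((\<phi>' (?V (Suc k) \<omega> i ({1..m} - {i})))\<^sup>2) \<partial>?P) \<le> ennreal A" if i: "i \<in> {1..m}" for i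
    proof -
      have "(\<integral>\<^sup>+ \<omega>. ennreal ((\<phi>' (?V (Suc k) \<omega> i ({1..m} - {i})))\<^sup>2) \<partial>?P) \<le> ennreal (real m * e2 m)"
        unfolding V[OF i] using elim(2) i by blast
      also have "\<dots> \<le> ennreal A" using elim by (intro ennreal_leI) (simp add: A_def mult_left_mono)
      finally show ?thesis .
    qed
    note vb = variance_bound[OF p \<phi>' k finite_atLeastAtMost m(2) A0 A1 A2 c]
    have T2: "integrable M (\<lambda>\<omega>. (T_hat \<phi>' k m (\<lambda>i. X i \<omega>))\<^sup>2)"
      using vb(1) unfolding T_hat_moments_product(2)[OF assms(1) p assms(3) \<phi>' k m(1)] .
    have T1: "integrable M (\<lambda>\<omega>. T_hat \<phi>' k m (\<lambda>i. X i \<omega>))"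
      by (rule square_integrable_imp_integrable[OF T_hat_moments_product(1)[OF assms(1) p assms(3) \<phi>' k m(1)] T2])
    have "variance (\<lambda>\<omega>. T_hat \<phi>' k m (\<lambda>i. X i \<omega>)) \<le> B * (A / real (card {1..m}))"
      unfolding variance_eq[OF T1 T2]
      unfolding T_hat_moments_product(3,4)[OF assms(1) p assms(3) \<phi>' k m(1)] B_def
      by (rule vb(2))
    also have "A / real (card {1..m}) = e1 m + e2 m" using m(1) by (simp add: A_def)
    finally show ?case using T1 T2 unfolding T by blast
  qed
  have "(\<lambda>m. variance (T m)) \<longlonglongrightarrow> 0"
  proof (rule tendsto_sandwich[where f = "\<lambda>_. 0"])
    show "\<forall>\<^sub>F m in sequentially. 0 \<le> variance (T m)" by (intro always_eventually allI variance_positive)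
    show "\<forall>\<^sub>F m in sequentially. variance (T m) \<le> B * (e1 m + e2 m)" using main by eventually_elim blast
    have "(\<lambda>m. B * (e1 m + e2 m)) \<longlonglongrightarrow> B * (0 + 0)" by (intro tendsto_mult tendsto_add tendsto_const e1(1) e2(1))
    then show "(\<lambda>m. B * (e1 m + e2 m)) \<longlonglongrightarrow> 0" by simp
  qed simp
  moreover have "\<forall>\<^sub>F m in sequentially. integrable M (T m) \<and> integrable M (\<lambda>\<omega>. (T m \<omega>)\<^sup>2)"
    using main by eventually_elim blast
  ultimately show ?thesis unfolding T_def by blast
qed

end
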